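(* If $T\in\mathbf B_\Lambda(\mathcal H)$, then the map $$\Psi_T(f):=\lim_{r\to1}K_{rT}^*[f\otimes I]K_{rT},\qquad f\in C^*(\{S_{i,s}\}),$$ where the limit (as $r\to 1$, $r<1$) is in the operator norm topology, is a (well-defined) completely contractive linear map. Moreover, its restriction to the $\Lambda$-polyball algebra $\mathcal A(\mathbf B_\Lambda)$ is a completely contractive homomorphism. If, in addition, $T$ is a pure $k$-tuple, then $\Psi_T(f)=K_T^*[f\otimes I]K_T$ for all $f\in C^*(\{S_{i,s}\})$.
   Context: Fix integers $k\ge1$, $n_1,\ldots,n_k\ge 1$ and, for $i\ne j$ in $\{1,\ldots,k\}$, an $n_i\times n_j$ matrix $\Lambda_{i,j}=[\lambda_{i,j}(s,t)]$ with entries in $\mathbb T=\{z\in\mathbb C:|z|=1\}$, such that $\lambda_{j,i}(t,s)=\overline{\lambda_{i,j}(s,t)}$. For $T=(T_1,\ldots,T_k)$ with $T_i=[T_{i,1}\cdots T_{i,n_i}]$, $T_{i,s}\in B(\mathcal H)$, let $\Phi_{rT_i}(X):=\sum_{s=1}^{n_i}r^2T_{i,s}XT_{i,s}^*$. The regular $\Lambda$-polyball $\mathbf B_\Lambda(\mathcal H)$ is the set of $T$ with $\sum_sT_{i,s}T_{i,s}^*\le I$ for each $i$, $T_{i,s}T_{j,t}=\lambda_{i,j}(s,t)T_{j,t}T_{i,s}$ for all $i\ne j$, $s,t$, and $(id-\Phi_{rT_1})\circ\cdots\circ(id-\Phi_{rT_k})(I)\ge0$ for all $r\in[0,1)$.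 $T$ is pure if $\Phi_{T_i}^m(I)\to0$ strongly as $m\to\infty$ for each $i$. If $T\in \mathbf B_\Lambda(\mathcal H)$ and $0\le r<1$, then $rT=(rT_1,\ldots,rT_k)$ is a pure element of $\mathbf B_\Lambda(\mathcal H)$. $\mathbb F_{n_i}^+$ is the unital free semigroup with generators $g_1^i,\ldots,g_{n_i}^i$ and neutral element $g_0^i$; $T_{i,\alpha}:=T_{i,p_1}\cdots T_{i,p_m}$ for $\alpha=g^i_{p_1}\cdots g^i_{p_m}$, $T_{i,g_0^i}:=I$. For pure $T\in\mathbf B_\Lambda(\mathcal H)$ the noncommutative Berezin kernel $K_T:\mathcal H\to\ell^2(\mathbb F_{n_1}^+\times\cdots\times\mathbb F_{n_k}^+)\otimes\mathcal H$ is $$K_Th=\sum_{\beta_1\in\mathbb F_{n_1}^+,\ldots,\beta_k\in\mathbb F_{n_k}^+}\chi_{(\beta_1,\ldots,\beta_k)}\otimes\Delta_T(I)^{1/2}T_{k,\beta_k}^*\cdots T_{1,\beta_1}^*h,$$ where $\Delta_T(I)=(id-\Phi_{T_k})\circ\cdots\circ(id-\Phi_{T_1})(I)$ and $\chi_{(\beta_1,\ldots,\beta_k)}$ is the standard basis. The standard $k$-tuple $S=(S_1,\ldots,S_k)$, $S_i=[S_{i,1}\cdots S_{i,n_i}]$, acts on $\ell^2(\mathbb F_{n_1}^+\times\cdots\times\mathbb F_{n_k}^+)$ by $$S_{i,s}\chi_{(\alpha_1,\ldots,\alpha_k)}=\boldsymbol\lambda_{i,1}(s,\alpha_1)\cdots\boldsymbol\lambda_{i,i-1}(s,\alpha_{i-1})\chi_{(\alpha_1,\ldots,\alpha_{i-1},g_s^i\alpha_i,\alpha_{i+1},\ldots,\alpha_k)},$$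 where $\boldsymbol\lambda_{i,j}(s,g^j_{j_1}\cdots g^j_{j_q})=\prod_{b=1}^q\lambda_{i,j}(s,j_b)$, $\boldsymbol\lambda_{i,j}(s,g_0^j)=1$ (no factor if $i=1$). $C^*(\{S_{i,s}\})$ is the $C^*$-algebra generated by all $S_{i,s}$, and $\mathcal A(\mathbf B_\Lambda)$ is the norm-closed non-self-adjoint algebra generated by all $S_{i,s}$ and the identity. *)

theory Defs
  imports "HOL-Analysis.Analysis"
begin

section \<open>Complex Hilbert spaces\<close>

class scaleC =
  fixes scaleC :: "complex \<Rightarrow> 'a \<Rightarrow> 'a" (infixr \<open>*\<^sub>C\<close> 75)

text \<open>The inner product is linear in the first and conjugate linear in the second argument.
  Positive definiteness is part of \<open>norm_eq_sqrt_cinner\<close>, because \<^const>\<open>norm\<close> is a norm and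
  \<^const>\<open>sqrt\<close> is negative on negative reals.\<close>

class chilbert_space = banach + scaleC +
  fixes cinner :: "'a \<Rightarrow> 'a \<Rightarrow> complex"
  assumes scaleR_scaleC: "r *\<^sub>R x = complex_of_real r *\<^sub>C x"
    and scaleC_add_right: "c *\<^sub>C (x + y) = c *\<^sub>C x + c *\<^sub>C y"
    and scaleC_add_left: "(c + d) *\<^sub>C x = c *\<^sub>C x + d *\<^sub>C x"
    and scaleC_scaleC: "c *\<^sub>C d *\<^sub>C x = (c * d) *\<^sub>C x"
    and cinner_commute: "cinner x y = cnj (cinner y x)"
    and cinner_add_left: "cinner (x + y) z = cinner x z + cinner y z"
    and cinner_scaleC_left: "cinner (c *\<^sub>C x) y = c * cinner x y"
    and norm_eq_sqrt_cinner: "norm x = sqrt (Re (cinner x x))"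

lemma cinner_self: "cinner x x = complex_of_real ((norm x)\<^sup>2)" for x :: "'a::chilbert_space"
proof -
  have "cinner x x = cnj (cinner x x)"
    by (rule cinner_commute)
  then have im: "Im (cinner x x) = 0"
    by (metis Reals_cnj_iff complex_is_Real_iff)
  have "0 \<le> sqrt (Re (cinner x x))"
    using norm_ge_zero[of x] by (simp only: norm_eq_sqrt_cinner)
  then have "(norm x)\<^sup>2 = Re (cinner x x)"
    by (simp add: norm_eq_sqrt_cinner[of x])
  with im show ?thesis
    by (simp add: complex_eq_iff)
qed

lemma cinner_add_right: "cinner x (y + z) = cinner x y + cinner x z" for x :: "'a::chilbert_space"
  by (metis cinner_add_left cinner_commute complex_cnj_add)

lemma cinner_scaleC_right: "cinner x (c *\<^sub>C y) = cnj c * cinner x y" for x :: "'a::chilbert_space"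
  by (metis cinner_scaleC_left cinner_commute complex_cnj_mult)

lemma norm_scaleC: "norm (c *\<^sub>C x) = cmod c * norm x" for x :: "'a::chilbert_space"
proof -
  have "cinner (c *\<^sub>C x) (c *\<^sub>C x) = (c * cnj c) * cinner x x"
    by (simp add: cinner_scaleC_left cinner_scaleC_right)
  then have "complex_of_real ((norm (c *\<^sub>C x))\<^sup>2) = complex_of_real ((cmod c * norm x)\<^sup>2)"
    unfolding cinner_self complex_norm_square[symmetric] by (simp add: power_mult_distrib)
  then have "(norm (c *\<^sub>C x))\<^sup>2 = (cmod c * norm x)\<^sup>2"
    by (simp only: of_real_eq_iff)
  then show ?thesis
    by (simp add: power2_eq_iff_nonneg)
qed

lemma Re_cinner_le: "Re (cinner x y) \<le> norm x * norm y" for x :: "'a::chilbert_space"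
proof -
  have "complex_of_real ((norm (x + y))\<^sup>2)
      = complex_of_real ((norm x)\<^sup>2) + complex_of_real ((norm y)\<^sup>2) + (cinner x y + cnj (cinner x y))"
    unfolding cinner_self[symmetric]
    by (simp add: cinner_add_left cinner_add_right cinner_commute[of y x])
  then have "(norm (x + y))\<^sup>2 = (norm x)\<^sup>2 + (norm y)\<^sup>2 + 2 * Re (cinner x y)"
    by (simp add: complex_eq_iff)
  moreover have "(norm (x + y))\<^sup>2 \<le> (norm x + norm y)\<^sup>2"
    by (simp add: norm_triangle_ineq power_mono)
  ultimately show ?thesis
    by (simp add: power2_sum)
qed

lemma norm_cinner_le: "cmod (cinner x y) \<le> norm x * norm y" for x :: "'a::chilbert_space"
proof (cases "cinner x y = 0")
  case False
  define c where "c = cnj (cinner x y) / cmod (cinner x y)"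
  have "cmod c = 1"
    using False by (simp add: c_def norm_divide)
  moreover have "cinner (c *\<^sub>C x) y = complex_of_real (cmod (cinner x y))"
    using False complex_norm_square[of "cinner x y"]
    by (simp add: cinner_scaleC_left c_def field_simps power2_eq_square)
  ultimately show ?thesis
    using Re_cinner_le[of "c *\<^sub>C x" y] by (simp add: norm_scaleC)
qed simp

instantiation complex :: chilbert_space
begin

definition "c *\<^sub>C z = c * z" for c z :: complex

definition "cinner z w = z * cnj w" for z w :: complex

instance
  by standard
    (auto simp: scaleC_complex_def cinner_complex_def algebra_simps scaleR_conv_of_real
      cmod_def power2_eq_square)

end

section \<open>Square-summable families\<close>

text \<open>\<open>('i, 'a) ell2\<close> is \<open>\<ell>\<^sup>2('i; 'a)\<close>. It serves both as \<open>\<ell>\<^sup>2('i)\<close>, with \<open>'a = complex\<close>,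
  and as the Hilbert space tensor product of \<open>\<ell>\<^sup>2('i)\<close> and \<open>'a\<close>.\<close>

typedef (overloaded) ('i, 'a) ell2 =
  "{f :: 'i \<Rightarrow> 'a::chilbert_space. (\<lambda>i. (norm (f i))\<^sup>2) summable_on UNIV}"
  morphisms ell2_coord Abs_ell2
  by (rule exI[of _ "\<lambda>_. 0"]) simp

setup_lifting type_definition_ell2

lemma square_summable_iff:
  "(\<lambda>i. (norm (f i))\<^sup>2) summable_on UNIV
    \<longleftrightarrow> (\<exists>B. \<forall>F. finite F \<longrightarrow> L2_set (\<lambda>i. norm (f i)) F \<le> B)" (is "?L \<longleftrightarrow> ?R")
proof
  assume s: ?L
  have "L2_set (\<lambda>i. norm (f i)) F \<le> sqrt (\<Sum>\<^sub>\<infinity>i. (norm (f i))\<^sup>2)" if "finite F" for F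
    unfolding L2_set_def by (rule real_sqrt_le_mono, rule finite_sum_le_infsum) (use s that in auto)
  then show ?R by blast
next
  assume ?R
  then obtain B where B: "\<And>F. finite F \<Longrightarrow> L2_set (\<lambda>i. norm (f i)) F \<le> B" by blast
  have "sum (\<lambda>i. (norm (f i))\<^sup>2) F \<le> B\<^sup>2" if "finite F" for F
    using power_mono[OF B[OF that], of 2] by (simp add: L2_set_def sum_nonneg)
  then show ?L
    by (intro nonneg_bdd_above_summable_on bdd_aboveI[where M = "B\<^sup>2"]) auto
qed

lemma square_summable_add:
  fixes f g :: "'i \<Rightarrow> 'a::real_normed_vector"
  assumes "(\<lambda>i. (norm (f i))\<^sup>2) summable_on UNIV" "(\<lambda>i. (norm (g i))\<^sup>2) summable_on UNIV"
  shows "(\<lambda>i. (norm (f i + g i))\<^sup>2) summable_on UNIV"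
proof -
  obtain B C where BC: "\<And>F. finite F \<Longrightarrow> L2_set (\<lambda>i. norm (f i)) F \<le> B"
      "\<And>F. finite F \<Longrightarrow> L2_set (\<lambda>i. norm (g i)) F \<le> C"
    using assms unfolding square_summable_iff by blast
  have "L2_set (\<lambda>i. norm (f i + g i)) F \<le> B + C" if "finite F" for F
  proof -
    have "L2_set (\<lambda>i. norm (f i + g i)) F \<le> L2_set (\<lambda>i. norm (f i) + norm (g i)) F"
      by (rule L2_set_mono) (auto intro: norm_triangle_ineq)
    also have "\<dots> \<le> L2_set (\<lambda>i. norm (f i)) F + L2_set (\<lambda>i. norm (g i)) F"
      by (rule L2_set_triangle_ineq)
    finally show ?thesis using BC[OF that] by linarith
  qed
  then show ?thesis unfolding square_summable_iff by blast
qed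

instantiation ell2 :: (type, chilbert_space) real_vector
begin

lift_definition zero_ell2 :: "('a, 'b) ell2" is "\<lambda>_. 0" by simp

lift_definition plus_ell2 :: "('a, 'b) ell2 \<Rightarrow> ('a, 'b) ell2 \<Rightarrow> ('a, 'b) ell2"
  is "\<lambda>f g i. f i + g i" by (rule square_summable_add)

lift_definition uminus_ell2 :: "('a, 'b) ell2 \<Rightarrow> ('a, 'b) ell2" is "\<lambda>f i. - f i" by simp

lift_definition minus_ell2 :: "('a, 'b) ell2 \<Rightarrow> ('a, 'b) ell2 \<Rightarrow> ('a, 'b) ell2"
  is "\<lambda>f g i. f i - g i"
  subgoal for f g using square_summable_add[of f "\<lambda>i. - g i"] by simp
  done

lift_definition scaleR_ell2 :: "real \<Rightarrow> ('a, 'b) ell2 \<Rightarrow> ('a, 'b) ell2" is "\<lambda>r f i. r *\<^sub>R f i"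
  by (simp add: power_mult_distrib summable_on_cmult_right)

instance
  by standard (transfer; simp add: algebra_simps fun_eq_iff)+

end

lemma ell2_eqI: "(\<And>i. ell2_coord x i = ell2_coord y i) \<Longrightarrow> x = y"
  by transfer (rule ext)

instantiation ell2 :: (type, chilbert_space) real_normed_vector
begin

definition norm_ell2 :: "('a, 'b) ell2 \<Rightarrow> real"
  where "norm_ell2 x = sqrt (\<Sum>\<^sub>\<infinity>i. (norm (ell2_coord x i))\<^sup>2)"

definition dist_ell2 :: "('a, 'b) ell2 \<Rightarrow> ('a, 'b) ell2 \<Rightarrow> real"
  where "dist_ell2 x y = norm (x - y)"

definition sgn_ell2 :: "('a, 'b) ell2 \<Rightarrow> ('a, 'b) ell2"
  where "sgn_ell2 x = x /\<^sub>R norm x"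

definition uniformity_ell2 :: "(('a, 'b) ell2 \<times> ('a, 'b) ell2) filter"
  where "uniformity_ell2 = (INF e\<in>{0<..}. principal {(x, y). dist x y < e})"

definition open_ell2 :: "('a, 'b) ell2 set \<Rightarrow> bool"
  where "open_ell2 U = (\<forall>x\<in>U. eventually (\<lambda>(x', y). x' = x \<longrightarrow> y \<in> U) uniformity)"

lemma ell2_summable: "(\<lambda>i. (norm (ell2_coord x i))\<^sup>2) summable_on UNIV"
  using ell2_coord[of x] by simp

lemma L2_set_le_norm_ell2: "finite F \<Longrightarrow> L2_set (\<lambda>i. norm (ell2_coord x i)) F \<le> norm x"
  unfolding L2_set_def norm_ell2_def
  by (rule real_sqrt_le_mono, rule finite_sum_le_infsum) (use ell2_summable in auto)

lemma norm_coord_le_norm_ell2: "norm (ell2_coord x i) \<le> norm x"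
  using L2_set_le_norm_ell2[of "{i}" x] by simp

lemma norm_ell2_leI:
  assumes "\<And>F. finite F \<Longrightarrow> L2_set (\<lambda>i. norm (ell2_coord x i)) F \<le> B"
  shows "norm x \<le> B"
proof -
  have B: "0 \<le> B"
    using assms[of "{}"] by simp
  have "sum (\<lambda>i. (norm (ell2_coord x i))\<^sup>2) F \<le> B\<^sup>2" if "finite F" for F
    using power_mono[OF assms[OF that], of 2] by (simp add: L2_set_def sum_nonneg)
  then have "(\<Sum>\<^sub>\<infinity>i. (norm (ell2_coord x i))\<^sup>2) \<le> B\<^sup>2"
    by (intro infsum_le_finite_sums ell2_summable) auto
  then show ?thesis
    unfolding norm_ell2_def by (rule real_le_lsqrt[OF B])
qed

instance
proof
  fix x y :: "('a, 'b) ell2" and r :: real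
  show "dist x y = norm (x - y)" by (fact dist_ell2_def)
  show "sgn x = x /\<^sub>R norm x" by (fact sgn_ell2_def)
  show "uniformity = (INF e\<in>{0<..}. principal {(x, y). dist (x :: ('a, 'b) ell2) y < e})"
    by (fact uniformity_ell2_def)
  show "open U = (\<forall>x\<in>U. eventually (\<lambda>(x', y). x' = x \<longrightarrow> y \<in> U) uniformity)"
    for U :: "('a, 'b) ell2 set" by (fact open_ell2_def)
  show "norm x = 0 \<longleftrightarrow> x = 0"
  proof
    assume "norm x = 0"
    then have "ell2_coord x i = 0" for i
      using norm_coord_le_norm_ell2[of x i] by simp
    then show "x = 0" by (intro ell2_eqI) (simp add: zero_ell2.rep_eq)
  qed (simp add: norm_ell2_def zero_ell2.rep_eq)
  show "norm (x + y) \<le> norm x + norm y"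
  proof (rule norm_ell2_leI)
    fix F :: "'a set" assume F: "finite F"
    have "L2_set (\<lambda>i. norm (ell2_coord (x + y) i)) F
        \<le> L2_set (\<lambda>i. norm (ell2_coord x i) + norm (ell2_coord y i)) F"
      by (rule L2_set_mono) (auto simp: plus_ell2.rep_eq intro: norm_triangle_ineq)
    also have "\<dots> \<le> L2_set (\<lambda>i. norm (ell2_coord x i)) F + L2_set (\<lambda>i. norm (ell2_coord y i)) F"
      by (rule L2_set_triangle_ineq)
    finally show "L2_set (\<lambda>i. norm (ell2_coord (x + y) i)) F \<le> norm x + norm y"
      using L2_set_le_norm_ell2[OF F, of x] L2_set_le_norm_ell2[OF F, of y] by linarith
  qed
  show "norm (r *\<^sub>R x) = \<bar>r\<bar> * norm x"
    by (simp add: norm_ell2_def scaleR_ell2.rep_eq power_mult_distrib infsum_cmult_right'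
        real_sqrt_mult)
qed

end

instance ell2 :: (type, chilbert_space) banach
proof
  fix X :: "nat \<Rightarrow> ('a, 'b) ell2"
  assume C: "Cauchy X"
  define f where "f i = lim (\<lambda>m. ell2_coord (X m) i)" for i
  have "Cauchy (\<lambda>m. ell2_coord (X m) i)" for i
  proof (rule metric_CauchyI)
    fix e :: real assume "0 < e"
    from metric_CauchyD[OF C this]
    obtain M where M: "\<And>m n. m \<ge> M \<Longrightarrow> n \<ge> M \<Longrightarrow> dist (X m) (X n) < e"
      by blast
    have "dist (ell2_coord (X m) i) (ell2_coord (X n) i) < e" if "m \<ge> M" "n \<ge> M" for m n
      using norm_coord_le_norm_ell2[of "X m - X n" i] M[OF that]
      by (simp add: dist_norm minus_ell2.rep_eq)
    then show "\<exists>M. \<forall>m\<ge>M. \<forall>n\<ge>M. dist (ell2_coord (X m) i) (ell2_coord (X n) i) < e" by blast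
  qed
  then have lim: "(\<lambda>m. ell2_coord (X m) i) \<longlonglongrightarrow> f i" for i
    unfolding f_def by (simp add: Cauchy_convergent convergent_LIMSEQ_iff[symmetric])
  have tail: "\<exists>M. \<forall>m\<ge>M. \<forall>F. finite F \<longrightarrow> L2_set (\<lambda>i. norm (ell2_coord (X m) i - f i)) F \<le> e"
    if "0 < e" for e :: real
  proof -
    from metric_CauchyD[OF C that]
    obtain M where M: "\<And>m n. m \<ge> M \<Longrightarrow> n \<ge> M \<Longrightarrow> dist (X m) (X n) < e"
      by blast
    have "L2_set (\<lambda>i. norm (ell2_coord (X m) i - f i)) F \<le> e" if m: "m \<ge> M" and F: "finite F" for m F
    proof (rule LIMSEQ_le_const2)
      show "(\<lambda>n. L2_set (\<lambda>i. norm (ell2_coord (X m) i - ell2_coord (X n) i)) F)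
          \<longlonglongrightarrow> L2_set (\<lambda>i. norm (ell2_coord (X m) i - f i)) F"
        unfolding L2_set_def by (intro tendsto_intros lim)
      show "\<exists>N. \<forall>n\<ge>N. L2_set (\<lambda>i. norm (ell2_coord (X m) i - ell2_coord (X n) i)) F \<le> e"
      proof (intro exI allI impI)
        fix n assume "M \<le> n"
        then show "L2_set (\<lambda>i. norm (ell2_coord (X m) i - ell2_coord (X n) i)) F \<le> e"
          using L2_set_le_norm_ell2[OF F, of "X m - X n"] M[OF m, of n]
          by (simp add: dist_norm minus_ell2.rep_eq)
      qed
    qed
    then show ?thesis by blast
  qed
  obtain M where M: "\<And>F. finite F \<Longrightarrow> L2_set (\<lambda>i. norm (ell2_coord (X M) i - f i)) F \<le> 1"
    using tail[of 1] by auto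
  have "(\<lambda>i. (norm (ell2_coord (X M) i - f i))\<^sup>2) summable_on UNIV"
    unfolding square_summable_iff using M by blast
  then have "(\<lambda>i. (norm (f i - ell2_coord (X M) i))\<^sup>2) summable_on UNIV"
    by (simp add: norm_minus_commute)
  from square_summable_add[OF this ell2_summable[of "X M"]]
  have "(\<lambda>i. (norm (f i))\<^sup>2) summable_on UNIV" by simp
  then obtain L where L: "ell2_coord L = f"
    using Abs_ell2_inverse[of f] by auto
  have "X \<longlonglongrightarrow> L"
  proof (rule metric_LIMSEQ_I)
    fix e :: real assume e: "0 < e"
    obtain M where M: "\<And>m F. m \<ge> M \<Longrightarrow> finite F \<Longrightarrow> L2_set (\<lambda>i. norm (ell2_coord (X m) i - f i)) F \<le> e / 2"
      using tail[of "e / 2"] e by auto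
    have "norm (X m - L) \<le> e / 2" if "m \<ge> M" for m
      using M[OF that] by (intro norm_ell2_leI) (simp only: minus_ell2.rep_eq L)
    then show "\<exists>M. \<forall>m\<ge>M. dist (X m) L < e"
      using e by (intro exI[of _ M]) (force simp: dist_norm)
  qed
  then show "convergent X" by (rule convergentI)
qed

lemma cinner_ell2_summable:
  "(\<lambda>i. cinner (ell2_coord x i) (ell2_coord y i)) summable_on UNIV"
proof (rule abs_summable_summable)
  let ?g = "\<lambda>i. (norm (ell2_coord x i))\<^sup>2 + (norm (ell2_coord y i))\<^sup>2"
  have le: "cmod (cinner (ell2_coord x i) (ell2_coord y i)) \<le> ?g i" for i
  proof -
    have "norm (ell2_coord x i) * norm (ell2_coord y i) \<le> ?g i"
      using sum_squares_bound[of "norm (ell2_coord x i)" "norm (ell2_coord y i)"]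
        mult_nonneg_nonneg[OF norm_ge_zero[of "ell2_coord x i"] norm_ge_zero[of "ell2_coord y i"]]
      by linarith
    then show ?thesis
      using norm_cinner_le order_trans by blast
  qed
  have "?g summable_on UNIV"
    by (intro summable_on_add ell2_summable)
  then show "(\<lambda>i. cmod (cinner (ell2_coord x i) (ell2_coord y i))) summable_on UNIV"
    by (rule summable_on_comparison_test) (auto intro: le)
qed

instantiation ell2 :: (type, chilbert_space) chilbert_space
begin

lift_definition scaleC_ell2 :: "complex \<Rightarrow> ('a, 'b) ell2 \<Rightarrow> ('a, 'b) ell2" is "\<lambda>c f i. c *\<^sub>C f i"
  by (simp add: norm_scaleC power_mult_distrib summable_on_cmult_right)

definition cinner_ell2 :: "('a, 'b) ell2 \<Rightarrow> ('a, 'b) ell2 \<Rightarrow> complex"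
  where "cinner_ell2 x y = (\<Sum>\<^sub>\<infinity>i. cinner (ell2_coord x i) (ell2_coord y i))"

instance
proof
  fix x y z :: "('a, 'b) ell2" and c d :: complex and r :: real
  show "r *\<^sub>R x = complex_of_real r *\<^sub>C x"
    by transfer (simp add: scaleR_scaleC)
  show "c *\<^sub>C (x + y) = c *\<^sub>C x + c *\<^sub>C y"
    by transfer (simp add: scaleC_add_right)
  show "(c + d) *\<^sub>C x = c *\<^sub>C x + d *\<^sub>C x"
    by transfer (simp add: scaleC_add_left)
  show "c *\<^sub>C d *\<^sub>C x = (c * d) *\<^sub>C x"
    by transfer (simp add: scaleC_scaleC)
  show "cinner x y = cnj (cinner y x)"
    unfolding cinner_ell2_def infsum_cnj[symmetric] by (subst cinner_commute) simp
  show "cinner (x + y) z = cinner x z + cinner y z"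
    by (simp add: cinner_ell2_def plus_ell2.rep_eq cinner_add_left infsum_add cinner_ell2_summable)
  show "cinner (c *\<^sub>C x) y = c * cinner x y"
    by (simp add: cinner_ell2_def scaleC_ell2.rep_eq cinner_scaleC_left infsum_cmult_right')
  show "norm x = sqrt (Re (cinner x x))"
    using infsum_Re[OF cinner_ell2_summable[of x x]]
    by (simp add: cinner_ell2_def norm_ell2_def cinner_self del: of_real_power)
qed

end

lift_definition chi :: "'i \<Rightarrow> ('i, complex) ell2" is "\<lambda>i j. if j = i then 1 else 0"
  subgoal for i
    by (rule summable_on_cong_neutral[THEN iffD1, OF _ _ _ summable_on_finite[of "{i}"]]) auto
  done

lift_definition elem_tensor :: "('i, complex) ell2 \<Rightarrow> 'a::chilbert_space \<Rightarrow> ('i, 'a) ell2"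
  is "\<lambda>x h i. x i *\<^sub>C h"
  by (simp add: norm_scaleC power_mult_distrib summable_on_cmult_left)

section \<open>Bounded operators\<close>

text \<open>\<open>bop\<close> is the space of bounded complex-linear operators; \<^typ>\<open>'a \<Rightarrow>\<^sub>L 'b\<close> only
  provides real linearity.\<close>

definition bop :: "('a::chilbert_space \<Rightarrow>\<^sub>L 'b::chilbert_space) set"
  where "bop = {A :: 'a \<Rightarrow>\<^sub>L 'b. \<forall>c x. A (c *\<^sub>C x) = c *\<^sub>C A x}"

instantiation blinfun :: (real_normed_vector, chilbert_space) scaleC
begin

lift_definition scaleC_blinfun :: "complex \<Rightarrow> ('a \<Rightarrow>\<^sub>L 'b) \<Rightarrow> ('a \<Rightarrow>\<^sub>L 'b)"
  is "\<lambda>c A x. c *\<^sub>C A x"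
proof -
  fix c :: complex and A :: "'a \<Rightarrow> 'b" assume "bounded_linear A"
  then interpret bounded_linear A .
  show "bounded_linear (\<lambda>x. c *\<^sub>C A x)"
  proof (rule bounded_linear_intro[where K = "cmod c * onorm A"])
    show "c *\<^sub>C A (x + y) = c *\<^sub>C A x + c *\<^sub>C A y" for x y
      by (simp add: add scaleC_add_right)
    show "c *\<^sub>C A (r *\<^sub>R x) = r *\<^sub>R c *\<^sub>C A x" for r x
      by (simp add: scaleR scaleR_scaleC scaleC_scaleC mult.commute)
    show "norm (c *\<^sub>C A x) \<le> norm x * (cmod c * onorm A)" for x
      using mult_left_mono[OF onorm[OF \<open>bounded_linear A\<close>, of x], of "cmod c"]
      by (simp add: norm_scaleC mult.commute mult.left_commute)
  qed
qed

instance ..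

end

definition adj :: "('a::chilbert_space \<Rightarrow>\<^sub>L 'b::chilbert_space) \<Rightarrow> ('b \<Rightarrow>\<^sub>L 'a)"
  where "adj A = (THE B :: 'b \<Rightarrow>\<^sub>L 'a. \<forall>x y. cinner (A x) y = cinner x (B y))"

definition positive_op :: "('a::chilbert_space \<Rightarrow>\<^sub>L 'a) \<Rightarrow> bool"
  where "positive_op A \<longleftrightarrow> A \<in> bop \<and> (\<forall>x. cinner (A x) x \<in> \<real> \<and> 0 \<le> Re (cinner (A x) x))"

definition op_sqrt :: "('a::chilbert_space \<Rightarrow>\<^sub>L 'a) \<Rightarrow> ('a \<Rightarrow>\<^sub>L 'a)"
  where "op_sqrt A = (THE B. positive_op B \<and> B o\<^sub>L B = A)"

text \<open>The operator \<open>f \<otimes> I\<close>; it is determined by its values on elementary tensors, whose span is dense.\<close>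

definition tensor_id ::
    "(('i, complex) ell2 \<Rightarrow>\<^sub>L ('i, complex) ell2) \<Rightarrow> (('i, 'a) ell2 \<Rightarrow>\<^sub>L ('i, 'a::chilbert_space) ell2)"
  where "tensor_id f = (THE F :: ('i, 'a) ell2 \<Rightarrow>\<^sub>L ('i, 'a) ell2.
    \<forall>x h. F (elem_tensor x h) = elem_tensor (f x) h)"

definition closed_subalgebra :: "('a::chilbert_space \<Rightarrow>\<^sub>L 'a) set \<Rightarrow> bool"
  where "closed_subalgebra \<A> \<longleftrightarrow> \<A> \<subseteq> bop \<and> closed \<A> \<and> 0 \<in> \<A>
    \<and> (\<forall>A\<in>\<A>. \<forall>B\<in>\<A>. A + B \<in> \<A> \<and> A o\<^sub>L B \<in> \<A>) \<and> (\<forall>c. \<forall>A\<in>\<A>. c *\<^sub>C A \<in> \<A>)"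

definition generated_algebra :: "('a::chilbert_space \<Rightarrow>\<^sub>L 'a) set \<Rightarrow> ('a \<Rightarrow>\<^sub>L 'a) set"
  where "generated_algebra G = \<Inter>{\<A>. G \<subseteq> \<A> \<and> closed_subalgebra \<A>}"

definition generated_cstar_algebra :: "('a::chilbert_space \<Rightarrow>\<^sub>L 'a) set \<Rightarrow> ('a \<Rightarrow>\<^sub>L 'a) set"
  where "generated_cstar_algebra G
    = \<Inter>{\<A>. G \<subseteq> \<A> \<and> closed_subalgebra \<A> \<and> (\<forall>A\<in>\<A>. adj A \<in> \<A>)}"

definition linear_map_on ::
    "('a::chilbert_space \<Rightarrow>\<^sub>L 'a) set \<Rightarrow> (('a \<Rightarrow>\<^sub>L 'a) \<Rightarrow> ('b::chilbert_space \<Rightarrow>\<^sub>L 'b)) \<Rightarrow> bool"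
  where "linear_map_on \<A> \<Psi> \<longleftrightarrow> (\<forall>f\<in>\<A>. \<Psi> f \<in> bop)
    \<and> (\<forall>f\<in>\<A>. \<forall>g\<in>\<A>. \<Psi> (f + g) = \<Psi> f + \<Psi> g) \<and> (\<forall>c. \<forall>f\<in>\<A>. \<Psi> (c *\<^sub>C f) = c *\<^sub>C \<Psi> f)"

definition homomorphism_on ::
    "('a::chilbert_space \<Rightarrow>\<^sub>L 'a) set \<Rightarrow> (('a \<Rightarrow>\<^sub>L 'a) \<Rightarrow> ('b::chilbert_space \<Rightarrow>\<^sub>L 'b)) \<Rightarrow> bool"
  where "homomorphism_on \<A> \<Psi> \<longleftrightarrow> linear_map_on \<A> \<Psi>
    \<and> (\<forall>f\<in>\<A>. \<forall>g\<in>\<A>. \<Psi> (f o\<^sub>L g) = \<Psi> f o\<^sub>L \<Psi> g)"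

text \<open>The norm of an \<open>m \<times> m\<close> matrix of operators acting from \<open>'a\<^sup>m\<close> to \<open>'b\<^sup>m\<close>.\<close>

definition op_matrix_norm ::
    "nat \<Rightarrow> (nat \<Rightarrow> nat \<Rightarrow> ('a::chilbert_space \<Rightarrow>\<^sub>L 'b::chilbert_space)) \<Rightarrow> real"
  where "op_matrix_norm m A =
    (SUP x \<in> {x :: nat \<Rightarrow> 'a. L2_set (\<lambda>j. norm (x j)) {..<m} \<le> 1}.
      L2_set (\<lambda>i. norm (\<Sum>j<m. A i j (x j))) {..<m})"

definition completely_contractive_on ::
    "('a::chilbert_space \<Rightarrow>\<^sub>L 'a) set \<Rightarrow> (('a \<Rightarrow>\<^sub>L 'a) \<Rightarrow> ('b::chilbert_space \<Rightarrow>\<^sub>L 'b)) \<Rightarrow> bool"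
  where "completely_contractive_on \<A> \<Psi> \<longleftrightarrow>
    (\<forall>m F. (\<forall>i<m. \<forall>j<m. F i j \<in> \<A>) \<longrightarrow>
      op_matrix_norm m (\<lambda>i j. \<Psi> (F i j)) \<le> op_matrix_norm m F)"

section \<open>Regular polyballs\<close>

text \<open>Throughout, \<open>k\<close> is the number of rows, \<open>n i\<close> the length of the \<open>i\<close>-th row,
  \<open>T i s\<close> the operator \<open>T\<^sub>i\<^sub>,\<^sub>s\<close>, and \<open>lam i j s t\<close> the number \<open>\<lambda>\<^sub>i\<^sub>,\<^sub>j(s,t)\<close>, with indices starting at 1.
  Values at other indices are irrelevant.\<close>

type_synonym 'h op_tuple = "nat \<Rightarrow> nat \<Rightarrow> ('h \<Rightarrow>\<^sub>L 'h)"

definition Phi :: "nat \<Rightarrow> (nat \<Rightarrow> ('h::chilbert_space \<Rightarrow>\<^sub>L 'h)) \<Rightarrow> ('h \<Rightarrow>\<^sub>L 'h) \<Rightarrow> ('h \<Rightarrow>\<^sub>L 'h)"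
  where "Phi m R X = (\<Sum>s=1..m. R s o\<^sub>L X o\<^sub>L adj (R s))"

definition scale_tuple :: "real \<Rightarrow> 'h::chilbert_space op_tuple \<Rightarrow> 'h op_tuple"
  where "scale_tuple r T = (\<lambda>i s. r *\<^sub>R T i s)"

text \<open>\<open>(id - \<Phi>\<^sub>1) \<circ> \<dots> \<circ> (id - \<Phi>\<^sub>k)\<close> applied to \<open>I\<close>, and the same composition in the opposite order.\<close>

definition defect :: "nat \<Rightarrow> (nat \<Rightarrow> nat) \<Rightarrow> 'h::chilbert_space op_tuple \<Rightarrow> ('h \<Rightarrow>\<^sub>L 'h)"
  where "defect k n T = foldr (\<lambda>i X. X - Phi (n i) (T i) X) [1..<Suc k] id_blinfun"

definition Delta :: "nat \<Rightarrow> (nat \<Rightarrow> nat) \<Rightarrow> 'h::chilbert_space op_tuple \<Rightarrow> ('h \<Rightarrow>\<^sub>L 'h)"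
  where "Delta k n T = fold (\<lambda>i X. X - Phi (n i) (T i) X) [1..<Suc k] id_blinfun"

definition polyball ::
    "nat \<Rightarrow> (nat \<Rightarrow> nat) \<Rightarrow> (nat \<Rightarrow> nat \<Rightarrow> nat \<Rightarrow> nat \<Rightarrow> complex) \<Rightarrow> 'h::chilbert_space op_tuple set"
  where "polyball k n lam = {T.
      (\<forall>i\<in>{1..k}. \<forall>s\<in>{1..n i}. T i s \<in> bop)
    \<and> (\<forall>i\<in>{1..k}. positive_op (id_blinfun - (\<Sum>s=1..n i. T i s o\<^sub>L adj (T i s))))
    \<and> (\<forall>i\<in>{1..k}. \<forall>j\<in>{1..k}. i \<noteq> j \<longrightarrow> (\<forall>s\<in>{1..n i}. \<forall>t\<in>{1..n j}.
        T i s o\<^sub>L T j t = lam i j s t *\<^sub>C (T j t o\<^sub>L T i s)))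
    \<and> (\<forall>r\<in>{0..<1}. positive_op (defect k n (scale_tuple r T)))}"

definition pure_tuple :: "nat \<Rightarrow> (nat \<Rightarrow> nat) \<Rightarrow> 'h::chilbert_space op_tuple \<Rightarrow> bool"
  where "pure_tuple k n T \<longleftrightarrow>
    (\<forall>i\<in>{1..k}. \<forall>x. (\<lambda>m. ((Phi (n i) (T i) ^^ m) id_blinfun) x) \<longlonglongrightarrow> 0)"

section \<open>The Berezin kernel and the standard tuple\<close>

text \<open>A tuple \<open>\<alpha>\<close> of words has \<open>i\<close>-th component \<open>\<alpha> i\<close>, a word being the list of the indices of its letters.
  \<open>words k n\<close> is the product of the free semigroups; components outside \<open>{1..k}\<close> are set to \<open>[]\<close>.
  The space \<open>\<ell>\<^sup>2(words k n)\<close> is the closed span of the \<open>chi \<alpha>\<close>, \<open>\<alpha> \<in> words k n\<close>, in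
  \<open>(word_tuple, complex) ell2\<close>. An operator on it is represented by its extension by 0 on
  the orthogonal complement; in particular \<open>fock_id\<close>, the orthogonal projection, represents
  the identity. This representation preserves adjoints, products and norms of operator matrices.\<close>

type_synonym word_tuple = "nat \<Rightarrow> nat list"

type_synonym fock_op = "(word_tuple, complex) ell2 \<Rightarrow>\<^sub>L (word_tuple, complex) ell2"

definition words :: "nat \<Rightarrow> (nat \<Rightarrow> nat) \<Rightarrow> word_tuple set"
  where "words k n = {\<alpha>. (\<forall>i\<in>{1..k}. set (\<alpha> i) \<subseteq> {1..n i}) \<and> (\<forall>i. i \<notin> {1..k} \<longrightarrow> \<alpha> i = [])}"

definition word_op :: "(nat \<Rightarrow> ('h::chilbert_space \<Rightarrow>\<^sub>L 'h)) \<Rightarrow> nat list \<Rightarrow> ('h \<Rightarrow>\<^sub>L 'h)"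
  where "word_op R w = foldr (\<lambda>s X. R s o\<^sub>L X) w id_blinfun"

text \<open>The fold is \<open>T\<^sub>k\<^sub>,\<^sub>\<beta>\<^sub>k\<^sup>* \<dots> T\<^sub>1\<^sub>,\<^sub>\<beta>\<^sub>1\<^sup>*\<close>.\<close>

definition berezin_kernel ::
    "nat \<Rightarrow> (nat \<Rightarrow> nat) \<Rightarrow> 'h::chilbert_space op_tuple \<Rightarrow> ('h \<Rightarrow>\<^sub>L (word_tuple, 'h) ell2)"
  where "berezin_kernel k n T = Blinfun (\<lambda>h. \<Sum>\<^sub>\<infinity>\<beta>\<in>words k n. elem_tensor (chi \<beta>)
    (op_sqrt (Delta k n T)
      (fold (\<lambda>i X. adj (word_op (T i) (\<beta> i)) o\<^sub>L X) [1..<Suc k] id_blinfun h)))"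

definition lam_word ::
    "(nat \<Rightarrow> nat \<Rightarrow> nat \<Rightarrow> nat \<Rightarrow> complex) \<Rightarrow> nat \<Rightarrow> nat \<Rightarrow> nat \<Rightarrow> nat list \<Rightarrow> complex"
  where "lam_word lam i j s w = prod_list (map (lam i j s) w)"

definition std_shift ::
    "nat \<Rightarrow> (nat \<Rightarrow> nat) \<Rightarrow> (nat \<Rightarrow> nat \<Rightarrow> nat \<Rightarrow> nat \<Rightarrow> complex) \<Rightarrow> nat \<Rightarrow> nat \<Rightarrow> fock_op"
  where "std_shift k n lam i s = (THE V :: fock_op. V \<in> bop \<and> (\<forall>\<alpha>. V (chi \<alpha>) =
    (if \<alpha> \<in> words k n
     then (\<Prod>j=1..<i. lam_word lam i j s (\<alpha> j)) *\<^sub>C chi (\<alpha>(i := s # \<alpha> i)) else 0)))"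

definition fock_id :: "nat \<Rightarrow> (nat \<Rightarrow> nat) \<Rightarrow> fock_op"
  where "fock_id k n = (THE V :: fock_op. V \<in> bop \<and>
    (\<forall>\<alpha>. V (chi \<alpha>) = (if \<alpha> \<in> words k n then chi \<alpha> else 0)))"

definition std_shifts ::
    "nat \<Rightarrow> (nat \<Rightarrow> nat) \<Rightarrow> (nat \<Rightarrow> nat \<Rightarrow> nat \<Rightarrow> nat \<Rightarrow> complex) \<Rightarrow> fock_op set"
  where "std_shifts k n lam = {std_shift k n lam i s | i s. i \<in> {1..k} \<and> s \<in> {1..n i}}"

definition shift_cstar_algebra ::
    "nat \<Rightarrow> (nat \<Rightarrow> nat) \<Rightarrow> (nat \<Rightarrow> nat \<Rightarrow> nat \<Rightarrow> nat \<Rightarrow> complex) \<Rightarrow> fock_op set"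
  where "shift_cstar_algebra k n lam = generated_cstar_algebra (std_shifts k n lam)"

definition polyball_algebra ::
    "nat \<Rightarrow> (nat \<Rightarrow> nat) \<Rightarrow> (nat \<Rightarrow> nat \<Rightarrow> nat \<Rightarrow> nat \<Rightarrow> complex) \<Rightarrow> fock_op set"
  where "polyball_algebra k n lam = generated_algebra (insert (fock_id k n) (std_shifts k n lam))"

definition berezin ::
    "nat \<Rightarrow> (nat \<Rightarrow> nat) \<Rightarrow> 'h::chilbert_space op_tuple \<Rightarrow> fock_op \<Rightarrow> ('h \<Rightarrow>\<^sub>L 'h)"
  where "berezin k n T f =
    adj (berezin_kernel k n T) o\<^sub>L tensor_id f o\<^sub>L berezin_kernel k n T"

definition Psi ::
    "nat \<Rightarrow> (nat \<Rightarrow> nat) \<Rightarrow> 'h::chilbert_space op_tuple \<Rightarrow> fock_op \<Rightarrow> ('h \<Rightarrow>\<^sub>L 'h)"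
  where "Psi k n T f = Lim (at_left 1) (\<lambda>r. berezin k n (scale_tuple r T) f)"

end

theory Submission
  imports Defs
begin

text \<open>For \<open>r < 1\<close> the Berezin kernel \<open>K\<close> of \<open>rT\<close> is an isometry (telescope
  \<open>\<Sum> \<Phi>\<^sup>m (Y - \<Phi> Y) = Y\<close> one row at a time) with \<open>K\<^sup>* (S\<^sub>i\<^sub>,\<^sub>s \<otimes> I) = r T\<^sub>i\<^sub>,\<^sub>s K\<^sup>*\<close>. Hence
  \<open>f \<mapsto> K\<^sup>* (f \<otimes> I) K\<close> is completely contractive and sends \<open>V U\<^sup>*\<close> to \<open>V(rT) U(rT)\<^sup>*\<close> for
  monomials \<open>U\<close>, \<open>V\<close> in the shifts. The commutation relations
  \<open>S\<^sub>i\<^sub>,\<^sub>s\<^sup>* S\<^sub>j\<^sub>,\<^sub>t = \<lambda>\<^sub>j\<^sub>,\<^sub>i(t,s) S\<^sub>j\<^sub>,\<^sub>t S\<^sub>i\<^sub>,\<^sub>s\<^sup>*\<close> show that the \<open>V U\<^sup>*\<close> span a dense subspace of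
  the \<open>C\<^sup>*\<close>-algebra; the limit \<open>r \<rightarrow> 1\<close> exists on them, and on all of it by uniform
  contractivity.\<close>

section \<open>Bounded operators on Hilbert spaces\<close>

text \<open>Two things can fail for the kernel of \<open>T\<close> itself: positivity of the defect
  is assumed only for \<open>r < 1\<close>, and without purity the telescoping leaves a remainder,
  so that the kernel need not be isometric. Scaling repairs both, because the powers of
  \<open>Phi\<close> for \<open>rT\<close> decay like r^(2p); a pure \<open>T\<close> inherits
  positivity in the limit. The predicate \<open>berezin_data\<close> records what the two cases
  share, and every statement about a single kernel is proved from it. The transform is in general
  not multiplicative on the C*-algebra, since \<open>K\<close> times its adjoint is only a
  projection. It is multiplicative as soon as the left factor lies in the non-self-adjoint algebra,
  because the adjoint of \<open>K\<close> intertwines that algebra. This one-sided rule is the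
  reason for ordering products with all adjoints on the right. Unimodularity of the \<lambda>'s
  makes the maps \<open>Phi\<close> of different rows commute, which reconciles the order of factors
  in the definition of the polyball with the opposite order in the kernel.\<close>

lemma bounded_bilinear_cinner: "bounded_bilinear (cinner :: 'a::chilbert_space \<Rightarrow> 'a \<Rightarrow> complex)"
proof
  fix a b c :: 'a and r :: real
  show "cinner (a + b) c = cinner a c + cinner b c" by (rule cinner_add_left)
  show "cinner a (b + c) = cinner a b + cinner a c" by (rule cinner_add_right)
  show "cinner (r *\<^sub>R a) b = r *\<^sub>R cinner a b"
    by (simp add: scaleR_scaleC[of r a] cinner_scaleC_left scaleR_conv_of_real)
  show "cinner a (r *\<^sub>R b) = r *\<^sub>R cinner a b"
    by (simp add: scaleR_scaleC[of r b] cinner_scaleC_right scaleR_conv_of_real)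
  show "\<exists>K. \<forall>a b::'a. cmod (cinner a b) \<le> norm a * norm b * K"
    by (rule exI[of _ 1]) (simp add: norm_cinner_le)
qed

interpretation cinner: bounded_bilinear "cinner :: 'a::chilbert_space \<Rightarrow> 'a \<Rightarrow> complex"
  by (rule bounded_bilinear_cinner)

lemma bounded_bilinear_scaleC:
  "bounded_bilinear (scaleC :: complex \<Rightarrow> 'a::chilbert_space \<Rightarrow> 'a)"
proof
  fix a b :: complex and x y :: 'a and r :: real
  show "(a + b) *\<^sub>C x = a *\<^sub>C x + b *\<^sub>C x" by (rule scaleC_add_left)
  show "a *\<^sub>C (x + y) = a *\<^sub>C x + a *\<^sub>C y" by (rule scaleC_add_right)
  show "(r *\<^sub>R a) *\<^sub>C x = r *\<^sub>R a *\<^sub>C x"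
    by (simp add: scaleR_scaleC[of r "a *\<^sub>C x"] scaleC_scaleC scaleR_conv_of_real)
  show "a *\<^sub>C (r *\<^sub>R x) = r *\<^sub>R a *\<^sub>C x"
    by (simp add: scaleR_scaleC scaleC_scaleC mult.commute)
  show "\<exists>K. \<forall>(a::complex) b::'a. norm (a *\<^sub>C b) \<le> norm a * norm b * K"
    by (rule exI[of _ 1]) (simp add: norm_scaleC)
qed

interpretation scaleC: bounded_bilinear "scaleC :: complex \<Rightarrow> 'a::chilbert_space \<Rightarrow> 'a"
  by (rule bounded_bilinear_scaleC)

lemma scaleC_one [simp]: "1 *\<^sub>C x = x" for x :: "'a::chilbert_space"
  using scaleR_scaleC[of 1 x] by simp

lemma Re_cinner_self [simp]: "Re (cinner x x) = (norm x)\<^sup>2" for x :: "'a::chilbert_space"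
  by (simp add: cinner_self del: of_real_power)

lemma Re_cinner_commute: "Re (cinner x y) = Re (cinner y x)" for x :: "'a::chilbert_space"
  by (metis cinner_commute cnj.simps(1))

lemma norm_add_square:
  "(norm (x + y))\<^sup>2 = (norm x)\<^sup>2 + (norm y)\<^sup>2 + 2 * Re (cinner x y)" for x :: "'a::chilbert_space"
  by (simp add: Re_cinner_self[symmetric] cinner_add_left cinner_add_right Re_cinner_commute[of y x]
      del: Re_cinner_self)

lemma cinner_right_eqI:
  assumes "\<And>x. cinner x y = cinner x z"
  shows "y = (z::'a::chilbert_space)"
proof -
  have "cinner (y - z) (y - z) = 0"
    by (simp add: cinner.diff_right assms)
  then have "(norm (y - z))\<^sup>2 = 0"
    by (metis Re_cinner_self zero_complex.simps(1))
  then show ?thesis by simp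
qed

lemma cinner_left_eqI:
  assumes "\<And>x. cinner y x = cinner z x"
  shows "y = (z::'a::chilbert_space)"
  by (rule cinner_right_eqI) (metis assms cinner_commute)

section \<open>The space of complex-linear bounded operators\<close>

lemma bopI:
  fixes A :: "'a::chilbert_space \<Rightarrow>\<^sub>L 'b::chilbert_space"
  shows "(\<And>c x. A (c *\<^sub>C x) = c *\<^sub>C A x) \<Longrightarrow> A \<in> bop"
  by (simp add: bop_def)

lemma bop_scaleC:
  fixes A :: "'a::chilbert_space \<Rightarrow>\<^sub>L 'b::chilbert_space"
  shows "A \<in> bop \<Longrightarrow> A (c *\<^sub>C x) = c *\<^sub>C A x"
  by (simp add: bop_def)

lemma scaleC_blinfun_apply [simp]: "(c *\<^sub>C A) x = c *\<^sub>C A x"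
  for A :: "'a::real_normed_vector \<Rightarrow>\<^sub>L 'b::chilbert_space"
  by (simp add: scaleC_blinfun.rep_eq)

lemma scaleR_scaleC_blinfun: "r *\<^sub>R A = complex_of_real r *\<^sub>C A"
  for A :: "'a::real_normed_vector \<Rightarrow>\<^sub>L 'b::chilbert_space"
  by (rule blinfun_eqI) (simp add: blinfun.scaleR_left scaleR_scaleC)

lemma
  fixes A B :: "'a::chilbert_space \<Rightarrow>\<^sub>L 'b::chilbert_space"
  shows zero_in_bop [simp]: "(0 :: 'a \<Rightarrow>\<^sub>L 'b) \<in> bop"
  and id_in_bop [simp]: "(id_blinfun :: 'a \<Rightarrow>\<^sub>L 'a) \<in> bop"
  and bop_add: "A \<in> bop \<Longrightarrow> B \<in> bop \<Longrightarrow> A + B \<in> bop"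
  and bop_diff: "A \<in> bop \<Longrightarrow> B \<in> bop \<Longrightarrow> A - B \<in> bop"
  and bop_scale: "A \<in> bop \<Longrightarrow> c *\<^sub>C A \<in> bop"
  by (auto simp: bop_def blinfun.add_left blinfun.diff_left scaleC_add_right scaleC.diff_right
      scaleC.zero_right scaleC_scaleC mult.commute)

lemma bop_scaleR: "A \<in> bop \<Longrightarrow> r *\<^sub>R A \<in> bop"
  by (simp add: scaleR_scaleC_blinfun bop_scale)

lemma bop_compose: "A \<in> bop \<Longrightarrow> B \<in> bop \<Longrightarrow> A o\<^sub>L B \<in> bop"
  by (simp add: bop_def)

lemma bop_sum: "(\<And>i. i \<in> I \<Longrightarrow> A i \<in> bop) \<Longrightarrow> sum A I \<in> bop"
  by (induction I rule: infinite_finite_induct) (auto intro: bop_add)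

lemma closed_bop: "closed bop"
proof -
  have "closed {A :: 'a::chilbert_space \<Rightarrow>\<^sub>L 'b::chilbert_space. A (c *\<^sub>C x) = c *\<^sub>C A x}" for c x
    by (intro closed_Collect_eq continuous_intros scaleC.continuous_on)
  then have "closed (\<Inter>c. \<Inter>x. {A :: 'a::chilbert_space \<Rightarrow>\<^sub>L 'b::chilbert_space. A (c *\<^sub>C x) = c *\<^sub>C A x})"
    by blast
  moreover have "bop = (\<Inter>c. \<Inter>x. {A :: 'a::chilbert_space \<Rightarrow>\<^sub>L 'b::chilbert_space. A (c *\<^sub>C x) = c *\<^sub>C A x})"
    by (auto simp only: bop_def mem_Collect_eq INT_iff)
  ultimately show ?thesis by (simp only:)
qed

text \<open>The Riesz vector minimises \<open>\<parallel>x\<parallel>\<^sup>2 - 2 Re (\<phi> x)\<close>; minimising sequences are Cauchy by the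
  parallelogram law.\<close>

lemma riesz_real:
  fixes f :: "'a::chilbert_space \<Rightarrow> real"
  assumes "bounded_linear f"
  shows "\<exists>u. \<forall>x. f x = Re (cinner x u)"
proof -
  interpret f: bounded_linear f by fact
  obtain K where K: "K > 0" "\<And>x. \<bar>f x\<bar> \<le> norm x * K"
    using f.pos_bounded by (auto simp: real_norm_def)
  define J where "J x = (norm x)\<^sup>2 - 2 * f x" for x
  define m where "m = Inf (range J)"
  \<comment> \<open>J x is at least the square of norm x minus 2 K norm x, and completing the square
    gives the bound.\<close>
  have low: "J x \<ge> - K\<^sup>2" for x
  proof -
    have "f x \<le> norm x * K" using K(2)[of x] by linarith
    then show ?thesis
      using zero_le_power2[of "norm x - K"] by (simp add: J_def power2_diff)
  qed
  then have bdd: "bdd_below (range J)" by (intro bdd_belowI[where m = "- K\<^sup>2"]) auto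
  then have mle: "m \<le> J x" for x unfolding m_def by (intro cInf_lower) auto
  have mid: "(norm (x - y))\<^sup>2 \<le> 2 * J x + 2 * J y - 4 * m" for x y
  proof -
    have "(norm (x - y))\<^sup>2 = 2 * J x + 2 * J y - 4 * J ((1/2) *\<^sub>R (x + y))"
    proof -
      have "4 * (norm ((1/2) *\<^sub>R (x + y)))\<^sup>2 = (norm (x + y))\<^sup>2"
        by (simp add: power2_eq_square)
      moreover have "f ((1/2) *\<^sub>R (x + y)) = (f x + f y) / 2"
        by (simp add: f.scaleR f.add)
      moreover have "(norm (x - y))\<^sup>2 = (norm x)\<^sup>2 + (norm y)\<^sup>2 - 2 * Re (cinner x y)"
        using norm_add_square[of x "- y"] by (simp add: cinner.minus_right)
      ultimately show ?thesis
        using norm_add_square[of x y] by (simp add: J_def field_simps)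
    qed
    moreover have "4 * J ((1/2) *\<^sub>R (x + y)) \<ge> 4 * m"
      using mle by (intro mult_left_mono) auto
    ultimately show ?thesis by linarith
  qed
  have "\<exists>x. J x < m + 1 / real (Suc j)" for j
  proof -
    have "Inf (range J) < m + 1 / real (Suc j)" by (simp add: m_def)
    then show ?thesis
      using cInf_lessD[of "range J"] by auto
  qed
  then obtain X where X: "\<And>j. J (X j) < m + 1 / real (Suc j)" by metis
  have "Cauchy X"
  proof (rule CauchyI')
    fix e :: real assume e: "e > 0"
    \<comment> \<open>The midpoint estimate \<open>mid\<close> weights each of the two excesses over
      m by 2; this explains the quarter.\<close>
    obtain N where N: "1 / real (Suc N) < e\<^sup>2 / 4"
      using nat_approx_posE[of "e\<^sup>2 / 4"] e by auto
    have "norm (X i - X j) < e" if "i \<ge> N" "j \<ge> N" for i j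
    proof -
      have "1 / real (Suc i) \<le> 1 / real (Suc N)" "1 / real (Suc j) \<le> 1 / real (Suc N)"
        using that by (auto simp: frac_le)
      then have "(norm (X i - X j))\<^sup>2 < e\<^sup>2"
        using mid[of "X i" "X j"] X[of i] X[of j] N by linarith
      then show ?thesis using e by (simp add: power_less_imp_less_base)
    qed
    then show "\<exists>M. \<forall>m\<ge>M. \<forall>n>m. dist (X m) (X n) < e"
      by (intro exI[of _ N]) (auto simp: dist_norm)
  qed
  then obtain u where u: "X \<longlonglongrightarrow> u"
    using Cauchy_convergent convergent_def by blast
  have "(\<lambda>j. J (X j)) \<longlonglongrightarrow> J u"
    unfolding J_def by (intro tendsto_intros u f.tendsto)
  moreover have "(\<lambda>j. J (X j)) \<longlonglongrightarrow> m"
  proof (rule tendsto_sandwich)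
    show "eventually (\<lambda>j. m \<le> J (X j)) sequentially" using mle by simp
    show "eventually (\<lambda>j. J (X j) \<le> m + 1 / real (Suc j)) sequentially"
      using X by (simp add: less_imp_le)
    show "(\<lambda>j. m + 1 / real (Suc j)) \<longlonglongrightarrow> m"
      using tendsto_add[OF tendsto_const LIMSEQ_inverse_real_of_nat, of m]
      by (simp add: inverse_eq_divide)
  qed simp
  ultimately have Ju: "J u = m" by (rule LIMSEQ_unique)
  have "f x = Re (cinner x u)" for x
  proof (rule ccontr)
    define d where "d = f x - Re (cinner x u)"
    assume "f x \<noteq> Re (cinner x u)"
    then have d: "d \<noteq> 0" by (simp add: d_def)
    have "J (u + t *\<^sub>R x) = J u + t\<^sup>2 * (norm x)\<^sup>2 - 2 * t * d" for t
      using norm_add_square[of u "t *\<^sub>R x"]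
      by (simp add: J_def d_def f.add f.scaleR cinner.scaleR_right Re_cinner_commute[of u x]
          power_mult_distrib algebra_simps)
    then have ge: "t\<^sup>2 * (norm x)\<^sup>2 - 2 * t * d \<ge> 0" for t
      using mle[of "u + t *\<^sub>R x"] Ju by simp
    have nx: "norm x > 0"
      using d by (auto simp: d_def f.zero cinner.zero_left)
    \<comment> \<open>This t minimises the quadratic in t from \<open>ge\<close>.\<close>
    have "(d / (norm x)\<^sup>2)\<^sup>2 * (norm x)\<^sup>2 - 2 * (d / (norm x)\<^sup>2) * d = - (d\<^sup>2 / (norm x)\<^sup>2)"
      using nx by (simp add: power2_eq_square field_simps)
    then have "d\<^sup>2 / (norm x)\<^sup>2 \<le> 0" using ge[of "d / (norm x)\<^sup>2"] by linarith
    moreover have "d\<^sup>2 / (norm x)\<^sup>2 > 0" using d nx by simp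
    ultimately show False by linarith
  qed
  then show ?thesis by blast
qed

text \<open>The imaginary part of \<open>f x\<close> is the real part of f at -i x, and the inner
  product obeys the same rule. The vector representing the real part therefore represents f.\<close>

lemma riesz:
  fixes f :: "'a::chilbert_space \<Rightarrow> complex"
  assumes "bounded_linear f" "\<And>c x. f (c *\<^sub>C x) = c * f x"
  shows "\<exists>u. \<forall>x. f x = cinner x u"
proof -
  obtain u where u: "\<And>x. Re (f x) = Re (cinner x u)"
    using riesz_real[OF bounded_linear_compose[OF bounded_linear_Re assms(1)]] by auto
  have "Im (f x) = Im (cinner x u)" for x
    using u[of "(- \<i>) *\<^sub>C x"] by (simp add: assms(2) cinner_scaleC_left)
  with u show ?thesis by (auto simp: complex_eq_iff)
qed

section \<open>Existence and calculus of adjoints\<close>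

lemma adjoint_exists:
  fixes A :: "'a::chilbert_space \<Rightarrow>\<^sub>L 'b::chilbert_space"
  assumes "A \<in> bop"
  shows "\<exists>B :: 'b \<Rightarrow>\<^sub>L 'a. \<forall>x y. cinner (A x) y = cinner x (B y)"
proof -
  have "\<exists>u. \<forall>x. cinner (A x) y = cinner x u" for y
    by (rule riesz)
      (auto intro!: bounded_linear_compose[OF cinner.bounded_linear_left] blinfun.bounded_linear_right
        simp: bop_scaleC[OF assms] cinner_scaleC_left)
  then obtain g where g: "\<And>x y. cinner (A x) y = cinner x (g y)" by metis
  have "bounded_linear g"
  proof (rule bounded_linear_intro)
    show "g (y + z) = g y + g z" for y z
      by (rule cinner_right_eqI) (metis g cinner_add_right)
    show "g (r *\<^sub>R y) = r *\<^sub>R g y" for r y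
      by (rule cinner_right_eqI) (metis g cinner.scaleR_right)
    fix y
    have "(norm (g y))\<^sup>2 = Re (cinner (A (g y)) y)" by (simp add: g)
    also have "\<dots> \<le> norm (A (g y)) * norm y" by (rule Re_cinner_le)
    also have "\<dots> \<le> (norm A * norm (g y)) * norm y"
      by (intro mult_right_mono norm_blinfun) simp
    finally have "norm (g y) * norm (g y) \<le> norm (g y) * (norm y * norm A)"
      by (simp add: power2_eq_square ac_simps)
    then show "norm (g y) \<le> norm y * norm A"
      by (cases "norm (g y) = 0") (auto simp: mult_le_cancel_left)
  qed
  then show ?thesis
    by (intro exI[of _ "Blinfun g"]) (simp add: bounded_linear_Blinfun_apply g)
qed

lemma adj_eqI:
  fixes A :: "'a::chilbert_space \<Rightarrow>\<^sub>L 'b::chilbert_space" and B :: "'b \<Rightarrow>\<^sub>L 'a"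
  assumes "\<And>x y. cinner (A x) y = cinner x (B y)"
  shows "adj A = B"
  unfolding adj_def
proof (rule the_equality)
  fix C :: "'b \<Rightarrow>\<^sub>L 'a" assume C: "\<forall>x y. cinner (A x) y = cinner x (C y)"
  show "C = B" by (rule blinfun_eqI, rule cinner_right_eqI) (metis assms C)
qed (use assms in blast)

lemma cinner_adj_right: "A \<in> bop \<Longrightarrow> cinner x (adj A y) = cinner (A x) y"
  using adjoint_exists[of A] adj_eqI[of A] by metis

lemma cinner_adj_left: "A \<in> bop \<Longrightarrow> cinner (adj A y) x = cinner y (A x)"
  by (metis cinner_commute cinner_adj_right)

lemma adj_in_bop [simp]: "A \<in> bop \<Longrightarrow> adj A \<in> bop"
  by (rule bopI, rule cinner_left_eqI) (simp add: cinner_adj_left cinner_scaleC_left)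

lemma adj_adj [simp]: "A \<in> bop \<Longrightarrow> adj (adj A) = A"
  by (intro adj_eqI) (simp add: cinner_adj_left)

lemma adj_zero [simp]: "adj 0 = 0"
  and adj_id [simp]: "adj id_blinfun = id_blinfun"
  by (auto intro: adj_eqI simp: cinner.zero_left cinner.zero_right)

lemma adj_add: "A \<in> bop \<Longrightarrow> B \<in> bop \<Longrightarrow> adj (A + B) = adj A + adj B"
  and adj_diff: "A \<in> bop \<Longrightarrow> B \<in> bop \<Longrightarrow> adj (A - B) = adj A - adj B"
  and adj_scaleC: "A \<in> bop \<Longrightarrow> adj (c *\<^sub>C A) = cnj c *\<^sub>C adj A"
  by (rule adj_eqI; simp add: blinfun.add_left blinfun.diff_left cinner_add_left cinner_add_right
      cinner.diff_left cinner.diff_right cinner_adj_right cinner_scaleC_left cinner_scaleC_right)+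

lemma adj_scaleR: "A \<in> bop \<Longrightarrow> adj (r *\<^sub>R A) = r *\<^sub>R adj A"
  by (simp add: scaleR_scaleC_blinfun adj_scaleC)

lemma adj_compose: "A \<in> bop \<Longrightarrow> B \<in> bop \<Longrightarrow> adj (A o\<^sub>L B) = adj B o\<^sub>L adj A"
  by (rule adj_eqI) (simp add: cinner_adj_right)

lemma norm_adj_le: 
  assumes "A \<in> bop" shows "norm (adj A) \<le> norm A"
proof (rule norm_blinfun_bound)
  fix y
  have "(norm (adj A y))\<^sup>2 = Re (cinner (A (adj A y)) y)"
    by (simp add: cinner_adj_right[OF assms, symmetric])
  also have "\<dots> \<le> norm (A (adj A y)) * norm y" by (rule Re_cinner_le)
  also have "\<dots> \<le> (norm A * norm (adj A y)) * norm y"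
    by (intro mult_right_mono norm_blinfun) simp
  finally have "norm (adj A y) * norm (adj A y) \<le> norm (adj A y) * (norm A * norm y)"
    by (simp add: power2_eq_square ac_simps)
  then show "norm (adj A y) \<le> norm A * norm y"
    by (cases "norm (adj A y) = 0") (auto simp: mult_le_cancel_left)
qed simp

lemma tendsto_adj:
  assumes "(A \<longlongrightarrow> L) F" "\<forall>\<^sub>F i in F. A i \<in> bop" "L \<in> bop"
  shows "((\<lambda>i. adj (A i)) \<longlongrightarrow> adj L) F"
proof (rule Lim_transform[where g = "\<lambda>i. adj L"])
  have "((\<lambda>i. norm (A i - L)) \<longlongrightarrow> 0) F"
    using assms(1) by (simp add: LIM_zero_iff tendsto_norm_zero)
  then show "((\<lambda>i. adj (A i) - adj L) \<longlongrightarrow> 0) F"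
  proof (rule tendsto_0_le[where K = 1])
    show "\<forall>\<^sub>F i in F. norm (adj (A i) - adj L) \<le> norm (norm (A i - L)) * 1"
      using assms(2)
    proof (rule eventually_mono)
      fix i assume "A i \<in> bop"
      then show "norm (adj (A i) - adj L) \<le> norm (norm (A i - L)) * 1"
        using norm_adj_le[OF bop_diff[OF _ assms(3)], of "A i"] by (simp add: adj_diff assms(3))
    qed
  qed
qed simp

section \<open>Positive operators and square roots\<close>

text \<open>Order relations between operators are read off from this real quadratic form; sums over
  words then become sums of nonnegative reals, which can be rearranged freely.\<close>

definition qf :: "('a::chilbert_space \<Rightarrow>\<^sub>L 'a) \<Rightarrow> 'a \<Rightarrow> real"
  where "qf A x = Re (cinner (A x) x)"

lemma qf_add: "qf (A + B) x = qf A x + qf B x"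
  and qf_diff: "qf (A - B) x = qf A x - qf B x"
  and qf_scaleR: "qf (r *\<^sub>R A) x = r * qf A x"
  and qf_id: "qf id_blinfun x = (norm x)\<^sup>2"
  and qf_zero: "qf 0 x = 0"
  by (simp_all add: qf_def blinfun.add_left blinfun.diff_left blinfun.scaleR_left cinner_add_left
      cinner.diff_left cinner.scaleR_left cinner.zero_left)

lemma qf_sum: "qf (sum A I) x = (\<Sum>i\<in>I. qf (A i) x)"
  by (induction I rule: infinite_finite_induct) (auto simp: qf_add qf_zero)

lemma qf_conj: "B \<in> bop \<Longrightarrow> qf (B o\<^sub>L A o\<^sub>L adj B) x = qf A (adj B x)"
  by (metis (no_types, lifting) adj_adj adj_in_bop blinfun_apply_blinfun_compose cinner_adj_left cinner_adj_right qf_def)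

lemma abs_qf_le: "\<bar>qf A x\<bar> \<le> norm A * (norm x)\<^sup>2"
proof -
  have "\<bar>qf A x\<bar> \<le> cmod (cinner (A x) x)"
    unfolding qf_def by (rule abs_Re_le_cmod)
  also have "\<dots> \<le> norm (A x) * norm x" by (rule norm_cinner_le)
  also have "\<dots> \<le> (norm A * norm x) * norm x" by (intro mult_right_mono norm_blinfun) simp
  finally show ?thesis by (simp add: power2_eq_square ac_simps)
qed

lemma tendsto_qf: "(A \<longlongrightarrow> L) F \<Longrightarrow> ((\<lambda>i. qf (A i) x) \<longlongrightarrow> qf L x) F"
  unfolding qf_def by (intro tendsto_intros cinner.tendsto)

definition selfadjoint :: "('a::chilbert_space \<Rightarrow>\<^sub>L 'a) \<Rightarrow> bool"
  where "selfadjoint A \<longleftrightarrow> A \<in> bop \<and> adj A = A"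

lemma selfadjoint_swap: "selfadjoint A \<Longrightarrow> cinner (A x) y = cinner x (A y)"
  by (metis cinner_adj_right selfadjoint_def)

text \<open>Polarisation: reality of the form at x + y relates the imaginary parts of the two mixed
  terms, and replacing x by i x relates their real parts. Together they say that A is
  symmetric.\<close>

lemma positive_op_iff: "positive_op A \<longleftrightarrow> selfadjoint A \<and> (\<forall>x. 0 \<le> qf A x)"
proof
  assume p: "positive_op A"
  then have A: "A \<in> bop" and re: "\<And>x. cinner (A x) x \<in> \<real>" by (auto simp: positive_op_def)
  have sym: "Im (cinner (A x) x) = 0" for x using re[of x] by (simp add: complex_is_Real_iff)
  have im: "Im (cinner (A x) y + cinner (A y) x) = 0" for x y
    using sym[of "x + y"] sym[of x] sym[of y]
    by (simp add: blinfun.add_right cinner_add_left cinner_add_right)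
  have "cinner (A x) y = cinner x (A y)" for x y
  proof -
    have 1: "Im (cinner (A x) y) = - Im (cinner (A y) x)" using im[of x y] by simp
    have 2: "Re (cinner (A x) y) = Re (cinner (A y) x)"
      using im[of "\<i> *\<^sub>C x" y] by (simp add: bop_scaleC[OF A] cinner_scaleC_left cinner_scaleC_right)
    have "cinner x (A y) = cnj (cinner (A y) x)" by (rule cinner_commute)
    then show ?thesis using 1 2 by (simp add: complex_eq_iff)
  qed
  then have "adj A = A" by (rule adj_eqI)
  with A p show "selfadjoint A \<and> (\<forall>x. 0 \<le> qf A x)"
    by (auto simp: selfadjoint_def positive_op_def qf_def)
next
  assume p: "selfadjoint A \<and> (\<forall>x. 0 \<le> qf A x)"
  have "cinner (A x) x = cnj (cinner (A x) x)" for x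
    by (metis cinner_commute p selfadjoint_swap)
  then show "positive_op A"
    using p by (auto simp: positive_op_def selfadjoint_def qf_def complex_is_Real_iff)
      (metis Reals_cnj_iff complex_is_Real_iff)
qed

lemma positive_op_bop: "positive_op A \<Longrightarrow> A \<in> bop"
  by (simp add: positive_op_def)

lemma positive_op_selfadjoint: "positive_op A \<Longrightarrow> selfadjoint A"
  by (simp add: positive_op_iff)

text \<open>Along the line x + t y the form is a nonnegative quadratic in the real variable t. Its
  leading coefficient may vanish, hence the case distinction.\<close>

lemma positive_op_cauchy_schwarz:
  assumes "positive_op A"
  shows "(Re (cinner (A x) y))\<^sup>2 \<le> qf A x * qf A y"
proof -
  have sa: "selfadjoint A" and pos: "\<And>x. 0 \<le> qf A x"
    using assms by (auto simp: positive_op_iff)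
  define b where "b = Re (cinner (A x) y)"
  have ge: "0 \<le> qf A x + 2 * t * b + t\<^sup>2 * qf A y" for t
  proof -
    have "Re (cinner (A y) x) = b"
      by (metis Re_cinner_commute b_def sa selfadjoint_swap)
    then have "qf A (x + t *\<^sub>R y) = qf A x + 2 * t * b + t\<^sup>2 * qf A y"
      by (simp add: qf_def b_def blinfun.add_right blinfun.scaleR_right cinner_add_left
          cinner_add_right cinner.scaleR_left cinner.scaleR_right power2_eq_square algebra_simps)
    then show ?thesis using pos[of "x + t *\<^sub>R y"] by simp
  qed
  show ?thesis
  proof (cases "qf A y = 0")
    case True
    have "b = 0"
    proof (rule ccontr)
      assume "b \<noteq> 0"
      \<comment> \<open>With the quadratic term absent, this t gives the expression in
        \<open>ge\<close> the value -1.\<close>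
      then have "2 * (- (qf A x + 1) / (2 * b)) * b = - (qf A x + 1)" by simp
      then show False using ge[of "- (qf A x + 1) / (2 * b)"] True by simp
    qed
    then show ?thesis using True by (simp add: b_def)
  next
    case False
    then have y: "qf A y > 0" using pos[of y] by simp
    \<comment> \<open>Evaluation at the minimiser of the quadratic.\<close>
    have "qf A x + 2 * (- b / qf A y) * b + (- b / qf A y)\<^sup>2 * qf A y = qf A x - b\<^sup>2 / qf A y"
      using y by (simp add: power2_eq_square field_simps)
    then have "b\<^sup>2 / qf A y \<le> qf A x" using ge[of "- b / qf A y"] by linarith
    then show ?thesis using y by (simp add: b_def field_simps)
  qed
qed

lemma positive_op_apply_zero:
  assumes "positive_op A" "qf A x = 0"
  shows "A x = 0"
proof -
  have "(Re (cinner (A x) (A x)))\<^sup>2 \<le> 0"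
    using positive_op_cauchy_schwarz[OF assms(1), of x "A x"] assms(2) by simp
  then show ?thesis by simp
qed

text \<open>Cauchy-Schwarz for the form of A, applied to x and A x, bounds the fourth power of norm
  (A x) by the squares of norm x and norm (A x). A bound on the form thus becomes a bound on the
  norm.\<close>

lemma positive_contraction_norm:
  assumes "positive_op A" "\<And>x. qf A x \<le> (norm x)\<^sup>2"
  shows "norm A \<le> 1"
proof (rule norm_blinfun_bound)
  fix x
  have "(Re (cinner (A x) (A x)))\<^sup>2 \<le> qf A x * qf A (A x)"
    by (rule positive_op_cauchy_schwarz[OF assms(1)])
  also have "\<dots> \<le> (norm x)\<^sup>2 * (norm (A x))\<^sup>2"
    using assms by (intro mult_mono) (auto simp: positive_op_iff)
  finally have "((norm (A x)) * (norm (A x)))\<^sup>2 \<le> (norm x * norm (A x))\<^sup>2"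
    by (simp add: power2_eq_square ac_simps)
  then have "norm (A x) * norm (A x) \<le> norm x * norm (A x)"
    by (rule power2_le_imp_le) simp
  then show "norm (A x) \<le> 1 * norm x"
    by (cases "norm (A x) = 0") (auto simp: mult_le_cancel_right)
qed simp

lemma adj_compose_self_positive:
  assumes "A \<in> bop" shows "positive_op (adj A o\<^sub>L A)" "qf (adj A o\<^sub>L A) x = (norm (A x))\<^sup>2"
proof -
  show q: "qf (adj A o\<^sub>L A) x = (norm (A x))\<^sup>2" for x
    by (simp add: qf_def cinner_adj_left[OF assms])
  show "positive_op (adj A o\<^sub>L A)"
    using assms by (simp add: positive_op_iff q selfadjoint_def bop_compose adj_compose)
qed

text \<open>The square root of \<open>A\<close> with \<open>0 \<le> A \<le> I\<close> is \<open>I - Y\<close>, where \<open>Y\<close> is the limit of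
  \<open>Y\<^sub>0 = 0\<close>, \<open>Y\<^sub>m\<^sub>+\<^sub>1 = (I - A + Y\<^sub>m\<^sup>2) / 2\<close>. The scalar iteration for \<open>A = 0\<close> majorises the increments.\<close>

fun sqrt_iter :: "('a::chilbert_space \<Rightarrow>\<^sub>L 'a) \<Rightarrow> nat \<Rightarrow> ('a \<Rightarrow>\<^sub>L 'a)" where
  "sqrt_iter D 0 = 0"
| "sqrt_iter D (Suc m) = (1/2) *\<^sub>R (D + (sqrt_iter D m o\<^sub>L sqrt_iter D m))"

fun sqrt_major :: "nat \<Rightarrow> real" where
  "sqrt_major 0 = 0"
| "sqrt_major (Suc m) = (1 + (sqrt_major m)\<^sup>2) / 2"

lemma sqrt_major_bounds: "0 \<le> sqrt_major m" "sqrt_major m \<le> 1"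
proof -
  have "0 \<le> sqrt_major m \<and> sqrt_major m \<le> 1"
    by (induction m) (auto simp: power_le_one)
  then show "0 \<le> sqrt_major m" "sqrt_major m \<le> 1" by auto
qed

lemma sqrt_major_convergent: "convergent sqrt_major"
proof -
  have "sqrt_major m \<le> sqrt_major (Suc m)" for m
    using zero_le_power2[of "sqrt_major m - 1"] by (simp add: power2_diff)
  then have "incseq sqrt_major" by (rule incseq_SucI)
  then show ?thesis
    using incseq_convergent[of sqrt_major 1] sqrt_major_bounds(2) by (metis convergentI)
qed

lemma norm_sqrt_iter:
  assumes "norm D \<le> 1" shows "norm (sqrt_iter D m) \<le> sqrt_major m"
proof (induction m)
  case (Suc m)
  have "norm (sqrt_iter D m o\<^sub>L sqrt_iter D m) \<le> sqrt_major m * sqrt_major m"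
    using norm_blinfun_compose[of "sqrt_iter D m" "sqrt_iter D m"]
      mult_mono[OF Suc Suc sqrt_major_bounds(1) norm_ge_zero] by linarith
  then have "norm (D + (sqrt_iter D m o\<^sub>L sqrt_iter D m)) \<le> 1 + (sqrt_major m)\<^sup>2"
    using norm_triangle_ineq[of D "sqrt_iter D m o\<^sub>L sqrt_iter D m"] assms
    unfolding power2_eq_square by linarith
  then show ?case by simp
qed simp

lemma norm_sqrt_iter_diff:
  assumes D: "norm D \<le> 1"
  shows "norm (sqrt_iter D (Suc m) - sqrt_iter D m) \<le> sqrt_major (Suc m) - sqrt_major m"
proof (induction m)
  case (Suc m)
  let ?Y = "sqrt_iter D (Suc m)" and ?X = "sqrt_iter D m"
  let ?y = "sqrt_major (Suc m)" and ?x = "sqrt_major m"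
  have "sqrt_iter D (Suc (Suc m)) - ?Y = (1/2) *\<^sub>R ((?Y o\<^sub>L ?Y) - (?X o\<^sub>L ?X))"
    by (simp add: scaleR_diff_right[symmetric] del: scaleR_diff_right)
  \<comment> \<open>This splitting of a difference of squares keeps the order of the factors, so it
    is valid for non-commuting operators; its scalar counterpart is (y - x)(y + x).\<close>
  also have "(?Y o\<^sub>L ?Y) - (?X o\<^sub>L ?X) = (?Y o\<^sub>L (?Y - ?X)) + ((?Y - ?X) o\<^sub>L ?X)"
    by (rule blinfun_eqI) (simp only: blinfun.diff_left blinfun.add_left blinfun_apply_blinfun_compose
        blinfun.diff_right, simp)
  finally have eq: "sqrt_iter D (Suc (Suc m)) - ?Y = (1/2) *\<^sub>R ((?Y o\<^sub>L (?Y - ?X)) + ((?Y - ?X) o\<^sub>L ?X))" .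
  have "norm (?Y o\<^sub>L (?Y - ?X)) \<le> ?y * (?y - ?x)"
    by (rule order_trans[OF norm_blinfun_compose])
      (rule mult_mono[OF norm_sqrt_iter[OF D] Suc sqrt_major_bounds(1) norm_ge_zero])
  moreover have "norm ((?Y - ?X) o\<^sub>L ?X) \<le> (?y - ?x) * ?x"
  proof (rule order_trans[OF norm_blinfun_compose], rule mult_mono[OF Suc norm_sqrt_iter[OF D]])
    show "0 \<le> ?y - ?x" using Suc norm_ge_zero order_trans by blast
  qed simp
  ultimately have "norm ((?Y o\<^sub>L (?Y - ?X)) + ((?Y - ?X) o\<^sub>L ?X)) \<le> ?y * (?y - ?x) + (?y - ?x) * ?x"
    by (rule order_trans[OF norm_triangle_ineq add_mono])
  also have "\<dots> = ?y\<^sup>2 - ?x\<^sup>2" by (simp only: power2_eq_square) algebra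
  finally have "norm (sqrt_iter D (Suc (Suc m)) - ?Y) \<le> (?y\<^sup>2 - ?x\<^sup>2) / 2"
    unfolding eq by simp
  also have "\<dots> = sqrt_major (Suc (Suc m)) - ?y"
    unfolding sqrt_major.simps(2)[of "Suc m"] by (simp add: field_simps)
  finally show ?case .
qed (use D in simp)

lemma sqrt_iter_convergent:
  assumes D: "norm D \<le> 1"
  shows "convergent (sqrt_iter D)"
proof -
  have diff: "norm (sqrt_iter D (m + p) - sqrt_iter D m) \<le> sqrt_major (m + p) - sqrt_major m" for m p
  proof (induction p)
    case (Suc p)
    have "sqrt_iter D (m + Suc p) - sqrt_iter D m
        = (sqrt_iter D (Suc (m + p)) - sqrt_iter D (m + p)) + (sqrt_iter D (m + p) - sqrt_iter D m)"
      by simp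
    then have "norm (sqrt_iter D (m + Suc p) - sqrt_iter D m)
      \<le> norm (sqrt_iter D (Suc (m + p)) - sqrt_iter D (m + p)) + norm (sqrt_iter D (m + p) - sqrt_iter D m)"
      by (metis norm_triangle_ineq)
    also have "\<dots> \<le> (sqrt_major (Suc (m + p)) - sqrt_major (m + p)) + (sqrt_major (m + p) - sqrt_major m)"
      by (rule add_mono[OF norm_sqrt_iter_diff[OF D] Suc])
    finally show ?case by simp
  qed simp
  have "Cauchy (sqrt_iter D)"
  proof (rule CauchyI')
    fix e :: real assume "0 < e"
    then obtain M where M: "\<And>m n. m \<ge> M \<Longrightarrow> n \<ge> M \<Longrightarrow> dist (sqrt_major m) (sqrt_major n) < e"
      using metric_CauchyD[OF convergent_Cauchy[OF sqrt_major_convergent]] by blast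
    have "dist (sqrt_iter D m) (sqrt_iter D n) < e" if "m \<ge> M" "n > m" for m n
    proof -
      have "norm (sqrt_iter D n - sqrt_iter D m) \<le> sqrt_major n - sqrt_major m"
        using diff[of m "n - m"] that by simp
      then show ?thesis using M[of m n] that by (simp add: dist_norm norm_minus_commute)
    qed
    then show "\<exists>M. \<forall>m\<ge>M. \<forall>n>m. dist (sqrt_iter D m) (sqrt_iter D n) < e" by blast
  qed
  then show ?thesis by (rule Cauchy_convergent)
qed

text \<open>Each iterate is a polynomial in D. The limit inherits the commutation, on which the
  uniqueness of square roots rests.\<close>

lemma sqrt_iter_commute:
  assumes "D o\<^sub>L B = B o\<^sub>L D" shows "sqrt_iter D m o\<^sub>L B = B o\<^sub>L sqrt_iter D m"
proof (induction m)
  case (Suc m)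
  have "D (B x) = B (D x)" "sqrt_iter D m (B x) = B (sqrt_iter D m x)" for x
    using assms Suc by (metis blinfun_apply_blinfun_compose)+
  then show ?case
    by (intro blinfun_eqI) (simp add: blinfun.add_left blinfun.scaleR_left blinfun.scaleR_right blinfun.add_right)
qed simp

lemma sqrt_iter_selfadjoint: "selfadjoint D \<Longrightarrow> selfadjoint (sqrt_iter D m)"
  by (induction m) (auto simp: selfadjoint_def bop_add bop_scaleR bop_compose adj_add adj_scaleR adj_compose)

lemma tendsto_blinfun_compose:
  "(A \<longlongrightarrow> L) F \<Longrightarrow> (B \<longlongrightarrow> M) F \<Longrightarrow> ((\<lambda>i. A i o\<^sub>L B i) \<longlongrightarrow> (L o\<^sub>L M)) F"
  by (rule bounded_bilinear.tendsto[OF bounded_bilinear_blinfun_compose])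

text \<open>The limit Y satisfies 2 Y = D + Y Y with D = I - A, which rearranges to (I - Y)(I - Y) =
  A. The last clause makes this root commute with any other root of A.\<close>

lemma positive_sqrt_contraction:
  assumes A: "positive_op A" and le: "\<And>x. qf A x \<le> (norm x)\<^sup>2"
  shows "\<exists>R. positive_op R \<and> R o\<^sub>L R = A \<and> (\<forall>B. A o\<^sub>L B = B o\<^sub>L A \<longrightarrow> R o\<^sub>L B = B o\<^sub>L R)"
proof -
  define D where "D = id_blinfun - A"
  have sa: "selfadjoint A" using A by (simp add: positive_op_iff)
  have Dsa: "selfadjoint D"
    using sa by (simp add: selfadjoint_def D_def bop_diff adj_diff)
  \<comment> \<open>A <= I makes D positive, and A >= 0 bounds its form by the squared norm; both
    are needed for norm D <= 1.\<close>
  have qD: "qf D x = (norm x)\<^sup>2 - qf A x" for x by (simp add: D_def qf_diff qf_id)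
  have "positive_op D" using Dsa le by (simp add: positive_op_iff qD)
  then have D1: "norm D \<le> 1"
    by (rule positive_contraction_norm) (use A in \<open>simp add: qD positive_op_iff\<close>)
  obtain Y where Y: "sqrt_iter D \<longlonglongrightarrow> Y"
    using sqrt_iter_convergent[OF D1] convergent_def by blast
  have "(\<lambda>m. sqrt_iter D (Suc m)) \<longlonglongrightarrow> (1/2) *\<^sub>R (D + (Y o\<^sub>L Y))"
    unfolding sqrt_iter.simps by (intro tendsto_intros tendsto_blinfun_compose Y)
  then have fp: "Y = (1/2) *\<^sub>R (D + (Y o\<^sub>L Y))"
    using LIMSEQ_unique LIMSEQ_Suc[OF Y] by blast
  have "2 *\<^sub>R Y = D + (Y o\<^sub>L Y)" by (subst fp) simp
  then have fp': "2 *\<^sub>R Y x = D x + Y (Y x)" for x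
    by (metis blinfun.add_left blinfun.scaleR_left blinfun_apply_blinfun_compose)
  have Yb: "Y \<in> bop"
    using closed_sequentially[OF closed_bop _ Y] sqrt_iter_selfadjoint[OF Dsa] by (auto simp: selfadjoint_def)
  have "(\<lambda>m. adj (sqrt_iter D m)) \<longlonglongrightarrow> adj Y"
    by (rule tendsto_adj[OF Y _ Yb]) (use sqrt_iter_selfadjoint[OF Dsa] in \<open>auto simp: selfadjoint_def\<close>)
  then have adjY: "sqrt_iter D \<longlonglongrightarrow> adj Y"
    using sqrt_iter_selfadjoint[OF Dsa] by (simp add: selfadjoint_def)
  have "adj Y = Y" by (rule LIMSEQ_unique[OF adjY Y])
  moreover have "norm Y \<le> 1"
    by (rule LIMSEQ_le_const2[OF tendsto_norm[OF Y]])
      (meson norm_sqrt_iter[OF D1] order_trans sqrt_major_bounds(2))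
  moreover have "qf Y x \<le> (norm x)\<^sup>2" for x
    using abs_qf_le[of Y x] mult_right_mono[OF \<open>norm Y \<le> 1\<close>, of "(norm x)\<^sup>2"] by simp
  ultimately have "positive_op (id_blinfun - Y)"
    by (simp add: positive_op_iff selfadjoint_def bop_diff adj_diff Yb qf_diff qf_id)
  moreover have "(id_blinfun - Y) o\<^sub>L (id_blinfun - Y) = A"
  proof (rule blinfun_eqI)
    fix x
    have "((id_blinfun - Y) o\<^sub>L (id_blinfun - Y)) x = x - 2 *\<^sub>R Y x + Y (Y x)"
      by (simp add: blinfun.diff_left blinfun.diff_right scaleR_2)
    also have "\<dots> = A x" by (simp add: fp' D_def blinfun.diff_left)
    finally show "((id_blinfun - Y) o\<^sub>L (id_blinfun - Y)) x = A x" .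
  qed
  moreover have "(id_blinfun - Y) o\<^sub>L B = B o\<^sub>L (id_blinfun - Y)" if "A o\<^sub>L B = B o\<^sub>L A" for B
  proof -
    have AB: "A (B x) = B (A x)" for x using that by (metis blinfun_apply_blinfun_compose)
    have "D o\<^sub>L B = B o\<^sub>L D"
      by (rule blinfun_eqI) (simp add: D_def AB blinfun.diff_left blinfun.diff_right)
    from sqrt_iter_commute[OF this] have c: "sqrt_iter D m o\<^sub>L B = B o\<^sub>L sqrt_iter D m" for m .
    have "(\<lambda>m. sqrt_iter D m o\<^sub>L B) \<longlonglongrightarrow> (Y o\<^sub>L B)" "(\<lambda>m. B o\<^sub>L sqrt_iter D m) \<longlonglongrightarrow> (B o\<^sub>L Y)"
      by (intro tendsto_blinfun_compose Y tendsto_const)+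
    then have "Y o\<^sub>L B = B o\<^sub>L Y"
      unfolding c by (rule LIMSEQ_unique)
    then have "Y (B x) = B (Y x)" for x by (metis blinfun_apply_blinfun_compose)
    then show ?thesis
      by (intro blinfun_eqI) (simp add: blinfun.diff_left blinfun.diff_right)
  qed
  ultimately show ?thesis by blast
qed

lemma positive_op_scaleR: "positive_op A \<Longrightarrow> 0 \<le> r \<Longrightarrow> positive_op (r *\<^sub>R A)"
  by (simp add: positive_op_iff selfadjoint_def bop_scaleR adj_scaleR qf_scaleR)

lemma positive_sqrt_exists:
  assumes A: "positive_op A"
  shows "\<exists>R. positive_op R \<and> R o\<^sub>L R = A \<and> (\<forall>B. A o\<^sub>L B = B o\<^sub>L A \<longrightarrow> R o\<^sub>L B = B o\<^sub>L R)"
proof -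
  \<comment> \<open>The added 1 keeps c positive when A = 0.\<close>
  define c where "c = norm A + 1"
  have c: "c > 0" by (simp add: c_def add_nonneg_pos)
  have qle: "qf ((1 / c) *\<^sub>R A) x \<le> (norm x)\<^sup>2" for x
  proof -
    have "qf A x \<le> c * (norm x)\<^sup>2" using abs_qf_le[of A x] zero_le_power2[of "norm x"] unfolding c_def distrib_right by linarith
    then show ?thesis using c by (simp add: qf_scaleR field_simps)
  qed
  have "positive_op ((1 / c) *\<^sub>R A)"
    by (rule positive_op_scaleR[OF A]) (use c in simp)
  from positive_sqrt_contraction[OF this qle]
  obtain R where R: "positive_op R" "R o\<^sub>L R = (1 / c) *\<^sub>R A"
      "\<And>B. ((1 / c) *\<^sub>R A) o\<^sub>L B = B o\<^sub>L ((1 / c) *\<^sub>R A) \<Longrightarrow> R o\<^sub>L B = B o\<^sub>L R" by blast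
  have RR: "R (R x) = (1 / c) *\<^sub>R A x" for x
    using R(2) by (metis blinfun.scaleR_left blinfun_apply_blinfun_compose)
  have "positive_op (sqrt c *\<^sub>R R)" by (rule positive_op_scaleR[OF R(1)]) (use c in simp)
  moreover have "(sqrt c *\<^sub>R R) o\<^sub>L (sqrt c *\<^sub>R R) = A"
    using c by (intro blinfun_eqI) (simp add: blinfun.scaleR_left blinfun.scaleR_right RR)
  moreover have "(sqrt c *\<^sub>R R) o\<^sub>L B = B o\<^sub>L (sqrt c *\<^sub>R R)" if "A o\<^sub>L B = B o\<^sub>L A" for B
  proof -
    have "A (B x) = B (A x)" for x using that by (metis blinfun_apply_blinfun_compose)
    then have "((1 / c) *\<^sub>R A) o\<^sub>L B = B o\<^sub>L ((1 / c) *\<^sub>R A)"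
      by (intro blinfun_eqI) (simp add: blinfun.scaleR_left blinfun.scaleR_right)
    from R(3)[OF this] have "R (B x) = B (R x)" for x by (metis blinfun_apply_blinfun_compose)
    then show ?thesis
      by (intro blinfun_eqI) (simp add: blinfun.scaleR_left blinfun.scaleR_right)
  qed
  ultimately show ?thesis by blast
qed

text \<open>Commuting roots give (B + C)(B - C) = 0. With y = (B - C) x the forms of B and C at y
  add up to 0, so both vanish, hence B y = C y = 0. Then y is orthogonal to (B - C) x, that is, to
  itself.\<close>

lemma positive_sqrt_unique:
  assumes B: "positive_op B" and C: "positive_op C" and eq: "B o\<^sub>L B = C o\<^sub>L C"
    and comm: "C o\<^sub>L B = B o\<^sub>L C"
  shows "B = C"
proof (rule blinfun_eqI)
  fix x
  have BB: "B (B z) = C (C z)" and CB: "C (B z) = B (C z)" for z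
    using eq comm by (metis blinfun_apply_blinfun_compose)+
  define y where "y = B x - C x"
  have "B y + C y = 0"
    by (simp add: y_def blinfun.diff_right BB CB)
  then have "qf B y + qf C y = 0"
    by (metis qf_add qf_zero blinfun.add_left blinfun.zero_left qf_def)
  then have "qf B y = 0" "qf C y = 0"
    using B C by (auto simp: positive_op_iff add_nonneg_eq_0_iff)
  then have "B y = 0" "C y = 0"
    using B C by (auto intro: positive_op_apply_zero)
  then have "cinner (B x - C x) y = 0"
    using selfadjoint_swap[OF positive_op_selfadjoint[OF B], of x y]
      selfadjoint_swap[OF positive_op_selfadjoint[OF C], of x y]
    by (simp add: cinner.diff_left cinner.zero_right)
  then have "(norm y)\<^sup>2 = 0" by (metis Re_cinner_self y_def zero_complex.simps(1))
  then show "B x = C x" by (simp add: y_def)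
qed

lemma op_sqrt:
  assumes "positive_op A"
  shows "positive_op (op_sqrt A)" "op_sqrt A o\<^sub>L op_sqrt A = A"
proof -
  obtain R where R: "positive_op R" "R o\<^sub>L R = A" "\<And>B. A o\<^sub>L B = B o\<^sub>L A \<Longrightarrow> R o\<^sub>L B = B o\<^sub>L R"
    using positive_sqrt_exists[OF assms] by blast
  have "op_sqrt A = R"
    unfolding op_sqrt_def
  proof (rule the_equality)
    fix B assume B: "positive_op B \<and> B o\<^sub>L B = A"
    \<comment> \<open>Any root B commutes with A because A is its square; the commutant clause for R
      then applies to B.\<close>
    then have "A o\<^sub>L B = B o\<^sub>L A" by (auto intro!: blinfun_eqI)
    then have comm: "R o\<^sub>L B = B o\<^sub>L R" by (rule R(3))
    have "B o\<^sub>L B = R o\<^sub>L R" unfolding R(2) by (rule conjunct2[OF B])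
    then show "B = R" by (rule positive_sqrt_unique[OF conjunct1[OF B] R(1) _ comm])
  qed (rule conjI[OF R(1,2)])
  then show "positive_op (op_sqrt A)" "op_sqrt A o\<^sub>L op_sqrt A = A" by (simp_all only: R(1,2))
qed

lemma norm_op_sqrt_square:
  assumes "positive_op A" shows "(norm (op_sqrt A x))\<^sup>2 = qf A x"
proof -
  have "op_sqrt A (op_sqrt A x) = A x"
    by (simp only: blinfun_apply_blinfun_compose[symmetric] op_sqrt(2)[OF assms])
  then show ?thesis
    using selfadjoint_swap[OF positive_op_selfadjoint[OF op_sqrt(1)[OF assms]], of "op_sqrt A x" x]
    by (simp add: qf_def Re_cinner_self[symmetric] del: Re_cinner_self)
qed

section \<open>Operators on square-summable families\<close>

lemmas ell2_coord_simps = plus_ell2.rep_eq minus_ell2.rep_eq uminus_ell2.rep_eq zero_ell2.rep_eq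
  scaleR_ell2.rep_eq scaleC_ell2.rep_eq chi.rep_eq elem_tensor.rep_eq

lift_definition coordL :: "'i \<Rightarrow> (('i, 'a::chilbert_space) ell2 \<Rightarrow>\<^sub>L 'a)" is "\<lambda>i x. ell2_coord x i"
  by (rule bounded_linear_intro[where K = 1]) (auto simp: ell2_coord_simps norm_coord_le_norm_ell2)

lemma ell2_coord_sum: "ell2_coord (sum f I) i = (\<Sum>j\<in>I. ell2_coord (f j) i)"
  by (induction I rule: infinite_finite_induct) (auto simp: ell2_coord_simps)

text \<open>Operators into square-summable families are assembled from their coordinates. One bound
  on all finite partial norms yields membership in the space, continuity and the norm estimate
  together.\<close>

lemma ell2_op_exists:
  fixes A :: "'i \<Rightarrow> ('x::real_normed_vector \<Rightarrow>\<^sub>L 'h::chilbert_space)"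
  assumes "\<And>K y. finite K \<Longrightarrow> L2_set (\<lambda>i. norm (A i y)) K \<le> c * norm y" "0 \<le> c"
  shows "\<exists>F :: 'x \<Rightarrow>\<^sub>L ('i, 'h) ell2. (\<forall>y i. ell2_coord (blinfun_apply F y) i = A i y) \<and> norm F \<le> c"
proof -
  define g where "g y = (Abs_ell2 (\<lambda>i. A i y) :: ('i, 'h) ell2)" for y
  have "(\<lambda>i. (norm (A i y))\<^sup>2) summable_on UNIV" for y
    unfolding square_summable_iff using assms(1) by blast
  then have g: "ell2_coord (g y) = (\<lambda>i. A i y)" for y
    unfolding g_def by (intro Abs_ell2_inverse) simp
  have n: "norm (g y) \<le> c * norm y" for y
    by (rule norm_ell2_leI) (simp add: g assms(1))
  have bl: "bounded_linear g"
  proof (rule bounded_linear_intro)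
    show "g (x + y) = g x + g y" for x y
      by (rule ell2_eqI) (simp add: g ell2_coord_simps blinfun.add_right)
    show "g (r *\<^sub>R y) = r *\<^sub>R g y" for r y
      by (rule ell2_eqI) (simp add: g ell2_coord_simps blinfun.scaleR_right)
    show "norm (g y) \<le> norm y * c" for y
      using n[of y] by (simp add: mult.commute)
  qed
  show ?thesis
  proof (intro exI conjI allI)
    show "ell2_coord (Blinfun g y) i = A i y" for y i
      by (simp add: bounded_linear_Blinfun_apply[OF bl] g)
    show "norm (Blinfun g) \<le> c"
      by (rule norm_blinfun_bound) (simp_all add: bounded_linear_Blinfun_apply[OF bl] n assms(2))
  qed
qed

lemma ell2_op_bop:
  fixes F :: "'x::chilbert_space \<Rightarrow>\<^sub>L ('i, 'h::chilbert_space) ell2"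
    and A :: "'i \<Rightarrow> ('x \<Rightarrow>\<^sub>L 'h)"
  assumes "\<And>y i. ell2_coord (F y) i = A i y" "\<And>i. A i \<in> bop"
  shows "F \<in> bop"
  by (rule bopI, rule ell2_eqI) (simp add: assms(1) ell2_coord_simps bop_scaleC[OF assms(2)])

lemma norm_ell2_square: "(norm x)\<^sup>2 = (\<Sum>\<^sub>\<infinity>i. (norm (ell2_coord x i))\<^sup>2)"
  by (simp add: norm_ell2_def infsum_nonneg)

text \<open>Subtracting a finite partial sum erases exactly the coordinates in F, so the squared
  error is a tail of the convergent series for the squared norm. Hence bounded maps are determined
  by their values on tensors \<open>elem_tensor (chi j) h\<close>.\<close>

lemma has_sum_ell2_coord:
  "((\<lambda>j. elem_tensor (chi j) (ell2_coord x j)) has_sum x) UNIV"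
proof -
  let ?f = "\<lambda>j. elem_tensor (chi j) (ell2_coord x j)"
  have coord: "ell2_coord (x - sum ?f F) i = (if i \<in> F then 0 else ell2_coord x i)" if "finite F" for F i
  proof -
    have "ell2_coord (sum ?f F) i = (\<Sum>j\<in>F. if i = j then ell2_coord x i else 0)"
      unfolding ell2_coord_sum by (rule sum.cong) (auto simp: ell2_coord_simps scaleC.zero_left)
    then show ?thesis using that by (simp add: ell2_coord_simps)
  qed
  have nrm: "(norm (x - sum ?f F))\<^sup>2 = (norm x)\<^sup>2 - (\<Sum>j\<in>F. (norm (ell2_coord x j))\<^sup>2)" if "finite F" for F
  proof -
    have "(norm (x - sum ?f F))\<^sup>2 = (\<Sum>\<^sub>\<infinity>i. (norm (ell2_coord (x - sum ?f F) i))\<^sup>2)"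
      by (rule norm_ell2_square)
    also have "\<dots> = (\<Sum>\<^sub>\<infinity>i\<in>UNIV - F. (norm (ell2_coord x i))\<^sup>2)"
      by (rule infsum_cong_neutral) (auto simp: coord[OF that])
    also have "\<dots> = (\<Sum>\<^sub>\<infinity>i. (norm (ell2_coord x i))\<^sup>2) - (\<Sum>\<^sub>\<infinity>i\<in>F. (norm (ell2_coord x i))\<^sup>2)"
      by (rule infsum_Diff) (auto simp: ell2_summable that)
    finally show ?thesis using that by (simp add: norm_ell2_square[of x])
  qed
  have "((\<lambda>j. (norm (ell2_coord x j))\<^sup>2) has_sum (norm x)\<^sup>2) UNIV"
    using has_sum_infsum[OF ell2_summable[of x]] by (simp add: norm_ell2_square)
  then have "((\<lambda>F. (norm x)\<^sup>2 - (\<Sum>j\<in>F. (norm (ell2_coord x j))\<^sup>2)) \<longlongrightarrow> (norm x)\<^sup>2 - (norm x)\<^sup>2)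
      (finite_subsets_at_top UNIV)"
    unfolding has_sum_def by (intro tendsto_intros)
  then have "((\<lambda>F. sqrt ((norm x)\<^sup>2 - (\<Sum>j\<in>F. (norm (ell2_coord x j))\<^sup>2))) \<longlongrightarrow> sqrt 0)
      (finite_subsets_at_top UNIV)"
    by (intro tendsto_real_sqrt) simp
  then have "((\<lambda>F. norm (sum ?f F - x)) \<longlongrightarrow> sqrt 0) (finite_subsets_at_top UNIV)"
  proof (rule Lim_transform_eventually, intro eventually_finite_subsets_at_top_weakI)
    fix F :: "'a set" assume "finite F"
    from nrm[OF this]
    show "sqrt ((norm x)\<^sup>2 - (\<Sum>j\<in>F. (norm (ell2_coord x j))\<^sup>2)) = norm (sum ?f F - x)"
      by (intro real_sqrt_unique) (simp_all only: norm_minus_commute[of "sum ?f F" x] norm_ge_zero)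
  qed
  then have "((\<lambda>F. sum ?f F - x) \<longlongrightarrow> 0) (finite_subsets_at_top UNIV)"
    unfolding real_sqrt_zero by (rule tendsto_norm_zero_cancel)
  then show ?thesis
    unfolding has_sum_def by (rule LIM_zero_cancel)
qed

lemma cinner_elem_tensor: "cinner (elem_tensor x g) (elem_tensor y h) = cinner x y * cinner g h"
proof -
  have "cinner (elem_tensor x g) (elem_tensor y h)
      = (\<Sum>\<^sub>\<infinity>i. cinner (ell2_coord x i) (ell2_coord y i) * cinner g h)"
    unfolding cinner_ell2_def elem_tensor.rep_eq
    by (rule infsum_cong) (simp add: cinner_scaleC_left cinner_scaleC_right cinner_complex_def)
  also have "\<dots> = cinner x y * cinner g h"
    by (simp add: infsum_cmult_left' cinner_ell2_def)
  finally show ?thesis .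
qed

lemma norm_elem_tensor: "norm (elem_tensor x h) = norm x * norm h"
proof -
  have "complex_of_real ((norm (elem_tensor x h))\<^sup>2) = complex_of_real ((norm x * norm h)\<^sup>2)"
    unfolding cinner_self[symmetric] cinner_elem_tensor
    by (simp add: cinner_self power_mult_distrib)
  then have "(norm (elem_tensor x h))\<^sup>2 = (norm x * norm h)\<^sup>2"
    by (simp only: of_real_eq_iff)
  then show ?thesis by (simp add: power2_eq_iff_nonneg)
qed

lemma elem_tensor_add_left: "elem_tensor (x + y) h = elem_tensor x h + elem_tensor y h"
  and elem_tensor_add_right: "elem_tensor x (g + h) = elem_tensor x g + elem_tensor x h"
  and elem_tensor_scaleC_left: "elem_tensor (c *\<^sub>C x) h = c *\<^sub>C elem_tensor x h"
  and elem_tensor_scaleC_right: "elem_tensor x (c *\<^sub>C h) = c *\<^sub>C elem_tensor x h"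
  by (rule ell2_eqI; simp add: ell2_coord_simps scaleC_add_left scaleC_add_right scaleC_scaleC
      scaleC_complex_def mult.commute)+

lemma bounded_bilinear_elem_tensor:
  "bounded_bilinear (elem_tensor :: ('i, complex) ell2 \<Rightarrow> 'a::chilbert_space \<Rightarrow> _)"
proof
  show "\<exists>K. \<forall>a b. norm (elem_tensor a b :: ('i, 'a) ell2) \<le> norm a * norm b * K"
    by (rule exI[of _ 1]) (simp add: norm_elem_tensor)
qed (simp_all add: elem_tensor_add_left elem_tensor_add_right scaleR_scaleC elem_tensor_scaleC_left
    elem_tensor_scaleC_right del: scaleR_scaleC[symmetric])

interpretation elem_tensor: bounded_bilinear
    "elem_tensor :: ('i, complex) ell2 \<Rightarrow> 'a::chilbert_space \<Rightarrow> _"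
  by (rule bounded_bilinear_elem_tensor)

lemma elem_tensor_chi_one: "elem_tensor (chi i) c = c *\<^sub>C (chi i :: ('i, complex) ell2)"
  by (rule ell2_eqI) (simp add: ell2_coord_simps scaleC_complex_def)

lemma ell2_bounded_linear_eqI:
  fixes F G :: "('i, 'a::chilbert_space) ell2 \<Rightarrow> 'b::real_normed_vector"
  assumes "bounded_linear F" "bounded_linear G"
    and eq: "\<And>j h. F (elem_tensor (chi j) h) = G (elem_tensor (chi j) h)"
  shows "F x = G x"
proof -
  have "((\<lambda>j. F (elem_tensor (chi j) (ell2_coord x j))) has_sum F x) UNIV"
    "((\<lambda>j. G (elem_tensor (chi j) (ell2_coord x j))) has_sum G x) UNIV"
    by (rule has_sum_bounded_linear[OF assms(1) has_sum_ell2_coord],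
        rule has_sum_bounded_linear[OF assms(2) has_sum_ell2_coord])
  then show "F x = G x" unfolding eq by (rule has_sum_unique)
qed

lemma ell2_blinfun_eqI:
  fixes F G :: "('i, 'a::chilbert_space) ell2 \<Rightarrow>\<^sub>L 'b::real_normed_vector"
  assumes "\<And>j h. F (elem_tensor (chi j) h) = G (elem_tensor (chi j) h)"
  shows "F = G"
  by (rule blinfun_eqI, rule ell2_bounded_linear_eqI[OF blinfun.bounded_linear_right
        blinfun.bounded_linear_right]) (rule assms)

lemma ell2_bop_eqI:
  fixes F G :: "('i, complex) ell2 \<Rightarrow>\<^sub>L 'b::chilbert_space"
  assumes "F \<in> bop" "G \<in> bop" "\<And>j. F (chi j) = G (chi j)"
  shows "F = G"
  by (rule ell2_blinfun_eqI) (simp add: elem_tensor_chi_one bop_scaleC assms)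

subsection \<open>Ampliation\<close>

lemma norm_sum_elem_tensor_square:
  assumes "finite J"
  shows "(norm (\<Sum>j\<in>J. elem_tensor (x j) (y j)))\<^sup>2 = (\<Sum>j\<in>J. \<Sum>l\<in>J. Re (cinner (x j) (x l) * cinner (y j) (y l)))"
  unfolding Re_cinner_self[symmetric] cinner.sum_left cinner.sum_right cinner_elem_tensor Re_sum
  by (rule sum.swap)

text \<open>With \<open>R = (c\<^sup>2 - f\<^sup>*f)\<^sup>1\<^sup>/\<^sup>2\<close>, \<open>c = \<parallel>f\<parallel>\<close>, one has
  \<open>\<parallel>\<Sum> f \<chi>\<^sub>j \<otimes> y\<^sub>j\<parallel>\<^sup>2 + \<parallel>\<Sum> R \<chi>\<^sub>j \<otimes> y\<^sub>j\<parallel>\<^sup>2 = c\<^sup>2 \<parallel>\<Sum> \<chi>\<^sub>j \<otimes> y\<^sub>j\<parallel>\<^sup>2\<close>; this avoids orthonormal bases.\<close>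

lemma norm_sum_elem_tensor_le:
  fixes f :: "('i, complex) ell2 \<Rightarrow>\<^sub>L ('i, complex) ell2" and y :: "'i \<Rightarrow> 'a::chilbert_space"
  assumes f: "f \<in> bop" and J: "finite J"
  shows "norm (\<Sum>j\<in>J. elem_tensor (f (chi j)) (y j)) \<le> norm f * norm (\<Sum>j\<in>J. elem_tensor (chi j) (y j))"
proof -
  define P where "P = (norm f)\<^sup>2 *\<^sub>R id_blinfun - (adj f o\<^sub>L f)"
  have qP: "qf P x = (norm f)\<^sup>2 * (norm x)\<^sup>2 - (norm (f x))\<^sup>2" for x
    by (simp add: P_def qf_diff qf_scaleR qf_id adj_compose_self_positive(2)[OF f])
  have "positive_op P"
    unfolding positive_op_iff
  proof
    show "selfadjoint P"
      using f by (simp add: P_def selfadjoint_def bop_diff bop_scaleR bop_compose adj_diff adj_scaleR adj_compose)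
    show "\<forall>x. 0 \<le> qf P x"
      using power_mono[OF norm_blinfun[of f] norm_ge_zero, of _ 2] by (simp add: qP power_mult_distrib)
  qed
  note R = op_sqrt[OF this]
  define R where "R = op_sqrt P"
  have RR: "cinner (R u) (R v) = complex_of_real ((norm f)\<^sup>2) * cinner u v - cinner (f u) (f v)" for u v
  proof -
    have "cinner (R u) (R v) = cinner (P u) v"
      using selfadjoint_swap[OF positive_op_selfadjoint[OF R(1)], of "R u" v] R(2)
      by (metis R_def blinfun_apply_blinfun_compose)
    then show ?thesis
      by (simp add: P_def blinfun.diff_left blinfun.scaleR_left cinner.diff_left cinner.scaleR_left
          cinner_adj_left[OF f] scaleR_conv_of_real)
  qed
  have "(norm (\<Sum>j\<in>J. elem_tensor (f (chi j)) (y j)))\<^sup>2 + (norm (\<Sum>j\<in>J. elem_tensor (R (chi j)) (y j)))\<^sup>2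
      = (norm f)\<^sup>2 * (norm (\<Sum>j\<in>J. elem_tensor (chi j) (y j)))\<^sup>2"
    unfolding norm_sum_elem_tensor_square[OF J] RR sum.distrib[symmetric] sum_distrib_left
    by (intro sum.cong refl) (simp add: algebra_simps)
  then have "(norm (\<Sum>j\<in>J. elem_tensor (f (chi j)) (y j)))\<^sup>2
      \<le> (norm f * norm (\<Sum>j\<in>J. elem_tensor (chi j) (y j)))\<^sup>2"
    using zero_le_power2[of "norm (\<Sum>j\<in>J. elem_tensor (R (chi j)) (y j))"]
    unfolding power_mult_distrib by linarith
  then show ?thesis by (rule power2_le_imp_le) simp
qed

text \<open>The i-th coordinate of the ampliation is the adjoint of \<open>E i\<close>, which
  tensors h with the vector \<open>adj f (chi i)\<close>. This gives a bounded coordinate map on the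
  whole space before the ampliation itself is known to exist.\<close>

lemma tensor_id_exists:
  fixes f :: "('i, complex) ell2 \<Rightarrow>\<^sub>L ('i, complex) ell2"
  assumes f: "f \<in> bop"
  shows "\<exists>F :: ('i, 'a::chilbert_space) ell2 \<Rightarrow>\<^sub>L ('i, 'a) ell2.
    (\<forall>x h. blinfun_apply F (elem_tensor x h) = elem_tensor (f x) h) \<and> F \<in> bop \<and> norm F \<le> norm f"
proof -
  define E where "E i = (Blinfun (elem_tensor (adj f (chi i))) :: 'a \<Rightarrow>\<^sub>L ('i, 'a) ell2)" for i
  have E: "E i h = elem_tensor (adj f (chi i)) h" for i h
    unfolding E_def by (rule bounded_linear_Blinfun_apply[THEN fun_cong])
      (rule elem_tensor.bounded_linear_right)
  have Eb: "E i \<in> bop" for i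
    by (rule bopI) (simp add: E elem_tensor_scaleC_right)
  have coord_eq: "ell2_coord u i = cinner u (chi i)" for u :: "('i, complex) ell2" and i
  proof -
    have "cinner u (chi i) = (\<Sum>\<^sub>\<infinity>l\<in>{i}. ell2_coord u i)"
      unfolding cinner_ell2_def by (rule infsum_cong_neutral) (auto simp: chi.rep_eq cinner_complex_def)
    then show ?thesis by simp
  qed
  have val: "adj (E i) (elem_tensor x h) = ell2_coord (f x) i *\<^sub>C h" for i x h
  proof (rule cinner_right_eqI)
    fix g
    have "cinner g (adj (E i) (elem_tensor x h)) = cinner (adj f (chi i)) x * cinner g h"
      by (simp add: cinner_adj_right[OF Eb] E cinner_elem_tensor)
    also have "cinner (adj f (chi i)) x = cnj (ell2_coord (f x) i)"
      unfolding coord_eq cinner_adj_left[OF f] by (rule cinner_commute)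
    finally show "cinner g (adj (E i) (elem_tensor x h)) = cinner g (ell2_coord (f x) i *\<^sub>C h)"
      by (simp add: cinner_scaleC_right)
  qed
  \<comment> \<open>The estimate holds for finite truncations of y, and both sides are continuous in
    y.\<close>
  have bound: "L2_set (\<lambda>i. norm (adj (E i) y)) K \<le> norm f * norm y" if K: "finite K" for K y
  proof (rule tendsto_le[OF finite_subsets_at_top_neq_bot])
    let ?y = "\<lambda>J. \<Sum>j\<in>J. elem_tensor (chi j) (ell2_coord y j)"
    have lim: "(?y \<longlongrightarrow> y) (finite_subsets_at_top UNIV)"
      using has_sum_ell2_coord[of y] by (simp add: has_sum_def)
    show "((\<lambda>J. norm f * norm (?y J)) \<longlongrightarrow> norm f * norm y) (finite_subsets_at_top UNIV)"
      by (intro tendsto_intros lim)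
    show "((\<lambda>J. L2_set (\<lambda>i. norm (adj (E i) (?y J))) K) \<longlongrightarrow> L2_set (\<lambda>i. norm (adj (E i) y)) K)
        (finite_subsets_at_top UNIV)"
      unfolding L2_set_def by (intro tendsto_intros blinfun.tendsto lim)
    show "\<forall>\<^sub>F J in finite_subsets_at_top UNIV. L2_set (\<lambda>i. norm (adj (E i) (?y J))) K \<le> norm f * norm (?y J)"
    proof (rule eventually_finite_subsets_at_top_weakI)
      fix J :: "'i set" assume J: "finite J"
      have eq: "adj (E i) (?y J) = ell2_coord (\<Sum>j\<in>J. elem_tensor (f (chi j)) (ell2_coord y j)) i" for i
        by (simp add: blinfun.sum_right val ell2_coord_sum elem_tensor.rep_eq)
      show "L2_set (\<lambda>i. norm (adj (E i) (?y J))) K \<le> norm f * norm (?y J)"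
        unfolding eq by (rule order_trans[OF L2_set_le_norm_ell2[OF K] norm_sum_elem_tensor_le[OF f J]])
    qed
  qed
  obtain F :: "('i, 'a) ell2 \<Rightarrow>\<^sub>L ('i, 'a) ell2"
    where F: "\<And>y i. ell2_coord (blinfun_apply F y) i = adj (E i) y" "norm F \<le> norm f"
    using ell2_op_exists[of "\<lambda>i. adj (E i)" "norm f", OF bound norm_ge_zero] by blast
  have "F (elem_tensor x h) = elem_tensor (f x) h" for x h
    by (rule ell2_eqI) (simp add: F(1) val elem_tensor.rep_eq)
  moreover have "F \<in> bop"
    by (rule ell2_op_bop[of F "\<lambda>i. adj (E i)"]) (simp_all add: F(1) Eb)
  ultimately show ?thesis using F(2) by blast
qed

lemma tensor_id_eqI:
  assumes "\<And>x h. blinfun_apply F (elem_tensor x h) = elem_tensor (blinfun_apply f x) h"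
  shows "tensor_id f = F"
  unfolding tensor_id_def
proof (rule the_equality)
  fix G :: "('a, 'b) ell2 \<Rightarrow>\<^sub>L ('a, 'b) ell2"
  assume G: "\<forall>x h. G (elem_tensor x h) = elem_tensor (f x) h"
  show "G = F" by (rule ell2_blinfun_eqI) (simp add: G assms)
qed (simp add: assms)

lemma
  fixes f :: "('i, complex) ell2 \<Rightarrow>\<^sub>L ('i, complex) ell2" and h :: "'a::chilbert_space"
  assumes "f \<in> bop"
  shows tensor_id_elem: "tensor_id f (elem_tensor x h) = elem_tensor (f x) h"
    and tensor_id_bop: "tensor_id f \<in> (bop :: (('i, 'a) ell2 \<Rightarrow>\<^sub>L _) set)"
    and norm_tensor_id_le: "norm (tensor_id f :: ('i, 'a) ell2 \<Rightarrow>\<^sub>L _) \<le> norm f"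
proof -
  obtain F :: "('i, 'a) ell2 \<Rightarrow>\<^sub>L ('i, 'a) ell2"
    where F: "\<And>x h. blinfun_apply F (elem_tensor x h) = elem_tensor (f x) h" "F \<in> bop" "norm F \<le> norm f"
    using tensor_id_exists[OF assms] by blast
  have "tensor_id f = F" by (rule tensor_id_eqI) (rule F(1))
  then show "tensor_id f (elem_tensor x h) = elem_tensor (f x) h"
    "tensor_id f \<in> (bop :: (('i, 'a) ell2 \<Rightarrow>\<^sub>L _) set)"
    "norm (tensor_id f :: ('i, 'a) ell2 \<Rightarrow>\<^sub>L _) \<le> norm f" using F by simp_all
qed

lemma tensor_id_add: "f \<in> bop \<Longrightarrow> g \<in> bop \<Longrightarrow> tensor_id (f + g) = tensor_id f + tensor_id g"
  and tensor_id_diff: "f \<in> bop \<Longrightarrow> g \<in> bop \<Longrightarrow> tensor_id (f - g) = tensor_id f - tensor_id g"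
  and tensor_id_scaleC: "f \<in> bop \<Longrightarrow> tensor_id (c *\<^sub>C f) = c *\<^sub>C tensor_id f"
  and tensor_id_compose: "f \<in> bop \<Longrightarrow> g \<in> bop \<Longrightarrow> tensor_id (f o\<^sub>L g) = tensor_id f o\<^sub>L tensor_id g"
  by (rule tensor_id_eqI; simp add: blinfun.add_left blinfun.diff_left tensor_id_elem
      elem_tensor_add_left elem_tensor.diff_left elem_tensor_scaleC_left)+

lemma tensor_id_adj:
  fixes f :: "('i, complex) ell2 \<Rightarrow>\<^sub>L ('i, complex) ell2"
  assumes f: "f \<in> bop"
  shows "tensor_id (adj f) = adj (tensor_id f :: ('i, 'a::chilbert_space) ell2 \<Rightarrow>\<^sub>L ('i, 'a) ell2)"
proof (rule tensor_id_eqI, rule cinner_left_eqI)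
  fix x :: "('i, complex) ell2" and h :: 'a and z :: "('i, 'a) ell2"
  let ?w = "elem_tensor x h"
  have "cinner z (adj (tensor_id f) ?w) = cinner z (elem_tensor (adj f x) h)"
    by (rule ell2_bounded_linear_eqI[OF cinner.bounded_linear_left cinner.bounded_linear_left])
      (simp add: tensor_id_elem f cinner_adj_right[OF tensor_id_bop[OF f]] cinner_adj_right[OF f]
        cinner_elem_tensor)
  then show "cinner (adj (tensor_id f) ?w) z = cinner (elem_tensor (adj f x) h) z"
    by (metis cinner_commute)
qed

subsection \<open>Weighted composition operators\<close>

text \<open>The coordinate j of the image is c j times the coordinate \<tau> j of the argument.
  Shifts, their adjoints, the Fock projection and block embeddings all have this shape. The
  coefficient space is arbitrary, so scalar operators and their ampliations share one
  formula.\<close>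

definition wcomp :: "'j set \<Rightarrow> ('j \<Rightarrow> complex) \<Rightarrow> ('j \<Rightarrow> 'i) \<Rightarrow>
    (('i, 'a::chilbert_space) ell2 \<Rightarrow>\<^sub>L ('j, 'a) ell2)"
  where "wcomp D c \<tau> = (SOME F. \<forall>x j. ell2_coord (blinfun_apply F x) j
    = (if j \<in> D then c j *\<^sub>C ell2_coord x (\<tau> j) else 0))"

text \<open>Injectivity ensures that no coordinate is read twice; together with the bound on the
  weights this makes the operator a contraction.\<close>

definition wcomp_ok :: "'j set \<Rightarrow> ('j \<Rightarrow> complex) \<Rightarrow> ('j \<Rightarrow> 'i) \<Rightarrow> bool"
  where "wcomp_ok D c \<tau> \<longleftrightarrow> inj_on \<tau> D \<and> (\<forall>j\<in>D. cmod (c j) \<le> 1)"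

lemma wcomp_coord:
  fixes x :: "('i, 'a::chilbert_space) ell2" and \<tau> :: "'j \<Rightarrow> 'i"
  assumes ok: "wcomp_ok D c \<tau>"
  shows "ell2_coord (wcomp D c \<tau> x) j = (if j \<in> D then c j *\<^sub>C ell2_coord x (\<tau> j) else 0)"
proof -
  define A where "A j = (if j \<in> D then c j *\<^sub>C coordL (\<tau> j) else 0 :: ('i, 'a) ell2 \<Rightarrow>\<^sub>L 'a)" for j
  have A: "A j x = (if j \<in> D then c j *\<^sub>C ell2_coord x (\<tau> j) else 0)" for j x
    by (simp add: A_def coordL.rep_eq)
  have "L2_set (\<lambda>j. norm (A j y)) K \<le> 1 * norm y" if K: "finite K" for K y
  proof -
    have "L2_set (\<lambda>j. norm (A j y)) K = L2_set (\<lambda>j. norm (A j y)) (K \<inter> D)"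
      unfolding L2_set_def using K
      by (intro arg_cong[where f = sqrt] sum.mono_neutral_cong_right) (auto simp: A)
    also have "\<dots> \<le> L2_set (\<lambda>j. norm (ell2_coord y (\<tau> j))) (K \<inter> D)"
      using ok by (intro L2_set_mono) (auto simp: A norm_scaleC wcomp_ok_def intro: mult_left_le_one_le)
    also have "\<dots> = L2_set (\<lambda>i. norm (ell2_coord y i)) (\<tau> ` (K \<inter> D))"
      unfolding L2_set_def using ok
      by (subst sum.reindex) (auto simp: wcomp_ok_def intro: inj_on_subset)
    also have "\<dots> \<le> norm y" using K by (intro L2_set_le_norm_ell2) simp
    finally show ?thesis by simp
  qed
  from ell2_op_exists[of A 1, OF this]
  obtain F :: "('i, 'a) ell2 \<Rightarrow>\<^sub>L ('j, 'a) ell2" where "\<forall>y j. ell2_coord (blinfun_apply F y) j = A j y" by auto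
  then have "\<forall>x j. ell2_coord (wcomp D c \<tau> x :: ('j, 'a) ell2) j = (if j \<in> D then c j *\<^sub>C ell2_coord x (\<tau> j) else 0)"
    unfolding wcomp_def A by (rule someI)
  then show ?thesis by blast
qed

lemma wcomp_bop: "wcomp_ok D c \<tau> \<Longrightarrow> wcomp D c \<tau> \<in> bop"
  by (rule bopI, rule ell2_eqI) (simp add: wcomp_coord ell2_coord_simps scaleC_scaleC mult.commute scaleC.zero_right)

lemma wcomp_elem_tensor:
  assumes "wcomp_ok D c \<tau>"
  shows "wcomp D c \<tau> (elem_tensor x h) = elem_tensor (wcomp D c \<tau> x) h"
  by (rule ell2_eqI)
    (simp add: wcomp_coord[OF assms] ell2_coord_simps scaleC_scaleC scaleC_complex_def scaleC.zero_left)

lemma tensor_id_wcomp: "wcomp_ok D c \<tau> \<Longrightarrow> tensor_id (wcomp D c \<tau>) = wcomp D c \<tau>"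
  by (rule tensor_id_eqI) (rule wcomp_elem_tensor)

lemma wcomp_ok_converse:
  assumes "wcomp_ok D c \<tau>"
    and fwd: "\<And>j. j \<in> D \<Longrightarrow> \<tau> j \<in> D' \<and> \<tau>' (\<tau> j) = j \<and> c' (\<tau> j) = cnj (c j)"
    and bwd: "\<And>i. i \<in> D' \<Longrightarrow> \<tau>' i \<in> D \<and> \<tau> (\<tau>' i) = i"
  shows "wcomp_ok D' c' \<tau>'"
  unfolding wcomp_ok_def
proof
  show "inj_on \<tau>' D'" by (rule inj_onI) (metis bwd)
  show "\<forall>i\<in>D'. cmod (c' i) \<le> 1"
  proof
    fix i assume "i \<in> D'"
    then have "c' i = cnj (c (\<tau>' i))" "\<tau>' i \<in> D" using fwd bwd by metis+
    then show "cmod (c' i) \<le> 1" using assms(1) by (simp add: wcomp_ok_def)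
  qed
qed

text \<open>Reindexing the inner product along the bijection \<tau> from D onto D' moves the
  operator to the other argument: the inverse map \<tau>' appears, with conjugated weights.\<close>

lemma adj_wcomp:
  assumes ok: "wcomp_ok D c \<tau>"
    and fwd: "\<And>j. j \<in> D \<Longrightarrow> \<tau> j \<in> D' \<and> \<tau>' (\<tau> j) = j \<and> c' (\<tau> j) = cnj (c j)"
    and bwd: "\<And>i. i \<in> D' \<Longrightarrow> \<tau>' i \<in> D \<and> \<tau> (\<tau>' i) = i"
  shows "adj (wcomp D c \<tau>) = wcomp D' c' \<tau>'"
proof (rule adj_eqI)
  fix x y
  have ok': "wcomp_ok D' c' \<tau>'" by (rule wcomp_ok_converse[OF assms])
  have "cinner (wcomp D c \<tau> x) y = (\<Sum>\<^sub>\<infinity>j\<in>D. c j * cinner (ell2_coord x (\<tau> j)) (ell2_coord y j))"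
    unfolding cinner_ell2_def
    by (rule infsum_cong_neutral) (auto simp: wcomp_coord[OF ok] cinner_scaleC_left cinner.zero_left)
  also have "\<dots> = (\<Sum>\<^sub>\<infinity>j\<in>D. cnj (c' (\<tau> j)) * cinner (ell2_coord x (\<tau> j)) (ell2_coord y (\<tau>' (\<tau> j))))"
    by (rule infsum_cong) (simp add: fwd)
  also have "\<dots> = (\<Sum>\<^sub>\<infinity>i\<in>D'. cnj (c' i) * cinner (ell2_coord x i) (ell2_coord y (\<tau>' i)))"
    by (rule infsum_reindex_bij_betw[where g = \<tau>]) (rule bij_betwI[where g = \<tau>'], use fwd bwd in auto)
  also have "\<dots> = cinner x (wcomp D' c' \<tau>' y)"
    unfolding cinner_ell2_def
    by (rule infsum_cong_neutral) (auto simp: wcomp_coord[OF ok'] cinner_scaleC_right cinner.zero_right)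
  finally show "cinner (wcomp D c \<tau> x) y = cinner x (wcomp D' c' \<tau>' y)" .
qed

subsection \<open>Operator matrices\<close>

text \<open>The supremum defining the matrix norm is meaningful only over a bounded set; the sum of
  all entry norms is a crude bound.\<close>

lemma op_matrix_norm_bdd:
  fixes A :: "nat \<Rightarrow> nat \<Rightarrow> ('a::chilbert_space \<Rightarrow>\<^sub>L 'b::chilbert_space)"
  shows "bdd_above ((\<lambda>x. L2_set (\<lambda>i. norm (\<Sum>j<m. A i j (x j))) {..<m}) ` {x. L2_set (\<lambda>j. norm (x j)) {..<m} \<le> 1})"
proof (rule bdd_aboveI2)
  fix x :: "nat \<Rightarrow> 'a" assume "x \<in> {x. L2_set (\<lambda>j. norm (x j)) {..<m} \<le> 1}"
  then have x: "norm (x j) \<le> 1" if "j < m" for j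
    using member_le_L2_set[of "{..<m}" j "\<lambda>j. norm (x j)"] that by simp
  have "L2_set (\<lambda>i. norm (\<Sum>j<m. A i j (x j))) {..<m} \<le> (\<Sum>i<m. norm (\<Sum>j<m. A i j (x j)))"
    by (rule L2_set_le_sum) simp
  also have "\<dots> \<le> (\<Sum>i<m. \<Sum>j<m. norm (A i j))"
  proof (intro sum_mono order_trans[OF norm_sum])
    fix i j assume "j \<in> {..<m}"
    then show "norm (A i j (x j)) \<le> norm (A i j)"
      using norm_blinfun[of "A i j" "x j"] mult_left_mono[OF x, of j "norm (A i j)"] by simp
  qed
  finally show "L2_set (\<lambda>i. norm (\<Sum>j<m. A i j (x j))) {..<m} \<le> (\<Sum>i<m. \<Sum>j<m. norm (A i j))" .
qed

lemma op_matrix_norm_leI: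
  fixes A :: "nat \<Rightarrow> nat \<Rightarrow> ('a::chilbert_space \<Rightarrow>\<^sub>L 'b::chilbert_space)"
  assumes "\<And>x. L2_set (\<lambda>j. norm (x j)) {..<m} \<le> 1 \<Longrightarrow> L2_set (\<lambda>i. norm (\<Sum>j<m. A i j (x j))) {..<m} \<le> M"
  shows "op_matrix_norm m A \<le> M"
  unfolding op_matrix_norm_def
proof (rule cSUP_least)
  have "(\<lambda>_. 0) \<in> {x :: nat \<Rightarrow> 'a. L2_set (\<lambda>j. norm (x j)) {..<m} \<le> 1}"
    by (simp add: L2_set_def)
  then show "{x :: nat \<Rightarrow> 'a. L2_set (\<lambda>j. norm (x j)) {..<m} \<le> 1} \<noteq> {}"
    unfolding ex_in_conv[symmetric] by (rule exI[of _ "\<lambda>_. 0"])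
qed (rule assms, simp only: mem_Collect_eq)

lemma op_matrix_norm_nonneg:
  fixes A :: "nat \<Rightarrow> nat \<Rightarrow> ('a::chilbert_space \<Rightarrow>\<^sub>L 'b::chilbert_space)"
  shows "0 \<le> op_matrix_norm m A"
proof -
  have "L2_set (\<lambda>i. norm (\<Sum>j<m. A i j 0)) {..<m} \<le> op_matrix_norm m A"
    unfolding op_matrix_norm_def
    by (rule cSUP_upper2[OF op_matrix_norm_bdd, of "\<lambda>_. 0"]) (simp_all add: L2_set_def)
  then show ?thesis using L2_set_nonneg order_trans by blast
qed

lemma op_matrix_norm_bound:
  fixes A :: "nat \<Rightarrow> nat \<Rightarrow> ('a::chilbert_space \<Rightarrow>\<^sub>L 'b::chilbert_space)"
  shows "L2_set (\<lambda>i. norm (\<Sum>j<m. A i j (x j))) {..<m} \<le> op_matrix_norm m A * L2_set (\<lambda>j. norm (x j)) {..<m}"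
proof (cases "L2_set (\<lambda>j. norm (x j)) {..<m} = 0")
  case True
  then have "x j = 0" if "j < m" for j
    using that by (simp add: L2_set_eq_0_iff)
  then have "(\<Sum>j<m. A i j (x j)) = 0" for i
    by (intro sum.neutral) simp
  then show ?thesis using True by (simp add: L2_set_def)
next
  case False
  define t where "t = L2_set (\<lambda>j. norm (x j)) {..<m}"
  have t: "t > 0" using False by (simp add: t_def less_le L2_set_nonneg)
  define z where "z j = (1 / t) *\<^sub>R x j" for j
  have "L2_set (\<lambda>j. norm (z j)) {..<m} = (1 / t) * L2_set (\<lambda>j. norm (x j)) {..<m}"
    using t by (subst L2_set_right_distrib) (auto simp: z_def)
  then have "L2_set (\<lambda>j. norm (z j)) {..<m} \<le> 1" using t by (simp add: t_def[symmetric])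
  then have "L2_set (\<lambda>i. norm (\<Sum>j<m. A i j (z j))) {..<m} \<le> op_matrix_norm m A"
    unfolding op_matrix_norm_def
    by (intro cSUP_upper2[OF op_matrix_norm_bdd, of z]) auto
  moreover have "L2_set (\<lambda>i. norm (\<Sum>j<m. A i j (z j))) {..<m}
      = (1 / t) * L2_set (\<lambda>i. norm (\<Sum>j<m. A i j (x j))) {..<m}"
    using t by (subst L2_set_right_distrib)
      (auto simp: z_def blinfun.scaleR_right scaleR_sum_right[symmetric])
  ultimately show ?thesis using t by (simp add: t_def[symmetric] field_simps)
qed

text \<open>An \<open>m \<times> m\<close> matrix over \<open>\<ell>\<^sup>2('i)\<close> is one operator on \<open>\<ell>\<^sup>2(nat \<times> 'i)\<close>, so that the norm bound
  for the ampliation of a single operator also covers matrices.\<close>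

definition iota :: "nat \<Rightarrow> (('i, 'a::chilbert_space) ell2 \<Rightarrow>\<^sub>L (nat \<times> 'i, 'a) ell2)"
  where "iota p = wcomp ({p} \<times> UNIV) (\<lambda>_. 1) snd"

definition slice :: "nat \<Rightarrow> ((nat \<times> 'i, 'a::chilbert_space) ell2 \<Rightarrow>\<^sub>L ('i, 'a) ell2)"
  where "slice p = wcomp UNIV (\<lambda>_. 1) (\<lambda>i. (p, i))"

lemma iota_ok: "wcomp_ok ({p} \<times> UNIV) (\<lambda>_. 1) snd"
  and slice_ok: "wcomp_ok UNIV (\<lambda>_. 1) (\<lambda>i. (p, i))"
  by (auto simp: wcomp_ok_def inj_on_def)

lemma adj_iota: "adj (iota p) = slice p"
  unfolding iota_def slice_def by (rule adj_wcomp[OF iota_ok]) auto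

lemma iota_bop: "iota p \<in> bop" and slice_bop: "slice p \<in> bop"
  unfolding iota_def slice_def by (rule wcomp_bop[OF iota_ok], rule wcomp_bop[OF slice_ok])

lemma slice_iota: "slice p (iota q x) = (if p = q then x else 0)"
  by (rule ell2_eqI) (simp add: iota_def slice_def wcomp_coord[OF iota_ok] wcomp_coord[OF slice_ok] zero_ell2.rep_eq)

lemma iota_elem_tensor: "iota p (elem_tensor x h) = elem_tensor (iota p x) h"
  and slice_elem_tensor: "slice p (elem_tensor y h) = elem_tensor (slice p y) h"
  unfolding iota_def slice_def by (rule wcomp_elem_tensor[OF iota_ok], rule wcomp_elem_tensor[OF slice_ok])

text \<open>Embeddings into different blocks have orthogonal ranges, so Pythagoras applies.\<close>

lemma norm_sum_iota:
  fixes z :: "nat \<Rightarrow> ('i, 'a::chilbert_space) ell2"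
  shows "norm (\<Sum>p<m. iota p (z p)) = L2_set (\<lambda>p. norm (z p)) {..<m}"
proof -
  have c: "cinner (iota p u) (iota q v) = (if p = q then cinner u v else 0)"
    for p q and u v :: "('i, 'a) ell2"
    using cinner_adj_right[OF iota_bop, of u p "iota q v"]
    by (simp add: adj_iota slice_iota cinner.zero_right split: if_splits)
  have "(norm (\<Sum>p<m. iota p (z p)))\<^sup>2 = (\<Sum>p<m. \<Sum>q<m. if p = q then (norm (z p))\<^sup>2 else 0)"
    unfolding Re_cinner_self[symmetric] cinner.sum_left cinner.sum_right c Re_sum
    by (intro sum.cong) auto
  also have "\<dots> = (\<Sum>p<m. (norm (z p))\<^sup>2)" by simp
  finally show ?thesis
    unfolding L2_set_def by (rule real_sqrt_unique[symmetric, OF _ norm_ge_zero])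
qed

text \<open>Re-embedding the slices gives a vector whose norm s is the left-hand side and whose
  inner product with y has real part s squared; Cauchy-Schwarz then gives s <= norm y.\<close>

lemma L2_set_slice_le: "L2_set (\<lambda>p. norm (slice p y)) {..<m} \<le> norm y"
proof -
  let ?s = "L2_set (\<lambda>p. norm (slice p y)) {..<m}"
  have "?s\<^sup>2 = (\<Sum>p<m. Re (cinner (iota p (slice p y)) y))"
    unfolding L2_set_def
    by (simp add: sum_nonneg cinner_adj_right[OF iota_bop, symmetric] adj_iota)
  also have "\<dots> = Re (cinner (\<Sum>p<m. iota p (slice p y)) y)"
    by (simp add: cinner.sum_left)
  also have "\<dots> \<le> ?s * norm y"
    using Re_cinner_le[of "\<Sum>p<m. iota p (slice p y)" y] by (simp add: norm_sum_iota)
  finally have "?s * ?s \<le> ?s * norm y" by (simp add: power2_eq_square)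
  then show ?thesis
    by (cases "?s = 0") (auto simp: mult_le_cancel_left less_le L2_set_nonneg)
qed

text \<open>The block operator G built from F has norm at most the matrix norm of F. Its ampliation
  is the block operator H with ampliated entries, because both act alike on elementary tensors. The
  bound for the single operator G therefore controls the whole matrix.\<close>

lemma tensor_id_matrix_bound:
  fixes x :: "nat \<Rightarrow> ('i, 'a::chilbert_space) ell2"
  assumes F: "\<And>p q. p < m \<Longrightarrow> q < m \<Longrightarrow> F p q \<in> bop"
  shows "L2_set (\<lambda>p. norm (\<Sum>q<m. tensor_id (F p q) (x q))) {..<m}
    \<le> op_matrix_norm m F * L2_set (\<lambda>q. norm (x q)) {..<m}"
proof -
  define G where "G = (\<Sum>p<m. \<Sum>q<m. iota p o\<^sub>L F p q o\<^sub>L slice q)"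
  have Gx: "G y = (\<Sum>p<m. iota p (\<Sum>q<m. F p q (slice q y)))" for y
    by (simp add: G_def blinfun.sum_left blinfun.sum_right)
  have Gb: "G \<in> bop"
    unfolding G_def by (intro bop_sum bop_compose iota_bop slice_bop F) auto
  have nG: "norm G \<le> op_matrix_norm m F"
  proof (rule norm_blinfun_bound[OF op_matrix_norm_nonneg])
    fix y
    have "norm (G y) \<le> op_matrix_norm m F * L2_set (\<lambda>q. norm (slice q y)) {..<m}"
      unfolding Gx norm_sum_iota by (rule op_matrix_norm_bound)
    also have "\<dots> \<le> op_matrix_norm m F * norm y"
      by (intro mult_left_mono L2_set_slice_le op_matrix_norm_nonneg)
    finally show "norm (G y) \<le> op_matrix_norm m F * norm y" .
  qed
  define H where "H = (\<Sum>p<m. \<Sum>q<m. iota p o\<^sub>L tensor_id (F p q) o\<^sub>L slice q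
    :: (nat \<times> 'i, 'a) ell2 \<Rightarrow>\<^sub>L (nat \<times> 'i, 'a) ell2)"
  have tG: "tensor_id G = H"
  proof (rule tensor_id_eqI)
    fix y h
    have "H (elem_tensor y h) = (\<Sum>p<m. \<Sum>q<m. elem_tensor (iota p (F p q (slice q y))) h)"
      unfolding H_def blinfun.sum_left
      by (intro sum.cong refl) (simp add: slice_elem_tensor tensor_id_elem F iota_elem_tensor)
    also have "\<dots> = elem_tensor (G y) h"
      by (simp add: G_def blinfun.sum_left elem_tensor.sum_left)
    finally show "H (elem_tensor y h) = elem_tensor (G y) h" .
  qed
  have nH: "norm H \<le> op_matrix_norm m F"
    unfolding tG[symmetric] by (rule order_trans[OF norm_tensor_id_le[OF Gb] nG])
  define y where "y = (\<Sum>q<m. iota q (x q))"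
  have sl: "slice q y = x q" if "q < m" for q
    using that by (simp add: y_def blinfun.sum_right slice_iota)
  have Hy: "H y = (\<Sum>p<m. iota p (\<Sum>q<m. tensor_id (F p q) (x q)))"
    unfolding H_def by (simp add: blinfun.sum_left blinfun.sum_right sl)
  have "L2_set (\<lambda>p. norm (\<Sum>q<m. tensor_id (F p q) (x q))) {..<m} = norm (H y)"
    unfolding Hy norm_sum_iota ..
  also have "\<dots> \<le> norm H * norm y" by (rule norm_blinfun)
  also have "\<dots> \<le> op_matrix_norm m F * norm y" by (intro mult_right_mono nH) simp
  also have "norm y = L2_set (\<lambda>q. norm (x q)) {..<m}" unfolding y_def by (rule norm_sum_iota)
  finally show ?thesis .
qed

section \<open>Closed spans of operators\<close>

lemma subspace_closure:
  fixes X :: "'a::real_normed_vector set"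
  assumes "subspace X" shows "subspace (closure X)"
  unfolding subspace_def
proof (intro conjI ballI allI)
  show "0 \<in> closure X" using subspace_0[OF assms] closure_subset by blast
next
  fix x y assume "x \<in> closure X" "y \<in> closure X"
  then obtain u v where "\<And>i. u i \<in> X" "u \<longlonglongrightarrow> x" "\<And>i. v i \<in> X" "v \<longlonglongrightarrow> y"
    unfolding closure_sequential by blast
  then show "x + y \<in> closure X"
    unfolding closure_sequential
    by (intro exI[of _ "\<lambda>i. u i + v i"]) (auto intro: subspace_add[OF assms] tendsto_add)
next
  fix c x assume "x \<in> closure X"
  then obtain u where "\<And>i. u i \<in> X" "u \<longlonglongrightarrow> x" unfolding closure_sequential by blast
  then show "c *\<^sub>R x \<in> closure X"
    unfolding closure_sequential
    by (intro exI[of _ "\<lambda>i. c *\<^sub>R u i"]) (auto intro: subspace_scale[OF assms] tendsto_intros)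
qed

text \<open>The prefix stands for closed: \<open>span\<close> is the real span. Complex scalars
  enter through \<open>wick\<close>, which already contains every complex multiple of its
  products.\<close>

abbreviation cspan :: "'a::real_normed_vector set \<Rightarrow> 'a set"
  where "cspan G \<equiv> closure (span G)"

lemma subspace_cspan: "subspace (cspan G)"
  by (intro subspace_closure subspace_span)

lemma cspan_superset: "x \<in> G \<Longrightarrow> x \<in> cspan G"
  using span_superset closure_subset by blast

lemma cspan_minimal: "G \<subseteq> X \<Longrightarrow> subspace X \<Longrightarrow> closed X \<Longrightarrow> cspan G \<subseteq> X"
  by (intro closure_minimal span_minimal)

lemma bounded_linear_cspan:
  assumes L: "bounded_linear L" and G: "\<And>x. x \<in> G \<Longrightarrow> L x \<in> cspan H" and x: "x \<in> cspan G"
  shows "L x \<in> cspan H"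
proof -
  have "cspan G \<subseteq> L -` cspan H"
  proof (rule cspan_minimal)
    show "closed (L -` cspan H)"
      by (intro closed_vimage linear_continuous_on[OF L] closed_closure)
    show "subspace (L -` cspan H)"
      by (rule linear_subspace_vimage[OF bounded_linear.linear[OF L] subspace_cspan])
  qed (use G in auto)
  then show ?thesis using x by blast
qed

lemma bounded_linear_compose_left: "bounded_linear (\<lambda>X. A o\<^sub>L X)"
  and bounded_linear_compose_right: "bounded_linear (\<lambda>X. X o\<^sub>L A)"
  by (rule bounded_bilinear.bounded_linear_right[OF bounded_bilinear_blinfun_compose],
      rule bounded_bilinear.bounded_linear_left[OF bounded_bilinear_blinfun_compose])

lemma bounded_linear_scaleC_blinfun:
  "bounded_linear (\<lambda>X :: 'a::real_normed_vector \<Rightarrow>\<^sub>L 'b::chilbert_space. c *\<^sub>C X)"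
proof -
  have "(\<lambda>X :: 'a \<Rightarrow>\<^sub>L 'b. c *\<^sub>C X) = (\<lambda>X. Blinfun ((*\<^sub>C) c) o\<^sub>L X)"
    by (intro ext blinfun_eqI)
      (simp add: bounded_linear_Blinfun_apply[OF scaleC.bounded_linear_right])
  then show ?thesis by (simp add: bounded_linear_compose_left)
qed

lemma scaleC_blinfun_compose:
  fixes A :: "'b::chilbert_space \<Rightarrow>\<^sub>L 'c::chilbert_space" and B :: "'a::real_normed_vector \<Rightarrow>\<^sub>L 'b"
  shows "(c *\<^sub>C A) o\<^sub>L B = c *\<^sub>C (A o\<^sub>L B)" "A \<in> bop \<Longrightarrow> A o\<^sub>L (c *\<^sub>C B) = c *\<^sub>C (A o\<^sub>L B)"
  by (auto intro!: blinfun_eqI simp: bop_scaleC)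

lemma blinfun_compose_assoc: "(A o\<^sub>L B) o\<^sub>L C = A o\<^sub>L (B o\<^sub>L C)"
  by (rule blinfun_eqI) simp

lemma subspace_bop: "subspace bop"
  unfolding subspace_def by (simp add: bop_add bop_scaleR)

section \<open>The standard shifts\<close>

locale polyball_shifts =
  fixes k :: nat and n :: "nat \<Rightarrow> nat" and lam :: "nat \<Rightarrow> nat \<Rightarrow> nat \<Rightarrow> nat \<Rightarrow> complex"
  assumes k_pos: "k \<ge> 1"
    and n_pos: "i \<in> {1..k} \<Longrightarrow> n i \<ge> 1"
    and lam_unit: "i \<in> {1..k} \<Longrightarrow> j \<in> {1..k} \<Longrightarrow> i \<noteq> j \<Longrightarrow> s \<in> {1..n i} \<Longrightarrow> t \<in> {1..n j} \<Longrightarrow>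
      cmod (lam i j s t) = 1"
    and lam_cnj: "i \<in> {1..k} \<Longrightarrow> j \<in> {1..k} \<Longrightarrow> i \<noteq> j \<Longrightarrow> s \<in> {1..n i} \<Longrightarrow> t \<in> {1..n j} \<Longrightarrow>
      lam j i t s = cnj (lam i j s t)"
begin

abbreviation "W \<equiv> words k n"
abbreviation "S \<equiv> std_shift k n lam"
abbreviation "P \<equiv> fock_id k n"

definition index :: "nat \<Rightarrow> nat \<Rightarrow> bool"
  where "index i s \<longleftrightarrow> i \<in> {1..k} \<and> s \<in> {1..n i}"

definition coef :: "nat \<Rightarrow> nat \<Rightarrow> word_tuple \<Rightarrow> complex"
  where "coef i s \<gamma> = (\<Prod>j=1..<i. lam_word lam i j s (\<gamma> j))"

text \<open>Seen on coordinates, the shift fills exactly these positions, reading each from the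
  tuple whose i-th word has lost its leading s.\<close>

definition shift_dom :: "nat \<Rightarrow> nat \<Rightarrow> word_tuple set"
  where "shift_dom i s = {\<gamma> \<in> W. \<exists>w. \<gamma> i = s # w}"

lemma cons_in_words: "index i s \<Longrightarrow> \<gamma>(i := s # w) \<in> W \<longleftrightarrow> \<gamma>(i := w) \<in> W"
  by (auto simp: words_def index_def)

lemma cons_in_words': "index i s \<Longrightarrow> \<gamma>(i := s # \<gamma> i) \<in> W \<longleftrightarrow> \<gamma> \<in> W"
  using cons_in_words[of i s \<gamma> "\<gamma> i"] by simp

lemma tl_in_words:
  assumes "\<gamma> \<in> W" "\<gamma> i = s # w" shows "\<gamma>(i := w) \<in> W"
proof -
  have \<gamma>: "\<And>j. j \<in> {1..k} \<Longrightarrow> set (\<gamma> j) \<subseteq> {1..n j}" "\<And>j. j \<notin> {1..k} \<Longrightarrow> \<gamma> j = []"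
    using assms(1) by (simp_all add: words_def)
  have "set ((\<gamma>(i := w)) j) \<subseteq> {1..n j}" if "j \<in> {1..k}" for j
    using \<gamma>(1)[OF that] assms(2) by (cases "j = i") simp_all
  moreover have "(\<gamma>(i := w)) j = []" if "j \<notin> {1..k}" for j
    using \<gamma>(2)[OF that] assms(2) by (cases "j = i") simp_all
  ultimately show ?thesis unfolding words_def by blast
qed

lemma cmod_lam_word:
  assumes "index i s" "j \<in> {1..<i}" "\<gamma> \<in> W"
  shows "cmod (lam_word lam i j s (\<gamma> j)) = 1"
proof -
  have j: "j \<in> {1..k}" "i \<noteq> j" "i \<in> {1..k}" "s \<in> {1..n i}" using assms by (auto simp: index_def)
  have unit: "cmod (lam i j s t) = 1" if "t \<in> {1..n j}" for t
    using that j by (intro lam_unit)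
  have "set (\<gamma> j) \<subseteq> {1..n j}" using assms(3) j by (auto simp: words_def)
  then have "cmod (prod_list (map (lam i j s) w)) = 1" if "set w \<subseteq> set (\<gamma> j)" for w
    using that by (induction w) (auto simp: norm_mult unit subset_iff)
  then show ?thesis by (simp add: lam_word_def)
qed

lemma cmod_coef: "index i s \<Longrightarrow> \<gamma> \<in> W \<Longrightarrow> cmod (coef i s \<gamma>) = 1"
  unfolding coef_def prod_norm[symmetric] by (rule prod.neutral) (use cmod_lam_word in blast)

lemma coef_upd_ge: "i \<le> j \<Longrightarrow> coef i s (\<gamma>(j := w)) = coef i s \<gamma>"
  unfolding coef_def by (rule prod.cong) auto

text \<open>One more letter in row i adds one factor to the weight of a later row j. This factor is
  the phase in the commutation relation between shifts and adjoints.\<close>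

lemma coef_cons:
  assumes "1 \<le> i" "i < j"
  shows "coef j t (\<gamma>(i := s # w)) = lam j i t s * coef j t (\<gamma>(i := w))"
proof -
  have fin: "finite {1..<j}" "i \<in> {1..<j}" using assms by auto
  have "(\<Prod>l\<in>{1..<j} - {i}. lam_word lam j l t ((\<gamma>(i := s # w)) l))
      = (\<Prod>l\<in>{1..<j} - {i}. lam_word lam j l t ((\<gamma>(i := w)) l))"
    by (rule prod.cong) auto
  then show ?thesis
    unfolding coef_def prod.remove[OF fin] by (simp add: lam_word_def)
qed

lemma shift_ok: "index i s \<Longrightarrow> wcomp_ok (shift_dom i s) (coef i s) (\<lambda>\<gamma>. \<gamma>(i := tl (\<gamma> i)))"
  unfolding wcomp_ok_def
proof
  assume i: "index i s"
  show "inj_on (\<lambda>\<gamma>. \<gamma>(i := tl (\<gamma> i))) (shift_dom i s)"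
    by (rule inj_on_inverseI[where g = "\<lambda>\<gamma>. \<gamma>(i := s # \<gamma> i)"])
      (auto simp: shift_dom_def fun_upd_idem)
  show "\<forall>\<gamma>\<in>shift_dom i s. cmod (coef i s \<gamma>) \<le> 1"
    using cmod_coef[OF i] by (simp add: shift_dom_def)
qed

lemma shift_adj_ok: "index i s \<Longrightarrow> wcomp_ok W (\<lambda>\<gamma>. cnj (coef i s \<gamma>)) (\<lambda>\<gamma>. \<gamma>(i := s # \<gamma> i))"
  by (rule wcomp_ok_converse[OF shift_ok, of i s])
    (auto simp: shift_dom_def coef_upd_ge cons_in_words' fun_upd_idem tl_in_words)

lemma fock_ok: "wcomp_ok W (\<lambda>_. 1) id"
  by (simp add: wcomp_ok_def)

lemma fock_id_eq: "P = wcomp W (\<lambda>_. 1) id"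
  unfolding fock_id_def
proof (rule the_equality)
  have val: "wcomp W (\<lambda>_. 1) id (chi \<alpha>) = (if \<alpha> \<in> W then chi \<alpha> else 0)" for \<alpha>
    by (rule ell2_eqI) (auto simp: wcomp_coord[OF fock_ok] chi.rep_eq zero_ell2.rep_eq)
  show *: "wcomp W (\<lambda>_. 1) id \<in> (bop :: fock_op set) \<and>
      (\<forall>\<alpha>. wcomp W (\<lambda>_. 1) id (chi \<alpha>) = (if \<alpha> \<in> W then chi \<alpha> else 0))"
    using wcomp_bop[OF fock_ok] val by blast
  fix V :: fock_op
  assume V: "V \<in> bop \<and> (\<forall>\<alpha>. V (chi \<alpha>) = (if \<alpha> \<in> W then chi \<alpha> else 0))"
  show "V = wcomp W (\<lambda>_. 1) id"
    by (rule ell2_bop_eqI[OF conjunct1[OF V] conjunct1[OF *]])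
      (simp only: conjunct2[OF V, rule_format] conjunct2[OF *, rule_format])
qed

text \<open>Prepending s and removing the leading letter are inverse bijections between
  \<open>W\<close> and \<open>shift_dom i s\<close>. The prescription on basis vectors thus becomes
  a formula on coordinates, and the definite description in \<open>std_shift\<close> is
  resolved.\<close>

lemma shift_eq:
  assumes i: "index i s"
  shows "S i s = wcomp (shift_dom i s) (coef i s) (\<lambda>\<gamma>. \<gamma>(i := tl (\<gamma> i)))"
  unfolding std_shift_def coef_def[symmetric]
proof (rule the_equality)
  let ?V = "wcomp (shift_dom i s) (coef i s) (\<lambda>\<gamma>. \<gamma>(i := tl (\<gamma> i))) :: fock_op"
  have val: "?V (chi \<alpha>) = (if \<alpha> \<in> W then coef i s \<alpha> *\<^sub>C chi (\<alpha>(i := s # \<alpha> i)) else 0)" for \<alpha>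
  proof (rule ell2_eqI)
    fix \<gamma>
    have iff: "\<gamma> \<in> shift_dom i s \<and> \<gamma>(i := tl (\<gamma> i)) = \<alpha> \<longleftrightarrow> \<alpha> \<in> W \<and> \<gamma> = \<alpha>(i := s # \<alpha> i)"
      using cons_in_words'[OF i, of \<alpha>] tl_in_words[of \<gamma> i s]
      by (auto simp: shift_dom_def fun_upd_idem)
    have "ell2_coord (?V (chi \<alpha>)) \<gamma>
        = (if \<gamma> \<in> shift_dom i s \<and> \<gamma>(i := tl (\<gamma> i)) = \<alpha> then coef i s \<gamma> else 0)"
      by (simp add: wcomp_coord[OF shift_ok[OF i]] chi.rep_eq scaleC_complex_def)
    also have "\<dots> = (if \<alpha> \<in> W \<and> \<gamma> = \<alpha>(i := s # \<alpha> i) then coef i s \<alpha> else 0)"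
      unfolding iff by (auto simp: coef_upd_ge)
    also have "\<dots> = ell2_coord (if \<alpha> \<in> W then coef i s \<alpha> *\<^sub>C chi (\<alpha>(i := s # \<alpha> i)) else 0) \<gamma>"
      by (simp add: ell2_coord_simps scaleC_complex_def)
    finally show "ell2_coord (?V (chi \<alpha>)) \<gamma>
        = ell2_coord (if \<alpha> \<in> W then coef i s \<alpha> *\<^sub>C chi (\<alpha>(i := s # \<alpha> i)) else 0) \<gamma>" .
  qed
  show *: "?V \<in> bop \<and> (\<forall>\<alpha>. ?V (chi \<alpha>) = (if \<alpha> \<in> W then coef i s \<alpha> *\<^sub>C chi (\<alpha>(i := s # \<alpha> i)) else 0))"
    using wcomp_bop[OF shift_ok[OF i]] val by blast
  fix V :: fock_op
  assume V: "V \<in> bop \<and> (\<forall>\<alpha>. V (chi \<alpha>) = (if \<alpha> \<in> W then coef i s \<alpha> *\<^sub>C chi (\<alpha>(i := s # \<alpha> i)) else 0))"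
  show "V = ?V"
    by (rule ell2_bop_eqI[OF conjunct1[OF V] conjunct1[OF *]])
      (simp only: conjunct2[OF V, rule_format] conjunct2[OF *, rule_format])
qed

lemma adj_shift:
  assumes i: "index i s"
  shows "adj (wcomp (shift_dom i s) (coef i s) (\<lambda>\<gamma>. \<gamma>(i := tl (\<gamma> i))))
    = wcomp W (\<lambda>\<gamma>. cnj (coef i s \<gamma>)) (\<lambda>\<gamma>. \<gamma>(i := s # \<gamma> i))"
  by (rule adj_wcomp[OF shift_ok[OF i]])
    (auto simp: shift_dom_def coef_upd_ge cons_in_words'[OF i] fun_upd_idem tl_in_words)

lemma shift_bop: "index i s \<Longrightarrow> S i s \<in> bop"
  unfolding shift_eq by (rule wcomp_bop[OF shift_ok])

lemma fock_id_bop: "P \<in> bop"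
  unfolding fock_id_eq by (rule wcomp_bop[OF fock_ok])

lemma adj_fock_id: "adj P = P"
  unfolding fock_id_eq by (rule adj_wcomp[OF fock_ok]) auto

lemma fock_id_coord: "ell2_coord (P x) \<gamma> = (if \<gamma> \<in> W then ell2_coord x \<gamma> else 0)"
  by (simp add: fock_id_eq wcomp_coord[OF fock_ok])

lemma shift_coord:
  "index i s \<Longrightarrow> ell2_coord (S i s x) \<gamma>
    = (if \<gamma> \<in> shift_dom i s then coef i s \<gamma> *\<^sub>C ell2_coord x (\<gamma>(i := tl (\<gamma> i))) else 0)"
  by (simp add: shift_eq wcomp_coord[OF shift_ok])

lemma adj_shift_coord:
  "index i s \<Longrightarrow> ell2_coord (adj (S i s) x) \<gamma>
    = (if \<gamma> \<in> W then cnj (coef i s \<gamma>) *\<^sub>C ell2_coord x (\<gamma>(i := s # \<gamma> i)) else 0)"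
  by (simp add: shift_eq adj_shift wcomp_coord[OF shift_adj_ok])

lemma fock_id_idem: "P o\<^sub>L P = P"
  by (intro blinfun_eqI, rule ell2_eqI) (simp add: fock_id_coord)

lemma fock_id_shift: "index i s \<Longrightarrow> P o\<^sub>L S i s = S i s"
  by (intro blinfun_eqI, rule ell2_eqI) (simp add: fock_id_coord shift_coord shift_dom_def)

lemma shift_fock_id: "index i s \<Longrightarrow> S i s o\<^sub>L P = S i s"
  by (intro blinfun_eqI, rule ell2_eqI)
    (auto simp: fock_id_coord shift_coord shift_dom_def scaleC.zero_right tl_in_words)

section \<open>Commutation relations between shifts and adjoint shifts\<close>

lemma cnj_mult_unit: "cmod c = 1 \<Longrightarrow> cnj c * c = 1"
  using complex_norm_square[of c] by (simp add: mult.commute)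

lemma adj_shift_shift_same:
  assumes "index i s" "index i t"
  shows "adj (S i s) o\<^sub>L S i t = (if s = t then P else 0)"
proof (intro blinfun_eqI, rule ell2_eqI)
  fix x \<gamma>
  show "ell2_coord ((adj (S i s) o\<^sub>L S i t) x) \<gamma> = ell2_coord ((if s = t then P else 0) x) \<gamma>"
    using cons_in_words'[OF assms(1), of \<gamma>]
    by (auto simp: adj_shift_coord shift_coord assms fock_id_coord shift_dom_def coef_upd_ge scaleC_scaleC
        cnj_mult_unit cmod_coef zero_ell2.rep_eq scaleC.zero_right)
qed

text \<open>The letter s in row i changes the weight of the later row j by one factor, whereas the
  weight of row i does not see row j. Only a single phase is left over.\<close>

lemma adj_shift_shift_less:
  assumes i: "index i s" and j: "index j t" and ij: "i < j"
  shows "adj (S i s) o\<^sub>L S j t = lam j i t s *\<^sub>C (S j t o\<^sub>L adj (S i s))"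
proof (intro blinfun_eqI, rule ell2_eqI)
  fix x \<gamma>
  have d: "\<gamma>(i := s # \<gamma> i) \<in> shift_dom j t \<longleftrightarrow> \<gamma> \<in> shift_dom j t"
    using cons_in_words'[OF i, of \<gamma>] ij by (simp add: shift_dom_def)
  have w: "\<gamma>(j := tl (\<gamma> j)) \<in> W" if "\<gamma> \<in> shift_dom j t"
    using that tl_in_words by (auto simp: shift_dom_def)
  have W: "\<gamma> \<in> W" if "\<gamma> \<in> shift_dom j t" using that by (simp add: shift_dom_def)
  have c: "coef j t (\<gamma>(i := s # \<gamma> i)) = lam j i t s * coef j t \<gamma>"
    using coef_cons[of i j t \<gamma> s "\<gamma> i"] ij i by (simp add: index_def)
  have tw: "\<gamma>(i := s # \<gamma> i, j := tl (\<gamma> j)) = \<gamma>(j := tl (\<gamma> j), i := s # \<gamma> i)"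
    using ij by (simp add: fun_upd_twist)
  show "ell2_coord ((adj (S i s) o\<^sub>L S j t) x) \<gamma> = ell2_coord ((lam j i t s *\<^sub>C (S j t o\<^sub>L adj (S i s))) x) \<gamma>"
    using ij
    by (auto simp: adj_shift_coord shift_coord i j d w W c tw coef_upd_ge scaleC_ell2.rep_eq
        scaleC_complex_def)
qed

text \<open>For j < i the adjoint of the relation with the indices exchanged has the right shape,
  and \<open>lam_cnj\<close> identifies its phase.\<close>

lemma adj_shift_shift_neq:
  assumes i: "index i s" and j: "index j t" and ij: "i \<noteq> j"
  shows "adj (S i s) o\<^sub>L S j t = lam j i t s *\<^sub>C (S j t o\<^sub>L adj (S i s))"
proof (cases "i < j")
  case False
  then have "j < i" using ij by simp
  from arg_cong[OF adj_shift_shift_less[OF j i this], of adj]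
  have "adj (S i s) o\<^sub>L S j t = cnj (lam i j s t) *\<^sub>C (S j t o\<^sub>L adj (S i s))"
    by (simp add: adj_compose adj_scaleC bop_compose shift_bop i j)
  moreover have "lam j i t s = cnj (lam i j s t)"
    using i j ij by (intro lam_cnj) (auto simp: index_def)
  ultimately show ?thesis by (simp only:)
qed (rule adj_shift_shift_less[OF i j])

section \<open>The algebras generated by the shifts\<close>

text \<open>Words in the shifts, with the Fock projection in the role of the empty word because it
  represents the identity.\<close>

inductive_set monomials :: "fock_op set" where
  fock_id_mono: "P \<in> monomials"
| shift_mono: "index i s \<Longrightarrow> V \<in> monomials \<Longrightarrow> S i s o\<^sub>L V \<in> monomials"

lemma monomials_bop: "V \<in> monomials \<Longrightarrow> V \<in> bop"
  by (induction rule: monomials.induct) (auto intro: fock_id_bop bop_compose shift_bop)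

lemma fock_id_monomial: "V \<in> monomials \<Longrightarrow> P o\<^sub>L V = V"
  by (induction rule: monomials.induct)
    (auto simp: fock_id_idem blinfun_compose_assoc[symmetric] fock_id_shift)

lemma monomial_fock_id: "V \<in> monomials \<Longrightarrow> V o\<^sub>L P = V"
  by (induction rule: monomials.induct) (auto simp: fock_id_idem blinfun_compose_assoc)

lemma monomial_shift: "V \<in> monomials \<Longrightarrow> index i s \<Longrightarrow> V o\<^sub>L S i s \<in> monomials"
proof (induction rule: monomials.induct)
  case fock_id_mono
  then show ?case
    using monomials.shift_mono[OF _ monomials.fock_id_mono] by (metis fock_id_shift shift_fock_id)
next
  case (shift_mono j t V)
  then show ?case by (simp add: blinfun_compose_assoc monomials.shift_mono)
qed

text \<open>Wick-ordered products: shifts on the left, adjoint shifts on the right.\<close>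

definition wick :: "fock_op set"
  where "wick = {c *\<^sub>C (V o\<^sub>L adj U) | c U V. U \<in> monomials \<and> V \<in> monomials}"

lemma wickI: "U \<in> monomials \<Longrightarrow> V \<in> monomials \<Longrightarrow> V o\<^sub>L adj U \<in> wick"
  unfolding wick_def by (intro CollectI exI[of _ 1] exI[of _ U] exI[of _ V] conjI) (auto intro: blinfun_eqI)

lemma wick_bop: "wick \<subseteq> bop"
  by (auto simp: wick_def bop_scale bop_compose monomials_bop)

lemma cspan_wick_bop: "cspan wick \<subseteq> bop"
  by (rule cspan_minimal[OF wick_bop subspace_bop closed_bop])

lemma cspan_wick_scaleC:
  assumes "X \<in> cspan wick" shows "c *\<^sub>C X \<in> cspan wick"
proof (rule bounded_linear_cspan[OF bounded_linear_scaleC_blinfun _ assms])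
  fix X assume "X \<in> wick"
  then obtain d U V where "X = d *\<^sub>C (V o\<^sub>L adj U)" "U \<in> monomials" "V \<in> monomials"
    by (auto simp: wick_def)
  moreover have "c *\<^sub>C d *\<^sub>C (V o\<^sub>L adj U) = (c * d) *\<^sub>C (V o\<^sub>L adj U)"
    by (rule blinfun_eqI) (simp add: scaleC_scaleC)
  ultimately have "c *\<^sub>C X \<in> wick" by (auto simp: wick_def)
  then show "c *\<^sub>C X \<in> cspan wick" by (rule cspan_superset)
qed

lemma cspan_wick_left:
  assumes A: "A \<in> bop"
    and *: "\<And>U V. U \<in> monomials \<Longrightarrow> V \<in> monomials \<Longrightarrow> A o\<^sub>L (V o\<^sub>L adj U) \<in> cspan wick"
    and X: "X \<in> cspan wick"
  shows "A o\<^sub>L X \<in> cspan wick"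
proof (rule bounded_linear_cspan[OF bounded_linear_compose_left _ X])
  fix X assume "X \<in> wick"
  then obtain d U V where "X = d *\<^sub>C (V o\<^sub>L adj U)" "U \<in> monomials" "V \<in> monomials"
    by (auto simp: wick_def)
  then show "A o\<^sub>L X \<in> cspan wick"
    by (simp add: scaleC_blinfun_compose(2)[OF A] cspan_wick_scaleC *)
qed

lemma cspan_wick_shift:
  "index i s \<Longrightarrow> X \<in> cspan wick \<Longrightarrow> S i s o\<^sub>L X \<in> cspan wick"
  by (rule cspan_wick_left)
    (auto simp: blinfun_compose_assoc[symmetric] intro!: shift_bop cspan_superset wickI shift_mono)

text \<open>The adjoint shift travels to the right through V. At a letter of its own row it cancels
  or gives 0, at a letter of another row it passes with a phase, and if it survives all of V it is
  absorbed into U.\<close>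

lemma adj_shift_wick:
  assumes i: "index i s" and U: "U \<in> monomials" and "V \<in> monomials"
  shows "adj (S i s) o\<^sub>L (V o\<^sub>L adj U) \<in> cspan wick"
  using \<open>V \<in> monomials\<close>
proof (induction rule: monomials.induct)
  case fock_id_mono
  have "adj (S i s) o\<^sub>L P = adj (S i s)"
    using arg_cong[OF fock_id_shift[OF i], of adj] by (simp add: adj_compose adj_fock_id fock_id_bop shift_bop i)
  then have "adj (S i s) o\<^sub>L (P o\<^sub>L adj U) = adj (U o\<^sub>L S i s)"
    by (simp add: blinfun_compose_assoc[symmetric] adj_compose monomials_bop[OF U] shift_bop i)
  also have "\<dots> = P o\<^sub>L adj (U o\<^sub>L S i s)"
    using arg_cong[OF monomial_fock_id[OF monomial_shift[OF U i]], of adj]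
    by (simp add: adj_compose adj_fock_id fock_id_bop bop_compose monomials_bop[OF U] shift_bop i)
  finally show ?case
    by (simp add: cspan_superset wickI monomial_shift U i monomials.fock_id_mono)
next
  case (shift_mono j t V)
  have eq: "adj (S i s) o\<^sub>L ((S j t o\<^sub>L V) o\<^sub>L adj U) = (adj (S i s) o\<^sub>L S j t) o\<^sub>L (V o\<^sub>L adj U)"
    by (simp add: blinfun_compose_assoc)
  show ?case
  proof (cases "i = j")
    case True
    have "P o\<^sub>L (V o\<^sub>L adj U) = V o\<^sub>L adj U"
      by (simp add: blinfun_compose_assoc[symmetric] fock_id_monomial shift_mono)
    moreover have "adj (S i s) o\<^sub>L S j t = (if s = t then P else 0)"
      using adj_shift_shift_same[OF i, of t] shift_mono True by simp
    ultimately have "adj (S i s) o\<^sub>L ((S j t o\<^sub>L V) o\<^sub>L adj U) = (if s = t then V o\<^sub>L adj U else 0)"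
      unfolding eq by simp
    then show ?thesis
      using cspan_superset[OF wickI[OF U \<open>V \<in> monomials\<close>]] subspace_0[OF subspace_cspan[of wick]] by simp
  next
    case False
    have "adj (S i s) o\<^sub>L ((S j t o\<^sub>L V) o\<^sub>L adj U)
        = lam j i t s *\<^sub>C (S j t o\<^sub>L (adj (S i s) o\<^sub>L (V o\<^sub>L adj U)))"
      unfolding eq adj_shift_shift_neq[OF i \<open>index j t\<close> False]
      by (simp add: scaleC_blinfun_compose(1) blinfun_compose_assoc)
    then show ?thesis
      using shift_mono by (simp add: cspan_wick_scaleC cspan_wick_shift)
  qed
qed

lemma cspan_wick_adj_shift:
  "index i s \<Longrightarrow> X \<in> cspan wick \<Longrightarrow> adj (S i s) o\<^sub>L X \<in> cspan wick"
  by (rule cspan_wick_left) (auto intro: adj_in_bop shift_bop adj_shift_wick)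

lemma cspan_wick_fock_id: "X \<in> cspan wick \<Longrightarrow> P o\<^sub>L X \<in> cspan wick"
  by (rule cspan_wick_left)
    (auto simp: fock_id_bop blinfun_compose_assoc[symmetric] fock_id_monomial intro: cspan_superset wickI)

lemma cspan_wick_monomial:
  assumes "V \<in> monomials" "X \<in> cspan wick" shows "V o\<^sub>L X \<in> cspan wick"
  using assms
  by (induction rule: monomials.induct) (auto simp: cspan_wick_fock_id blinfun_compose_assoc cspan_wick_shift)

lemma cspan_wick_adj_monomial:
  assumes "V \<in> monomials" "X \<in> cspan wick" shows "adj V o\<^sub>L X \<in> cspan wick"
  using assms
  by (induction arbitrary: X rule: monomials.induct)
    (auto simp: adj_fock_id cspan_wick_fock_id adj_compose shift_bop monomials_bop blinfun_compose_assoc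
      cspan_wick_adj_shift)

lemma cspan_wick_compose:
  assumes X: "X \<in> cspan wick" and Y: "Y \<in> cspan wick"
  shows "X o\<^sub>L Y \<in> cspan wick"
proof (rule bounded_linear_cspan[OF bounded_linear_compose_right _ X])
  fix X assume "X \<in> wick"
  then obtain d U V where "X = d *\<^sub>C (V o\<^sub>L adj U)" "U \<in> monomials" "V \<in> monomials"
    by (auto simp: wick_def)
  then show "X o\<^sub>L Y \<in> cspan wick"
    by (simp add: scaleC_blinfun_compose(1) blinfun_compose_assoc cspan_wick_scaleC
        cspan_wick_monomial cspan_wick_adj_monomial Y)
qed

lemma cspan_wick_adj:
  assumes X: "X \<in> cspan wick" shows "adj X \<in> cspan wick"
proof -
  \<comment> \<open>Membership in \<open>bop\<close> is included because additivity and continuity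
    of \<open>adj\<close> are available there.\<close>
  let ?Y = "{X. X \<in> bop \<and> adj X \<in> cspan wick}"
  have "cspan wick \<subseteq> ?Y"
  proof (rule cspan_minimal)
    show "wick \<subseteq> ?Y"
    proof
      fix X assume "X \<in> wick"
      then obtain d U V where X: "X = d *\<^sub>C (V o\<^sub>L adj U)" and UV: "U \<in> monomials" "V \<in> monomials"
        by (auto simp: wick_def)
      then have "adj X = cnj d *\<^sub>C (U o\<^sub>L adj V)"
        by (simp add: adj_scaleC adj_compose bop_compose monomials_bop)
      then show "X \<in> ?Y"
        using wick_bop \<open>X \<in> wick\<close> UV by (auto intro: cspan_wick_scaleC cspan_superset wickI)
    qed
    show "subspace ?Y"
      unfolding subspace_def
      by (auto simp: bop_add bop_scaleR adj_add adj_scaleR subspace_0[OF subspace_cspan]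
          intro: subspace_add[OF subspace_cspan] subspace_scale[OF subspace_cspan])
    show "closed ?Y"
      unfolding closed_sequential_limits
    proof (intro allI impI)
      fix X l assume "(\<forall>i::nat. X i \<in> ?Y) \<and> X \<longlonglongrightarrow> l"
      then have X: "\<And>i. X i \<in> bop" "\<And>i. adj (X i) \<in> cspan wick" "X \<longlonglongrightarrow> l" by auto
      have l: "l \<in> bop" by (rule closed_sequentially[OF closed_bop X(1,3)])
      have "adj l \<in> cspan wick"
        by (rule closed_sequentially[OF closed_closure X(2) tendsto_adj[OF X(3) _ l]]) (simp add: X(1))
      with l show "l \<in> ?Y" by simp
    qed
  qed
  then show ?thesis using X by blast
qed

section \<open>Comparison with the generated algebras\<close>

lemma std_shifts_eq: "std_shifts k n lam = {S i s | i s. index i s}"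
  by (auto simp: std_shifts_def index_def)

lemma closed_subalgebra_cspan_wick: "closed_subalgebra (cspan wick)"
  unfolding closed_subalgebra_def
  using cspan_wick_bop subspace_0[OF subspace_cspan] subspace_add[OF subspace_cspan]
  by (auto intro: cspan_wick_compose cspan_wick_scaleC)

lemma shift_in_wick: "index i s \<Longrightarrow> S i s \<in> wick"
  using wickI[OF fock_id_mono shift_mono[OF _ fock_id_mono]]
  by (metis adj_fock_id blinfun_compose_assoc fock_id_idem shift_fock_id)

text \<open>The closed Wick span is itself a C*-algebra containing the shifts, so anything proved on
  it holds on the generated one.\<close>

lemma shift_cstar_subset: "shift_cstar_algebra k n lam \<subseteq> cspan wick"
  unfolding shift_cstar_algebra_def generated_cstar_algebra_def std_shifts_eq
  using closed_subalgebra_cspan_wick cspan_wick_adj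
  by (intro Inter_lower) (auto intro: cspan_superset shift_in_wick)

lemma shift_cstar_closed:
  "std_shifts k n lam \<subseteq> shift_cstar_algebra k n lam" (is ?sub)
  "closed_subalgebra (shift_cstar_algebra k n lam)" (is ?alg)
  "A \<in> shift_cstar_algebra k n lam \<Longrightarrow> adj A \<in> shift_cstar_algebra k n lam"
proof -
  define \<F> where "\<F> = {\<A>. std_shifts k n lam \<subseteq> \<A> \<and> closed_subalgebra \<A> \<and> (\<forall>A\<in>\<A>. adj A \<in> \<A>)}"
  have eq: "shift_cstar_algebra k n lam = \<Inter>\<F>"
    by (simp add: shift_cstar_algebra_def generated_cstar_algebra_def \<F>_def)
  have sub: "shift_cstar_algebra k n lam \<subseteq> bop" using shift_cstar_subset cspan_wick_bop by blast
  show ?sub unfolding eq \<F>_def by blast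
  show ?alg
    unfolding closed_subalgebra_def
    using sub by (auto simp: eq \<F>_def closed_subalgebra_def intro!: closed_Inter)
  show "A \<in> shift_cstar_algebra k n lam \<Longrightarrow> adj A \<in> shift_cstar_algebra k n lam"
    unfolding eq \<F>_def by blast
qed

text \<open>The identity is not among the generators of the C*-algebra, but one shift composed with
  its adjoint yields it. A shift exists because k and n 1 are at least 1. This places the polyball
  algebra inside the C*-algebra.\<close>

lemma fock_id_in_cstar: "P \<in> shift_cstar_algebra k n lam"
proof -
  have i: "index 1 1" using k_pos n_pos[of 1] by (simp add: index_def)
  then have "S 1 1 \<in> shift_cstar_algebra k n lam"
    using shift_cstar_closed(1) by (auto simp: std_shifts_eq)
  then have "adj (S 1 1) o\<^sub>L S 1 1 \<in> shift_cstar_algebra k n lam"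
    using shift_cstar_closed(2,3) by (auto simp: closed_subalgebra_def)
  moreover have "adj (S 1 1) o\<^sub>L S 1 1 = P" using adj_shift_shift_same[OF i i] by (simp only: refl if_True)
  ultimately show ?thesis by (simp only:)
qed

lemma polyball_algebra_minimal:
  assumes "closed_subalgebra \<A>" "P \<in> \<A>" "\<And>i s. index i s \<Longrightarrow> S i s \<in> \<A>"
  shows "polyball_algebra k n lam \<subseteq> \<A>"
  unfolding polyball_algebra_def generated_algebra_def
  using assms by (intro Inter_lower) (auto simp: std_shifts_eq)

lemma polyball_algebra_subset: "polyball_algebra k n lam \<subseteq> shift_cstar_algebra k n lam"
  using shift_cstar_closed(1,2) fock_id_in_cstar
  by (intro polyball_algebra_minimal) (auto simp: std_shifts_eq)

lemma polyball_algebra_compose: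
  "f \<in> polyball_algebra k n lam \<Longrightarrow> g \<in> polyball_algebra k n lam \<Longrightarrow> f o\<^sub>L g \<in> polyball_algebra k n lam"
  unfolding polyball_algebra_def generated_algebra_def closed_subalgebra_def by blast

end

section \<open>Row operators and defects\<close>

text \<open>For nonnegative terms an iterated sum already yields summability over the pairs.\<close>

lemma has_sum_Sigma_nonneg:
  fixes f :: "'a \<times> 'b \<Rightarrow> real"
  assumes "\<And>x. x \<in> A \<Longrightarrow> ((\<lambda>y. f (x, y)) has_sum g x) (B x)" "(g has_sum S) A"
    and "\<And>x y. x \<in> A \<Longrightarrow> y \<in> B x \<Longrightarrow> 0 \<le> f (x, y)"
  shows "(f has_sum S) (Sigma A B)"
proof (rule has_sum_SigmaI[OF assms(1,2)])
  show "f summable_on Sigma A B"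
    by (rule summable_on_SigmaI[OF assms(1) has_sum_imp_summable[OF assms(2)] assms(3)])
qed

lemma word_op_Cons [simp]: "word_op R (s # w) = R s o\<^sub>L word_op R w"
  and word_op_Nil [simp]: "word_op R [] = id_blinfun"
  by (simp_all add: word_op_def)

lemma word_op_bop: "(\<And>s. s \<in> set w \<Longrightarrow> R s \<in> bop) \<Longrightarrow> word_op R w \<in> bop"
  by (induction w) (auto intro: bop_compose)

locale row =
  fixes m :: nat and R :: "nat \<Rightarrow> ('h::chilbert_space \<Rightarrow>\<^sub>L 'h)"
  assumes R_bop: "s \<in> {1..m} \<Longrightarrow> R s \<in> bop"
begin

lemma Phi_bop: "X \<in> bop \<Longrightarrow> Phi m R X \<in> bop"
  unfolding Phi_def by (intro bop_sum bop_compose adj_in_bop R_bop)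

lemma Phi_selfadjoint:
  assumes "selfadjoint X" shows "selfadjoint (Phi m R X)"
proof -
  have X: "X \<in> bop" "\<And>x y. cinner (X x) y = cinner x (X y)"
    using assms selfadjoint_swap by (auto simp: selfadjoint_def)
  have "adj (Phi m R X) = Phi m R X"
    by (rule adj_eqI)
      (auto simp: Phi_def blinfun.sum_left cinner.sum_left cinner.sum_right cinner_adj_left R_bop
        cinner_adj_right[symmetric] X(2) intro!: sum.cong)
  then show ?thesis by (simp add: selfadjoint_def Phi_bop X(1))
qed

lemma Phi_diff: "Phi m R (X - Y) = Phi m R X - Phi m R Y"
  unfolding Phi_def sum_subtractf[symmetric]
  by (intro sum.cong refl blinfun_eqI) (simp add: blinfun.diff_left blinfun.diff_right)

lemma qf_Phi: "qf (Phi m R X) x = (\<Sum>s=1..m. qf X (adj (R s) x))"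
  unfolding Phi_def qf_sum by (intro sum.cong refl qf_conj R_bop)

lemma adj_word_op_Cons:
  assumes "s \<in> {1..m}" "set w \<subseteq> {1..m}"
  shows "adj (word_op R (s # w)) x = adj (word_op R w) (adj (R s) x)"
proof -
  have "word_op R w \<in> bop" by (rule word_op_bop) (use assms R_bop in auto)
  then show ?thesis using assms by (simp add: adj_compose R_bop)
qed

abbreviation "wordset p \<equiv> {w. set w \<subseteq> {1..m} \<and> length w = p}"

text \<open>The p-th power of \<open>Phi\<close> sums over words of length p; the outermost
  application supplies the first letter, whose adjoint acts first on x.\<close>

lemma qf_Phi_power: "qf ((Phi m R ^^ p) X) x = (\<Sum>w\<in>wordset p. qf X (adj (word_op R w) x))"
proof (induction p arbitrary: x)
  case 0
  have "wordset 0 = {[]}" by auto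
  then show ?case by simp
next
  case (Suc p)
  have "qf ((Phi m R ^^ Suc p) X) x = (\<Sum>s=1..m. \<Sum>w\<in>wordset p. qf X (adj (word_op R w) (adj (R s) x)))"
    by (simp add: qf_Phi Suc)
  also have "\<dots> = (\<Sum>s=1..m. \<Sum>w\<in>wordset p. qf X (adj (word_op R (s # w)) x))"
    by (intro sum.cong refl) (subst adj_word_op_Cons, auto)
  also have "\<dots> = (\<Sum>(w, s)\<in>wordset p \<times> {1..m}. qf X (adj (word_op R (s # w)) x))"
    by (subst sum.swap) (rule sum.cartesian_product)
  also have "\<dots> = (\<Sum>w\<in>wordset (Suc p). qf X (adj (word_op R w) x))"
    unfolding lists_length_Suc_eq
    by (subst sum.reindex) (auto simp: inj_on_def intro!: sum.cong)
  finally show ?case .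
qed

text \<open>Termwise estimation: decay of the powers at the identity forces decay at every
  X.\<close>

lemma abs_qf_Phi_power_le: "\<bar>qf ((Phi m R ^^ p) X) x\<bar> \<le> norm X * qf ((Phi m R ^^ p) id_blinfun) x"
  unfolding qf_Phi_power sum_distrib_left qf_id
  by (rule order_trans[OF sum_abs sum_mono[OF abs_qf_le]])

text \<open>Telescoping over the word length: the sum over words shorter than \<open>p\<close> is
  \<open>qf Y x - qf (\<Phi>\<^sup>p Y) x\<close>.\<close>

lemma row_has_sum:
  assumes pure: "(\<lambda>p. qf ((Phi m R ^^ p) id_blinfun) x) \<longlonglongrightarrow> 0"
    and pos: "\<And>y. 0 \<le> qf (Y - Phi m R Y) y"
  shows "((\<lambda>w. qf (Y - Phi m R Y) (adj (word_op R w) x)) has_sum qf Y x) {w. set w \<subseteq> {1..m}}"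
proof -
  define g where "g p = qf ((Phi m R ^^ p) Y) x" for p
  define Z where "Z = Y - Phi m R Y"
  have pw: "(Phi m R ^^ p) Z = (Phi m R ^^ p) Y - (Phi m R ^^ Suc p) Y" for p
    by (induction p) (simp_all add: Z_def Phi_diff)
  have "g \<longlonglongrightarrow> 0"
  proof (rule tendsto_rabs_zero_cancel, rule tendsto_sandwich)
    show "\<forall>\<^sub>F p in sequentially. 0 \<le> \<bar>g p\<bar>" by simp
    show "\<forall>\<^sub>F p in sequentially. \<bar>g p\<bar> \<le> norm Y * qf ((Phi m R ^^ p) id_blinfun) x"
      unfolding g_def using abs_qf_Phi_power_le by simp
    show "(\<lambda>p. norm Y * qf ((Phi m R ^^ p) id_blinfun) x) \<longlonglongrightarrow> 0"
      using tendsto_mult_left[OF pure, of "norm Y"] by simp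
  qed simp
  from telescope_sums'[OF this]
  have "(\<lambda>p. g p - g (Suc p)) sums g 0" by simp
  moreover have "g p - g (Suc p) = qf ((Phi m R ^^ p) Z) x" for p
    unfolding g_def pw qf_diff ..
  moreover have nonneg: "0 \<le> qf Z y" for y using pos by (simp add: Z_def)
  \<comment> \<open>Nonnegativity of the terms turns the convergent series into an unconditional
    sum.\<close>
  ultimately have "((\<lambda>p. qf ((Phi m R ^^ p) Z) x) has_sum g 0) UNIV"
    by (intro sums_nonneg_imp_has_sum) (auto simp: qf_Phi_power intro: sum_nonneg)
  then have "((\<lambda>(p, w). qf Z (adj (word_op R w) x)) has_sum g 0) (Sigma UNIV wordset)"
  proof (rule has_sum_Sigma_nonneg[rotated])
    show "((\<lambda>w. case (p, w) of (p, w) \<Rightarrow> qf Z (adj (word_op R w) x)) has_sum qf ((Phi m R ^^ p) Z) x) (wordset p)"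
      for p by (auto simp: qf_Phi_power intro!: has_sum_finiteI finite_lists_length_eq)
  qed (auto simp: nonneg)
  \<comment> \<open>Every word occurs exactly once, paired with its own length.\<close>
  also have "?this \<longleftrightarrow> ((\<lambda>w. qf Z (adj (word_op R w) x)) has_sum g 0) {w. set w \<subseteq> {1..m}}"
    by (rule has_sum_reindex_bij_witness[where j = snd and i = "\<lambda>w. (length w, w)"]) auto
  finally show ?thesis by (simp add: Z_def g_def)
qed

text \<open>The form of Y is a sum of values of the form of Y - \<open>Phi\<close> Y, so positivity
  of the difference passes back to Y.\<close>

lemma row_nonneg:
  assumes "\<And>x. (\<lambda>p. qf ((Phi m R ^^ p) id_blinfun) x) \<longlonglongrightarrow> 0"
    and "\<And>y. 0 \<le> qf (Y - Phi m R Y) y"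
  shows "0 \<le> qf Y x"
  using row_has_sum[OF assms, of x] assms(2) by (rule has_sum_nonneg)

end

section \<open>Telescoping through all rows\<close>

lemma Delta_0: "Delta 0 n T = id_blinfun"
  and Delta_Suc: "Delta (Suc j) n T = Delta j n T - Phi (n (Suc j)) (T (Suc j)) (Delta j n T)"
  by (simp_all add: Delta_def)

text \<open>The product of adjoint words in the kernel, cut off after row j so that rows can be
  added by induction; j = k gives the expression in \<open>berezin_kernel\<close>.\<close>

definition word_adj :: "'h::chilbert_space op_tuple \<Rightarrow> word_tuple \<Rightarrow> nat \<Rightarrow> ('h \<Rightarrow>\<^sub>L 'h)"
  where "word_adj T \<beta> j = fold (\<lambda>i X. adj (word_op (T i) (\<beta> i)) o\<^sub>L X) [1..<Suc j] id_blinfun"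

lemma word_adj_0: "word_adj T \<beta> 0 = id_blinfun"
  and word_adj_Suc: "word_adj T \<beta> (Suc j) = adj (word_op (T (Suc j)) (\<beta> (Suc j))) o\<^sub>L word_adj T \<beta> j"
  by (simp_all add: word_adj_def)

lemma word_adj_upd: "j < i \<Longrightarrow> word_adj T (\<beta>(i := w)) j = word_adj T \<beta> j"
  by (induction j) (auto simp: word_adj_0 word_adj_Suc)

text \<open>\<open>Delta (Suc j)\<close> is Y - \<open>Phi\<close> Y for Y = \<open>Delta j\<close>,
  so summing over the word in row Suc j collapses it to \<open>Delta j\<close>. Repeating this
  leaves the identity at j = 0.\<close>

lemma tuple_has_sum:
  fixes T :: "'h::chilbert_space op_tuple"
  assumes row: "\<And>i. i \<in> {1..k} \<Longrightarrow> row (n i) (T i)"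
    and pure: "\<And>i x. i \<in> {1..k} \<Longrightarrow> (\<lambda>p. qf ((Phi (n i) (T i) ^^ p) id_blinfun) x) \<longlonglongrightarrow> 0"
    and pos: "\<And>x. 0 \<le> qf (Delta k n T) x"
  shows "((\<lambda>\<beta>. qf (Delta k n T) (word_adj T \<beta> k x)) has_sum (norm x)\<^sup>2) (words k n)"
proof -
  let ?D = "\<lambda>j. Delta j n T"
  have nonneg: "\<forall>x. 0 \<le> qf (?D j) x" if "j \<le> k" for j
    using that
  proof (induction rule: inc_induct)
    case base
    then show ?case using pos by simp
  next
    case (step j)
    then have "Suc j \<in> {1..k}" by simp
    from row.row_nonneg[OF row[OF this] pure[OF this], of "?D j"] step
    show ?case by (simp add: Delta_Suc)
  qed
  have "((\<lambda>\<beta>. qf (?D j) (word_adj T \<beta> j x)) has_sum (norm x)\<^sup>2) (words j n)" if "j \<le> k" for j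
    using that
  proof (induction j)
    case 0
    have "words 0 n = {\<lambda>_. []}" by (auto simp: words_def)
    then show ?case by (auto simp: Delta_0 word_adj_0 qf_id intro: has_sum_finiteI)
  next
    case (Suc j)
    let ?L = "{w. set w \<subseteq> {1..n (Suc j)}}"
    define f where "f \<beta> w = qf (?D (Suc j)) (adj (word_op (T (Suc j)) w) (word_adj T \<beta> j x))"
      for \<beta> :: word_tuple and w
    have sj: "Suc j \<in> {1..k}" using Suc.prems by simp
    have in_row: "((\<lambda>w. case (\<beta>, w) of (\<beta>, w) \<Rightarrow> f \<beta> w) has_sum qf (?D j) (word_adj T \<beta> j x)) ?L" for \<beta>
      unfolding f_def Delta_Suc prod.case
      by (rule row.row_has_sum[OF row[OF sj] pure[OF sj]])
        (use nonneg[OF Suc.prems] in \<open>simp add: Delta_Suc\<close>)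
    have "((\<lambda>(\<beta>, w). f \<beta> w) has_sum (norm x)\<^sup>2) (words j n \<times> ?L)"
      by (rule has_sum_Sigma_nonneg[OF in_row Suc.IH])
        (use Suc.prems nonneg in \<open>auto simp: f_def\<close>)
    also have "?this \<longleftrightarrow> ((\<lambda>\<beta>. qf (?D (Suc j)) (word_adj T \<beta> (Suc j) x)) has_sum (norm x)\<^sup>2) (words (Suc j) n)"
    \<comment> \<open>A tuple over the rows up to Suc j splits into its first j rows and the word in
      row Suc j.\<close>
    proof (rule has_sum_reindex_bij_witness[where
          i = "\<lambda>\<beta>. (\<beta>(Suc j := []), \<beta> (Suc j))" and j = "\<lambda>(\<beta>, w). \<beta>(Suc j := w)"])
      fix a assume "a \<in> words j n \<times> ?L"
      then show "(\<lambda>\<beta>. (\<beta>(Suc j := []), \<beta> (Suc j))) ((\<lambda>(\<beta>, w). \<beta>(Suc j := w)) a) = a"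
        by (auto simp: words_def fun_upd_idem)
      show "(\<lambda>(\<beta>, w). \<beta>(Suc j := w)) a \<in> words (Suc j) n"
      proof -
        obtain \<beta> w where a: "a = (\<beta>, w)" by (cases a)
        then have \<beta>: "\<And>i. i \<in> {1..j} \<Longrightarrow> set (\<beta> i) \<subseteq> {1..n i}" "\<And>i. i \<notin> {1..j} \<Longrightarrow> \<beta> i = []"
          and w: "set w \<subseteq> {1..n (Suc j)}"
          using \<open>a \<in> words j n \<times> ?L\<close> by (simp_all add: words_def)
        have "set ((\<beta>(Suc j := w)) i) \<subseteq> {1..n i}" if "i \<in> {1..Suc j}" for i
          using that \<beta>(1)[of i] w by (cases "i = Suc j") simp_all
        moreover have "(\<beta>(Suc j := w)) i = []" if "i \<notin> {1..Suc j}" for i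
          using that \<beta>(2)[of i] by (cases "i = Suc j") auto
        ultimately show ?thesis unfolding words_def a prod.case by blast
      qed
      show "qf (?D (Suc j)) (word_adj T ((\<lambda>(\<beta>, w). \<beta>(Suc j := w)) a) (Suc j) x) = (case a of (\<beta>, w) \<Rightarrow> f \<beta> w)"
        by (simp add: f_def word_adj_Suc word_adj_upd split: prod.split)
    next
      fix \<beta> assume "\<beta> \<in> words (Suc j) n"
      then show "(\<beta>(Suc j := []), \<beta> (Suc j)) \<in> words j n \<times> ?L"
        by (auto simp: words_def)
    qed auto
    finally show ?case .
  qed
  from this[OF order_refl] show ?thesis .
qed

section \<open>The Berezin kernel\<close>

context polyball_shifts
begin

text \<open>The common ground of scaled tuples and pure tuples. Purity appears only through
  quadratic forms, which is what the telescoping consumes.\<close>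

definition berezin_data :: "'h::chilbert_space op_tuple \<Rightarrow> bool"
  where "berezin_data T \<longleftrightarrow> (\<forall>i s. index i s \<longrightarrow> T i s \<in> bop)
    \<and> (\<forall>i j s t. index i s \<longrightarrow> index j t \<longrightarrow> i \<noteq> j \<longrightarrow> T i s o\<^sub>L T j t = lam i j s t *\<^sub>C (T j t o\<^sub>L T i s))
    \<and> positive_op (Delta k n T)
    \<and> (\<forall>i\<in>{1..k}. \<forall>x. (\<lambda>p. qf ((Phi (n i) (T i) ^^ p) id_blinfun) x) \<longlonglongrightarrow> 0)"

lemma berezin_data_row: "berezin_data T \<Longrightarrow> i \<in> {1..k} \<Longrightarrow> row (n i) (T i)"
  by unfold_locales (simp add: berezin_data_def index_def)

lemma berezin_data_bop: "berezin_data T \<Longrightarrow> index i s \<Longrightarrow> T i s \<in> bop"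
  by (simp add: berezin_data_def)

lemma words_letter: "\<beta> \<in> W \<Longrightarrow> i \<in> {1..k} \<Longrightarrow> s \<in> set (\<beta> i) \<Longrightarrow> index i s"
  unfolding words_def index_def by blast

lemma berezin_data_word_op_bop:
  "berezin_data T \<Longrightarrow> \<beta> \<in> W \<Longrightarrow> i \<in> {1..k} \<Longrightarrow> word_op (T i) (\<beta> i) \<in> bop"
  by (intro word_op_bop berezin_data_bop words_letter)

lemma op_sqrt_Delta_bop: "berezin_data T \<Longrightarrow> op_sqrt (Delta k n T) \<in> bop"
  unfolding berezin_data_def by (intro positive_op_bop op_sqrt(1)) blast

lemma berezin_data_has_sum:
  assumes "berezin_data T"
  shows "((\<lambda>\<beta>. (norm (op_sqrt (Delta k n T) (word_adj T \<beta> k x)))\<^sup>2) has_sum (norm x)\<^sup>2) W"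
proof -
  have D: "positive_op (Delta k n T)" using assms by (simp add: berezin_data_def)
  show ?thesis
    unfolding norm_op_sqrt_square[OF D]
    by (rule tuple_has_sum) (use assms D berezin_data_row in \<open>auto simp: berezin_data_def positive_op_iff\<close>)
qed

text \<open>An operator with the desired coordinates is built first; its basis expansion then shows
  that the infinite sum in the definition converges to it, which justifies the use of
  \<open>Blinfun\<close>.\<close>

lemma berezin_kernel_coord:
  assumes T: "berezin_data T"
  shows "ell2_coord (berezin_kernel k n T h) \<beta>
    = (if \<beta> \<in> W then op_sqrt (Delta k n T) (word_adj T \<beta> k h) else 0)"
proof -
  define A where "A \<beta> = (if \<beta> \<in> W then op_sqrt (Delta k n T) o\<^sub>L word_adj T \<beta> k else 0)" for \<beta>
  have bound: "L2_set (\<lambda>\<beta>. norm (A \<beta> y)) F \<le> 1 * norm y" if F: "finite F" for F y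
  proof -
    have "(\<Sum>\<beta>\<in>F. (norm (A \<beta> y))\<^sup>2)
        = (\<Sum>\<beta>\<in>F \<inter> W. (norm (op_sqrt (Delta k n T) (word_adj T \<beta> k y)))\<^sup>2)"
      using F by (intro sum.mono_neutral_cong_right) (auto simp: A_def)
    also have "\<dots> \<le> (norm y)\<^sup>2"
      by (rule finite_sum_le_has_sum[OF berezin_data_has_sum[OF T]]) (use F in auto)
    finally have "(\<Sum>\<beta>\<in>F. (norm (A \<beta> y))\<^sup>2) \<le> (norm y)\<^sup>2" .
    then show ?thesis unfolding L2_set_def by (intro real_le_lsqrt) auto
  qed
  obtain K where K: "\<And>y \<beta>. ell2_coord (blinfun_apply K y) \<beta> = A \<beta> y"
    using ell2_op_exists[of A 1, OF bound] by auto
  have "(\<Sum>\<^sub>\<infinity>\<beta>\<in>W. elem_tensor (chi \<beta>) (op_sqrt (Delta k n T) (word_adj T \<beta> k y))) = K y" for y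
  proof (rule infsumI)
    have "((\<lambda>\<beta>. elem_tensor (chi \<beta>) (A \<beta> y)) has_sum K y) UNIV"
      using has_sum_ell2_coord[of "K y"] by (simp add: K)
    then show "((\<lambda>\<beta>. elem_tensor (chi \<beta>) (op_sqrt (Delta k n T) (word_adj T \<beta> k y))) has_sum K y) W"
      by (rule has_sum_cong_neutral[THEN iffD1, rotated 3]) (auto simp: A_def elem_tensor.zero_right)
  qed
  then have "berezin_kernel k n T = K"
    unfolding berezin_kernel_def word_adj_def[symmetric] by (simp add: blinfun_apply_inverse)
  then show ?thesis by (simp add: K A_def)
qed

lemma word_adj_bop:
  assumes "berezin_data T" "\<beta> \<in> W" "j \<le> k"
  shows "word_adj T \<beta> j \<in> bop"
  using \<open>j \<le> k\<close>
proof (induction j)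
  case (Suc j)
  have "word_op (T (Suc j)) (\<beta> (Suc j)) \<in> bop"
    by (rule berezin_data_word_op_bop[OF assms(1,2)]) (use Suc.prems in simp)
  then show ?case using Suc by (simp add: word_adj_Suc bop_compose)
qed (simp add: word_adj_0)

lemma berezin_kernel_bop:
  assumes T: "berezin_data T" shows "berezin_kernel k n T \<in> bop"
proof (rule ell2_op_bop)
  fix h \<beta>
  show "ell2_coord (berezin_kernel k n T h) \<beta>
      = (if \<beta> \<in> W then op_sqrt (Delta k n T) o\<^sub>L word_adj T \<beta> k else 0) h"
    by (simp add: berezin_kernel_coord[OF T])
  show "(if \<beta> \<in> W then op_sqrt (Delta k n T) o\<^sub>L word_adj T \<beta> k else 0) \<in> bop"
    by (simp add: bop_compose word_adj_bop[OF T] op_sqrt_Delta_bop[OF T])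
qed

lemma norm_berezin_kernel:
  assumes T: "berezin_data T" shows "norm (berezin_kernel k n T h) = norm h"
proof -
  have "(norm (berezin_kernel k n T h))\<^sup>2
      = (\<Sum>\<^sub>\<infinity>\<beta>\<in>W. (norm (op_sqrt (Delta k n T) (word_adj T \<beta> k h)))\<^sup>2)"
    unfolding norm_ell2_square
    by (rule infsum_cong_neutral) (auto simp: berezin_kernel_coord[OF T])
  also have "\<dots> = (norm h)\<^sup>2" by (rule infsumI[OF berezin_data_has_sum[OF T]])
  finally show ?thesis by (simp add: power2_eq_iff_nonneg)
qed

text \<open>Isometry says that the form of the self-adjoint operator ?Z vanishes, and a positive
  operator with zero form is zero.\<close>

lemma adj_berezin_kernel_compose:
  assumes T: "berezin_data T"
  shows "adj (berezin_kernel k n T) o\<^sub>L berezin_kernel k n T = id_blinfun"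
proof -
  let ?K = "berezin_kernel k n T"
  let ?Z = "id_blinfun - (adj ?K o\<^sub>L ?K)"
  note K = berezin_kernel_bop[OF T]
  have q: "qf ?Z x = 0" for x
    by (simp add: qf_diff qf_id adj_compose_self_positive(2)[OF K] norm_berezin_kernel[OF T])
  have "selfadjoint ?Z"
    using positive_op_selfadjoint[OF adj_compose_self_positive(1)[OF K]]
    by (simp add: selfadjoint_def bop_diff adj_diff)
  then have "positive_op ?Z" by (simp add: positive_op_iff q)
  then have Z: "?Z x = 0" for x by (rule positive_op_apply_zero[OF _ q])
  have "adj ?K (?K x) = x" for x
    using Z[of x] by (simp add: blinfun.diff_left)
  then show ?thesis by (intro blinfun_eqI) simp
qed

section \<open>Moving an adjoint letter through the words of the kernel\<close>

lemma adj_commute: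
  assumes T: "berezin_data T" and i: "index i s" and j: "index j t" and ij: "i \<noteq> j"
  shows "adj (T j t) (adj (T i s) h) = cnj (lam i j s t) *\<^sub>C adj (T i s) (adj (T j t) h)"
proof -
  have "T i s o\<^sub>L T j t = lam i j s t *\<^sub>C (T j t o\<^sub>L T i s)"
    using assms unfolding berezin_data_def by blast
  from arg_cong[OF this, of adj]
  have "adj (T j t) o\<^sub>L adj (T i s) = cnj (lam i j s t) *\<^sub>C (adj (T i s) o\<^sub>L adj (T j t))"
    by (simp add: adj_compose adj_scaleC bop_compose berezin_data_bop[OF T] i j)
  from arg_cong[OF this, of "\<lambda>X. blinfun_apply X h"] show ?thesis by simp
qed

lemma adj_word_commute:
  assumes T: "berezin_data T" and i: "index i s" and j: "j \<in> {1..k}" and ij: "i \<noteq> j"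
    and w: "set w \<subseteq> {1..n j}"
  shows "adj (word_op (T j) w) (adj (T i s) h)
    = cnj (lam_word lam i j s w) *\<^sub>C adj (T i s) (adj (word_op (T j) w) h)"
  using w
proof (induction w arbitrary: h)
  case (Cons t w)
  then have jt: "index j t" and w: "set w \<subseteq> {1..n j}" using j by (auto simp: index_def)
  have Tj: "word_op (T j) w \<in> bop"
    by (rule word_op_bop) (use w j berezin_data_bop[OF T] in \<open>auto simp: index_def\<close>)
  have e: "adj (word_op (T j) (t # w)) h = adj (word_op (T j) w) (adj (T j t) h)" for h
    by (simp add: adj_compose berezin_data_bop[OF T jt] Tj)
  show ?case
    unfolding e adj_commute[OF T i jt ij] bop_scaleC[OF adj_in_bop[OF Tj]] Cons.IH[OF w]
    by (simp add: lam_word_def scaleC_scaleC)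
qed (simp add: lam_word_def)

lemma word_adj_commute:
  assumes T: "berezin_data T" and i: "index i s" and \<beta>: "\<beta> \<in> W"
  shows "j < i \<Longrightarrow> word_adj T \<beta> j (adj (T i s) h)
    = cnj (\<Prod>l=1..<Suc j. lam_word lam i l s (\<beta> l)) *\<^sub>C adj (T i s) (word_adj T \<beta> j h)"
proof (induction j)
  case (Suc j)
  then have j: "Suc j \<in> {1..k}" "i \<noteq> Suc j" using i by (auto simp: index_def)
  have w: "set (\<beta> (Suc j)) \<subseteq> {1..n (Suc j)}" using \<beta> j by (simp add: words_def)
  note b = berezin_data_word_op_bop[OF T \<beta> j(1)]
  have IH: "word_adj T \<beta> j (adj (T i s) h)
    = cnj (\<Prod>l=1..<Suc j. lam_word lam i l s (\<beta> l)) *\<^sub>C adj (T i s) (word_adj T \<beta> j h)"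
    using Suc by simp
  show ?case
    unfolding word_adj_Suc blinfun_apply_blinfun_compose IH bop_scaleC[OF adj_in_bop[OF b]]
      adj_word_commute[OF T i j w]
    by (simp add: scaleC_scaleC)
qed (simp add: word_adj_0)

text \<open>The adjoint of \<open>T i s\<close> passes the words of rows 1 to i - 1, collecting the
  conjugate of the weight \<open>coef\<close>, and then joins the word of row i as its new first
  letter. Later rows are unaffected.\<close>

lemma word_adj_cons:
  assumes T: "berezin_data T" and i: "index i s" and \<beta>: "\<beta> \<in> W" and "i \<le> j" "j \<le> k"
  shows "word_adj T \<beta> j (adj (T i s) h) = cnj (coef i s \<beta>) *\<^sub>C word_adj T (\<beta>(i := s # \<beta> i)) j h"
  using \<open>i \<le> j\<close> \<open>j \<le> k\<close>
proof (induction rule: dec_induct)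
  case base
  obtain l where l: "i = Suc l" using i by (cases i) (auto simp: index_def)
  have ik: "i \<in> {1..k}" using i by (simp add: index_def)
  note b = berezin_data_word_op_bop[OF T \<beta> ik]
  have "word_adj T \<beta> l (adj (T i s) h) = cnj (coef i s \<beta>) *\<^sub>C adj (T i s) (word_adj T \<beta> l h)"
    unfolding coef_def using word_adj_commute[OF T i \<beta>, of l h] by (simp add: l)
  then have "word_adj T \<beta> i (adj (T i s) h)
      = cnj (coef i s \<beta>) *\<^sub>C adj (word_op (T i) (\<beta> i)) (adj (T i s) (word_adj T \<beta> l h))"
    using bop_scaleC[OF adj_in_bop[OF b]] by (simp add: l word_adj_Suc)
  also have "adj (word_op (T i) (\<beta> i)) (adj (T i s) (word_adj T \<beta> l h)) = word_adj T (\<beta>(i := s # \<beta> i)) i h"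
    using word_adj_upd[of l i T \<beta> "s # \<beta> i"]
    by (simp add: l word_adj_Suc adj_compose berezin_data_bop[OF T i[unfolded l]] b[unfolded l])
  finally show ?case .
next
  case (step j)
  have b: "word_op (T (Suc j)) (\<beta> (Suc j)) \<in> bop"
    by (rule berezin_data_word_op_bop[OF T \<beta>]) (use step.prems in simp)
  show ?case
    using step by (simp add: word_adj_Suc bop_scaleC[OF adj_in_bop[OF b]])
qed

text \<open>The adjoint identity is proved, since the adjoint shift merely prepends a letter to the
  index, which matches \<open>word_adj_cons\<close> coordinate by coordinate.\<close>

lemma berezin_kernel_intertwine:
  assumes T: "berezin_data T" and i: "index i s"
  shows "adj (berezin_kernel k n T) o\<^sub>L tensor_id (S i s) = T i s o\<^sub>L adj (berezin_kernel k n T)"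
proof -
  let ?K = "berezin_kernel k n T" and ?R = "op_sqrt (Delta k n T)"
  note K = berezin_kernel_bop[OF T] and Sb = shift_bop[OF i] and Tb = berezin_data_bop[OF T i]
  note R = op_sqrt_Delta_bop[OF T]
  have "tensor_id (adj (S i s)) o\<^sub>L ?K = ?K o\<^sub>L adj (T i s)"
  proof (rule blinfun_eqI, rule ell2_eqI)
    fix h \<gamma>
    have t: "tensor_id (adj (S i s)) = wcomp W (\<lambda>\<gamma>. cnj (coef i s \<gamma>)) (\<lambda>\<gamma>. \<gamma>(i := s # \<gamma> i))"
      unfolding shift_eq[OF i] adj_shift[OF i] by (rule tensor_id_wcomp[OF shift_adj_ok[OF i]])
    have ik: "i \<le> k" using i by (simp add: index_def)
    show "ell2_coord ((tensor_id (adj (S i s)) o\<^sub>L ?K) h) \<gamma> = ell2_coord ((?K o\<^sub>L adj (T i s)) h) \<gamma>"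
      by (simp add: t wcomp_coord[OF shift_adj_ok[OF i]] berezin_kernel_coord[OF T]
          cons_in_words'[OF i] word_adj_cons[OF T i _ ik order_refl] bop_scaleC[OF R])
  qed
  from arg_cong[OF this, of adj] show ?thesis
    by (simp add: adj_compose K Tb tensor_id_bop tensor_id_adj[symmetric] Sb)
qed

lemma berezin_kernel_fock_id:
  assumes T: "berezin_data T"
  shows "adj (berezin_kernel k n T) o\<^sub>L tensor_id P = adj (berezin_kernel k n T)"
proof -
  let ?K = "berezin_kernel k n T"
  note K = berezin_kernel_bop[OF T]
  have t: "tensor_id P = wcomp W (\<lambda>_. 1) id"
    unfolding fock_id_eq by (rule tensor_id_wcomp[OF fock_ok])
  have "tensor_id P o\<^sub>L ?K = ?K"
    by (rule blinfun_eqI, rule ell2_eqI)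
      (simp add: t wcomp_coord[OF fock_ok] berezin_kernel_coord[OF T])
  from arg_cong[OF this, of adj] show ?thesis
    by (simp add: adj_compose K tensor_id_bop tensor_id_adj[symmetric] fock_id_bop adj_fock_id)
qed

end

section \<open>Scaled and pure tuples\<close>

lemma blinfun_compose_id: "A o\<^sub>L id_blinfun = A" "id_blinfun o\<^sub>L A = A"
  by (rule blinfun_eqI, simp)+

text \<open>Pairwise commuting steps may be performed in either order. The invariant set A is there
  because the maps \<open>Phi\<close> are shown to commute on complex-linear operators.\<close>

lemma foldr_eq_fold_on:
  assumes "\<And>x X. x \<in> set xs \<Longrightarrow> X \<in> A \<Longrightarrow> f x X \<in> A"
    and "\<And>x y X. x \<in> set xs \<Longrightarrow> y \<in> set xs \<Longrightarrow> X \<in> A \<Longrightarrow> f x (f y X) = f y (f x X)"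
    and "X \<in> A"
  shows "foldr f xs X = fold f xs X"
proof -
  have comm: "fold f ys (f x X) = f x (fold f ys X)" if "x \<in> set xs" "set ys \<subseteq> set xs" "X \<in> A" for x ys X
    using that(2,3)
  proof (induction ys arbitrary: X)
    case (Cons y ys)
    then show ?case using assms(1,2) that(1) by simp
  qed simp
  have "foldr f ys X = fold f ys X" if "set ys \<subseteq> set xs" for ys
    using that by (induction ys) (auto simp: comm \<open>X \<in> A\<close>)
  then show ?thesis by blast
qed

context row
begin

lemma Phi_scale: "Phi m (\<lambda>s. r *\<^sub>R R s) X = r\<^sup>2 *\<^sub>R Phi m R X"
  unfolding Phi_def scaleR_sum_right
  by (intro sum.cong refl blinfun_eqI)
    (simp add: adj_scaleR R_bop blinfun.scaleR_left blinfun.scaleR_right power2_eq_square)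

lemma contraction_sum_le:
  assumes "positive_op (id_blinfun - (\<Sum>s=1..m. R s o\<^sub>L adj (R s)))"
  shows "(\<Sum>s=1..m. (norm (adj (R s) x))\<^sup>2) \<le> (norm x)\<^sup>2"
proof -
  have "0 \<le> qf (id_blinfun - (\<Sum>s=1..m. R s o\<^sub>L adj (R s))) x"
    using assms by (simp add: positive_op_iff)
  moreover have "qf (R s o\<^sub>L adj (R s)) x = (norm (adj (R s) x))\<^sup>2" if "s \<in> {1..m}" for s
    using adj_compose_self_positive(2)[OF adj_in_bop[OF R_bop[OF that]], of x] R_bop[OF that] by simp
  ultimately show ?thesis by (simp add: qf_diff qf_id qf_sum)
qed

text \<open>The row contraction gives \<open>Phi\<close> I <= I, so each scaled application
  contributes a factor r squared and the decay is geometric.\<close>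

lemma scaled_weakly_pure:
  assumes contr: "positive_op (id_blinfun - (\<Sum>s=1..m. R s o\<^sub>L adj (R s)))" and r: "0 \<le> r" "r < 1"
  shows "(\<lambda>p. qf ((Phi m (\<lambda>s. r *\<^sub>R R s) ^^ p) id_blinfun) x) \<longlonglongrightarrow> 0"
proof -
  have bnd: "0 \<le> qf ((Phi m (\<lambda>s. r *\<^sub>R R s) ^^ p) id_blinfun) x
      \<and> qf ((Phi m (\<lambda>s. r *\<^sub>R R s) ^^ p) id_blinfun) x \<le> (r\<^sup>2) ^ p * (norm x)\<^sup>2" for p x
  proof (induction p arbitrary: x)
    case (Suc p)
    let ?X = "(Phi m (\<lambda>s. r *\<^sub>R R s) ^^ p) id_blinfun"
    have eq: "qf ((Phi m (\<lambda>s. r *\<^sub>R R s) ^^ Suc p) id_blinfun) x = r\<^sup>2 * (\<Sum>s=1..m. qf ?X (adj (R s) x))"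
      by (simp add: Phi_scale qf_scaleR qf_Phi)
    have "(\<Sum>s=1..m. qf ?X (adj (R s) x)) \<le> (\<Sum>s=1..m. (r\<^sup>2) ^ p * (norm (adj (R s) x))\<^sup>2)"
      using Suc by (intro sum_mono) blast
    also have "\<dots> \<le> (r\<^sup>2) ^ p * (norm x)\<^sup>2"
      unfolding sum_distrib_left[symmetric] by (intro mult_left_mono contraction_sum_le contr) simp
    finally have "r\<^sup>2 * (\<Sum>s=1..m. qf ?X (adj (R s) x)) \<le> r\<^sup>2 * ((r\<^sup>2) ^ p * (norm x)\<^sup>2)"
      by (rule mult_left_mono[OF _ zero_le_power2])
    moreover have "0 \<le> (\<Sum>s=1..m. qf ?X (adj (R s) x))"
      using Suc by (intro sum_nonneg) blast
    ultimately show ?case unfolding eq by (simp add: mult.assoc)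
  qed (simp add: qf_id)
  have "r\<^sup>2 < 1" using r by (simp add: abs_square_less_1)
  then have "(\<lambda>p. (r\<^sup>2) ^ p * (norm x)\<^sup>2) \<longlonglongrightarrow> 0"
    by (intro tendsto_mult_left_zero LIMSEQ_power_zero) simp
  then show ?thesis
    by (rule tendsto_sandwich[OF _ _ tendsto_const, rotated 2]) (use bnd in auto)
qed

end

context polyball_shifts
begin

lemma polyball_row: "T \<in> polyball k n lam \<Longrightarrow> i \<in> {1..k} \<Longrightarrow> row (n i) (T i)"
  by unfold_locales (simp add: polyball_def)

lemma polyball_commute:
  "T \<in> polyball k n lam \<Longrightarrow> index i s \<Longrightarrow> index j t \<Longrightarrow> i \<noteq> j \<Longrightarrow>
    T i s o\<^sub>L T j t = lam i j s t *\<^sub>C (T j t o\<^sub>L T i s)"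
  unfolding polyball_def index_def by blast

lemma polyball_bop: "T \<in> polyball k n lam \<Longrightarrow> index i s \<Longrightarrow> T i s \<in> bop"
  unfolding polyball_def index_def by blast

lemma scale_commute:
  assumes "T \<in> polyball k n lam" "index i s" "index j t" "i \<noteq> j"
  shows "scale_tuple r T i s o\<^sub>L scale_tuple r T j t
    = lam i j s t *\<^sub>C (scale_tuple r T j t o\<^sub>L scale_tuple r T i s)"
proof (rule blinfun_eqI)
  fix x
  have "T i s (T j t x) = lam i j s t *\<^sub>C T j t (T i s x)"
    using arg_cong[OF polyball_commute[OF assms], of "\<lambda>X. blinfun_apply X x"] by simp
  then show "(scale_tuple r T i s o\<^sub>L scale_tuple r T j t) x
      = (lam i j s t *\<^sub>C (scale_tuple r T j t o\<^sub>L scale_tuple r T i s)) x"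
    by (simp add: scale_tuple_def blinfun.scaleR_left blinfun.scaleR_right scaleC.scaleR_right)
qed

text \<open>Exchanging two letters produces a phase on the left of X and its conjugate on the right;
  their product is 1.\<close>

lemma Phi_commute:
  assumes bop: "\<And>i s. index i s \<Longrightarrow> T i s \<in> bop"
    and comm: "\<And>i j s t. index i s \<Longrightarrow> index j t \<Longrightarrow> i \<noteq> j \<Longrightarrow>
      T i s o\<^sub>L T j t = lam i j s t *\<^sub>C (T j t o\<^sub>L T i s)"
    and X: "X \<in> bop" and i: "i \<in> {1..k}" and j: "j \<in> {1..k}" and ij: "i \<noteq> j"
  shows "Phi (n i) (T i) (Phi (n j) (T j) X) = Phi (n j) (T j) (Phi (n i) (T i) X)"
proof (rule blinfun_eqI)
  fix x
  have term_eq: "T i s (T j t (X (adj (T j t) (adj (T i s) x)))) = T j t (T i s (X (adj (T i s) (adj (T j t) x))))"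
    if s: "s \<in> {1..n i}" and t: "t \<in> {1..n j}" for s t
  proof -
    have idx: "index i s" and jt: "index j t" using s t i j by (auto simp: index_def)
    note b = bop[OF idx] bop[OF jt]
    note c = comm[OF idx jt ij]
    have 1: "T i s (T j t y) = lam i j s t *\<^sub>C T j t (T i s y)" for y
      using arg_cong[OF c, of "\<lambda>X. blinfun_apply X y"] by simp
    have "adj (T j t) o\<^sub>L adj (T i s) = cnj (lam i j s t) *\<^sub>C (adj (T i s) o\<^sub>L adj (T j t))"
      using arg_cong[OF c, of adj] by (simp add: adj_compose adj_scaleC bop_compose b)
    then have 2: "adj (T j t) (adj (T i s) x) = cnj (lam i j s t) *\<^sub>C adj (T i s) (adj (T j t) x)"
      by (metis blinfun_apply_blinfun_compose scaleC_blinfun_apply)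
    note u = cnj_mult_unit[OF lam_unit[OF i j ij s t]]
    show ?thesis
      unfolding 2 1 bop_scaleC[OF X] bop_scaleC[OF b(1)] bop_scaleC[OF b(2)] scaleC_scaleC u scaleC_one ..
  qed
  have "Phi (n i) (T i) (Phi (n j) (T j) X) x
      = (\<Sum>s=1..n i. \<Sum>t=1..n j. T i s (T j t (X (adj (T j t) (adj (T i s) x)))))"
    by (simp add: Phi_def blinfun.sum_left blinfun.sum_right)
  also have "\<dots> = (\<Sum>s=1..n i. \<Sum>t=1..n j. T j t (T i s (X (adj (T i s) (adj (T j t) x)))))"
    by (intro sum.cong refl term_eq)
  also have "\<dots> = (\<Sum>t=1..n j. \<Sum>s=1..n i. T j t (T i s (X (adj (T i s) (adj (T j t) x)))))"
    by (rule sum.swap)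
  also have "\<dots> = Phi (n j) (T j) (Phi (n i) (T i) X) x"
    by (simp add: Phi_def blinfun.sum_left blinfun.sum_right)
  finally show "Phi (n i) (T i) (Phi (n j) (T j) X) x = Phi (n j) (T j) (Phi (n i) (T i) X) x" .
qed

text \<open>Membership in the polyball speaks of one order of composition, the kernel of the
  opposite one.\<close>

lemma defect_eq_Delta:
  assumes bop: "\<And>i s. index i s \<Longrightarrow> T i s \<in> bop"
    and comm: "\<And>i j s t. index i s \<Longrightarrow> index j t \<Longrightarrow> i \<noteq> j \<Longrightarrow>
      T i s o\<^sub>L T j t = lam i j s t *\<^sub>C (T j t o\<^sub>L T i s)"
  shows "defect k n T = Delta k n T"
  unfolding defect_def Delta_def
proof (rule foldr_eq_fold_on[where A = bop])
  have row: "row (n i) (T i)" if "i \<in> {1..k}" for i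
    by unfold_locales (use bop that in \<open>simp add: index_def\<close>)
  have k: "set [1..<Suc k] = {1..k}" by auto
  fix i assume "i \<in> set [1..<Suc k]"
  then have i: "i \<in> {1..k}" unfolding k .
  fix X :: "'a \<Rightarrow>\<^sub>L 'a" assume X: "X \<in> bop"
  show "X - Phi (n i) (T i) X \<in> bop" by (intro bop_diff X row.Phi_bop[OF row[OF i]])
  fix j assume "j \<in> set [1..<Suc k]"
  then have j: "j \<in> {1..k}" unfolding k .
  show "X - Phi (n j) (T j) X - Phi (n i) (T i) (X - Phi (n j) (T j) X)
      = X - Phi (n i) (T i) X - Phi (n j) (T j) (X - Phi (n i) (T i) X)"
  proof (cases "i = j")
    case False
    have "Phi (n i) (T i) (Phi (n j) (T j) X) = Phi (n j) (T j) (Phi (n i) (T i) X)"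
      by (rule Phi_commute[OF bop comm X i j False])
    then show ?thesis
      unfolding row.Phi_diff[OF row[OF i]] row.Phi_diff[OF row[OF j]] by (simp add: algebra_simps)
  qed simp
qed simp

lemma berezin_data_scale:
  assumes T: "T \<in> polyball k n lam" and r: "0 \<le> r" "r < 1"
  shows "berezin_data (scale_tuple r T)"
proof -
  have b: "scale_tuple r T i s \<in> bop" if "index i s" for i s
    by (simp add: scale_tuple_def bop_scaleR polyball_bop[OF T that])
  have "r \<in> {0..<1}" using r by simp
  with T have "positive_op (defect k n (scale_tuple r T))"
    unfolding polyball_def by blast
  moreover have "defect k n (scale_tuple r T) = Delta k n (scale_tuple r T)"
    by (rule defect_eq_Delta[OF b scale_commute[OF T]])
  ultimately have D: "positive_op (Delta k n (scale_tuple r T))" by (simp only:)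
  have pure: "(\<lambda>p. qf ((Phi (n i) (scale_tuple r T i) ^^ p) id_blinfun) x) \<longlonglongrightarrow> 0" if i: "i \<in> {1..k}" for i x
  proof -
    have "positive_op (id_blinfun - (\<Sum>s=1..n i. T i s o\<^sub>L adj (T i s)))"
      using T i unfolding polyball_def by blast
    from row.scaled_weakly_pure[OF polyball_row[OF T i] this r]
    show ?thesis by (simp add: scale_tuple_def)
  qed
  show ?thesis
    unfolding berezin_data_def by (intro conjI allI impI ballI b scale_commute[OF T] D pure)
qed

lemma Delta_scale_tendsto:
  assumes T: "T \<in> polyball k n lam" and "j \<le> k"
  shows "((\<lambda>r. Delta j n (scale_tuple r T)) \<longlongrightarrow> Delta j n T) (at_left 1)"
  using \<open>j \<le> k\<close>
proof (induction j)
  case (Suc j)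
  then have "Suc j \<in> {1..k}" by simp
  note row = polyball_row[OF T this]
  have IH: "((\<lambda>r. Delta j n (scale_tuple r T)) \<longlongrightarrow> Delta j n T) (at_left 1)"
    using Suc by simp
  have Phi: "((\<lambda>r. Phi (n (Suc j)) (T (Suc j)) (Delta j n (scale_tuple r T)))
      \<longlongrightarrow> Phi (n (Suc j)) (T (Suc j)) (Delta j n T)) (at_left 1)"
    unfolding Phi_def by (intro tendsto_sum tendsto_blinfun_compose tendsto_const IH)
  have "((\<lambda>r::real. r\<^sup>2 *\<^sub>R Phi (n (Suc j)) (T (Suc j)) (Delta j n (scale_tuple r T)))
      \<longlongrightarrow> 1\<^sup>2 *\<^sub>R Phi (n (Suc j)) (T (Suc j)) (Delta j n T)) (at_left 1)"
    by (intro tendsto_intros Phi)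
  then have "((\<lambda>r. Phi (n (Suc j)) (scale_tuple r T (Suc j)) (Delta j n (scale_tuple r T)))
      \<longlongrightarrow> Phi (n (Suc j)) (T (Suc j)) (Delta j n T)) (at_left 1)"
    by (simp add: scale_tuple_def row.Phi_scale[OF row])
  then show ?case unfolding Delta_Suc by (intro tendsto_diff IH)
qed (simp add: Delta_0)

lemma Delta_selfadjoint:
  assumes T: "T \<in> polyball k n lam" and "j \<le> k"
  shows "selfadjoint (Delta j n T)"
  using \<open>j \<le> k\<close>
proof (induction j)
  case (Suc j)
  have j: "Suc j \<in> {1..k}" using Suc.prems by simp
  have "selfadjoint (Delta j n T)" using Suc by simp
  with row.Phi_selfadjoint[OF polyball_row[OF T j] this] show ?case
    by (simp add: Delta_Suc selfadjoint_def bop_diff adj_diff)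
qed (simp add: Delta_0 selfadjoint_def)

lemma eventually_at_left_unit: "eventually (\<lambda>r::real. r \<in> {0..<1}) (at_left 1)"
  by (rule eventually_mono[OF eventually_at_left_real[OF zero_less_one]]) auto

text \<open>The polyball condition stops short of r = 1, so positivity of the defect of T is
  obtained as a limit of the forms for rT.\<close>

lemma berezin_data_pure:
  assumes T: "T \<in> polyball k n lam" and pure: "pure_tuple k n T"
  shows "berezin_data T"
proof -
  have lim: "((\<lambda>r. qf (Delta k n (scale_tuple r T)) x) \<longlongrightarrow> qf (Delta k n T) x) (at_left 1)" for x
    by (rule tendsto_qf[OF Delta_scale_tendsto[OF T order_refl]])
  have "0 \<le> qf (Delta k n T) x" for x
  proof (rule tendsto_lowerbound[OF lim])
    show "\<forall>\<^sub>F r in at_left 1. 0 \<le> qf (Delta k n (scale_tuple r T)) x"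
      by (rule eventually_mono[OF eventually_at_left_unit])
        (use berezin_data_scale[OF T] in \<open>auto simp: berezin_data_def positive_op_iff\<close>)
  qed simp
  then have D: "positive_op (Delta k n T)"
    using Delta_selfadjoint[OF T order_refl] by (simp add: positive_op_iff)
  have weak: "(\<lambda>p. qf ((Phi (n i) (T i) ^^ p) id_blinfun) x) \<longlonglongrightarrow> 0" if "i \<in> {1..k}" for i x
  proof -
    have "(\<lambda>p. ((Phi (n i) (T i) ^^ p) id_blinfun) x) \<longlonglongrightarrow> 0"
      using pure that by (simp add: pure_tuple_def)
    from tendsto_Re[OF cinner.tendsto[OF this tendsto_const]]
    show ?thesis by (simp add: qf_def cinner.zero_left)
  qed
  show ?thesis
    unfolding berezin_data_def
    by (intro conjI allI impI ballI polyball_bop[OF T] polyball_commute[OF T] D weak)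
qed

section \<open>The Berezin transform\<close>

context
  fixes T :: "'h::chilbert_space op_tuple"
  assumes T: "berezin_data T"
begin

abbreviation "K \<equiv> berezin_kernel k n T"
abbreviation "B \<equiv> berezin k n T"

lemma berezin_apply: "B f x = adj K (tensor_id f (K x))"
  by (simp add: berezin_def)

lemma berezin_bop: "f \<in> bop \<Longrightarrow> B f \<in> bop"
  unfolding berezin_def by (intro bop_compose adj_in_bop tensor_id_bop berezin_kernel_bop T)

lemma berezin_add: "f \<in> bop \<Longrightarrow> g \<in> bop \<Longrightarrow> B (f + g) = B f + B g"
  and berezin_diff: "f \<in> bop \<Longrightarrow> g \<in> bop \<Longrightarrow> B (f - g) = B f - B g"
  by (rule blinfun_eqI; simp add: berezin_apply tensor_id_add tensor_id_diff blinfun.add_left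
      blinfun.diff_left blinfun.add_right blinfun.diff_right)+

lemma berezin_scaleC: "f \<in> bop \<Longrightarrow> B (c *\<^sub>C f) = c *\<^sub>C B f"
  by (rule blinfun_eqI)
    (simp add: berezin_apply tensor_id_scaleC bop_scaleC[OF adj_in_bop[OF berezin_kernel_bop[OF T]]])

lemma berezin_adj: "f \<in> bop \<Longrightarrow> B (adj f) = adj (B f)"
  by (simp add: berezin_def adj_compose bop_compose tensor_id_bop berezin_kernel_bop[OF T]
      tensor_id_adj blinfun_compose_assoc)

lemma norm_adj_kernel_le: "norm (adj K y) \<le> norm y"
proof -
  have "norm K \<le> 1"
    by (rule norm_blinfun_bound) (simp_all add: norm_berezin_kernel[OF T])
  then have "norm (adj K) \<le> 1" using norm_adj_le[OF berezin_kernel_bop[OF T]] by linarith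
  then show ?thesis
    using norm_blinfun[of "adj K" y] mult_right_mono[of "norm (adj K)" 1 "norm y"] by simp
qed

lemma norm_berezin_le:
  assumes "f \<in> bop" shows "norm (B f) \<le> norm f"
proof (rule norm_blinfun_bound)
  fix x
  have "norm (B f x) \<le> norm (tensor_id f (K x))"
    unfolding berezin_apply by (rule norm_adj_kernel_le)
  also have "\<dots> \<le> norm (tensor_id f :: (word_tuple, 'h) ell2 \<Rightarrow>\<^sub>L _) * norm (K x)" by (rule norm_blinfun)
  also have "\<dots> \<le> norm f * norm x"
    unfolding norm_berezin_kernel[OF T] by (intro mult_right_mono norm_tensor_id_le assms) simp
  finally show "norm (B f x) \<le> norm f * norm x" .
qed simp

text \<open>Compressing by the kernel acts entrywise: the isometry preserves the norms of the
  components and its adjoint does not increase them.\<close>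

lemma berezin_matrix_bound:
  assumes F: "\<And>p q. p < m \<Longrightarrow> q < m \<Longrightarrow> F p q \<in> bop"
  shows "L2_set (\<lambda>p. norm (\<Sum>q<m. B (F p q) (x q))) {..<m}
    \<le> op_matrix_norm m F * L2_set (\<lambda>q. norm (x q)) {..<m}"
proof -
  have "(\<Sum>q<m. B (F p q) (x q)) = adj K (\<Sum>q<m. tensor_id (F p q) (K (x q)))" for p
    by (simp add: berezin_apply blinfun.sum_right)
  then have "L2_set (\<lambda>p. norm (\<Sum>q<m. B (F p q) (x q))) {..<m}
      \<le> L2_set (\<lambda>p. norm (\<Sum>q<m. tensor_id (F p q) (K (x q)))) {..<m}"
    by (intro L2_set_mono) (auto simp: norm_adj_kernel_le)
  also have "\<dots> \<le> op_matrix_norm m F * L2_set (\<lambda>q. norm (K (x q))) {..<m}"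
    by (rule tensor_id_matrix_bound[OF F])
  finally show ?thesis by (simp add: norm_berezin_kernel[OF T])
qed

lemma berezin_fock_id: "B P = id_blinfun"
  by (simp add: berezin_def berezin_kernel_fock_id[OF T] adj_berezin_kernel_compose[OF T])

lemma berezin_shift: "index i s \<Longrightarrow> B (S i s) = T i s"
  by (simp add: berezin_def berezin_kernel_intertwine[OF T] blinfun_compose_assoc
      adj_berezin_kernel_compose[OF T] blinfun_compose_id)

text \<open>The operators \<open>f\<close> with \<open>K\<^sup>* (f \<otimes> I) = B f K\<^sup>*\<close> form a closed algebra.\<close>

lemma adj_kernel_tensor:
  assumes "f \<in> polyball_algebra k n lam"
  shows "f \<in> bop \<and> adj K o\<^sub>L tensor_id f = B f o\<^sub>L adj K"
proof -
  let ?A = "{f. f \<in> bop \<and> adj K o\<^sub>L tensor_id f = B f o\<^sub>L adj K}"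
  have KK: "adj K (K x) = x" for x
    using arg_cong[OF adj_berezin_kernel_compose[OF T], of "\<lambda>X. blinfun_apply X x"] by simp
  have app: "adj K (tensor_id f y) = B f (adj K y)" if "f \<in> ?A" for f y
  proof -
    have "adj K o\<^sub>L tensor_id f = B f o\<^sub>L adj K" using that by blast
    from arg_cong[OF this, of "\<lambda>X. blinfun_apply X y"] show ?thesis by simp
  qed
  have "closed_subalgebra ?A"
    unfolding closed_subalgebra_def
  proof (intro conjI ballI allI)
    show "?A \<subseteq> bop" by blast
    have z: "tensor_id 0 = (0 :: (word_tuple, 'h) ell2 \<Rightarrow>\<^sub>L _)"
      by (rule tensor_id_eqI) (simp add: elem_tensor.zero_left)
    show "0 \<in> ?A" by (simp add: berezin_def z)
    show "closed ?A"
      unfolding closed_sequential_limits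
    proof (intro allI impI)
      fix f l assume "(\<forall>i::nat. f i \<in> ?A) \<and> f \<longlonglongrightarrow> l"
      then have f: "\<And>i. f i \<in> bop" "\<And>i. adj K o\<^sub>L tensor_id (f i) = B (f i) o\<^sub>L adj K" and lim: "f \<longlonglongrightarrow> l"
        by auto
      have l: "l \<in> bop" by (rule closed_sequentially[OF closed_bop f(1) lim])
      have "(\<lambda>i. tensor_id (f i) - tensor_id l :: (word_tuple, 'h) ell2 \<Rightarrow>\<^sub>L _) \<longlonglongrightarrow> 0"
      proof (rule tendsto_0_le[OF LIM_zero[OF lim], where K = 1])
        show "\<forall>\<^sub>F i in sequentially. norm (tensor_id (f i) - tensor_id l :: (word_tuple, 'h) ell2 \<Rightarrow>\<^sub>L _)
            \<le> norm (f i - l) * 1"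
          using norm_tensor_id_le[OF bop_diff[OF f(1) l]]
          by (intro always_eventually allI) (simp add: tensor_id_diff f(1) l)
      qed
      then have t: "(\<lambda>i. tensor_id (f i) :: (word_tuple, 'h) ell2 \<Rightarrow>\<^sub>L _) \<longlonglongrightarrow> tensor_id l"
        by (rule LIM_zero_cancel)
      have "(\<lambda>i. adj K o\<^sub>L tensor_id (f i)) \<longlonglongrightarrow> (adj K o\<^sub>L tensor_id l)"
        "(\<lambda>i. B (f i) o\<^sub>L adj K) \<longlonglongrightarrow> (B l o\<^sub>L adj K)"
        unfolding berezin_def by (intro tendsto_blinfun_compose tendsto_const t)+
      then have "adj K o\<^sub>L tensor_id l = B l o\<^sub>L adj K"
        unfolding f(2) by (rule LIMSEQ_unique)
      with l show "l \<in> ?A" by blast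
    qed
    fix f g assume fg: "f \<in> ?A" "g \<in> ?A"
    then have fb: "f \<in> bop" "g \<in> bop" by auto
    show "f + g \<in> ?A"
      using app[OF fg(1)] app[OF fg(2)]
      by (auto intro!: blinfun_eqI simp: fb bop_add tensor_id_add berezin_add blinfun.add_left blinfun.add_right)
    \<comment> \<open>Only the intertwining for the left factor f enters here.\<close>
    have "B (f o\<^sub>L g) x = B f (B g x)" for x
      by (simp add: berezin_apply[of "f o\<^sub>L g"] berezin_apply[of g] tensor_id_compose fb app[OF fg(1)])
    then show "f o\<^sub>L g \<in> ?A"
      using app[OF fg(1)] app[OF fg(2)]
      by (auto intro!: blinfun_eqI simp: fb bop_compose tensor_id_compose)
  next
    fix c f assume f: "f \<in> ?A"
    then have fb: "f \<in> bop" by auto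
    show "c *\<^sub>C f \<in> ?A"
      using app[OF f]
      by (auto intro!: blinfun_eqI simp: fb bop_scale tensor_id_scaleC berezin_scaleC
          bop_scaleC[OF adj_in_bop[OF berezin_kernel_bop[OF T]]])
  qed
  moreover have "P \<in> ?A"
    by (simp add: fock_id_bop berezin_kernel_fock_id[OF T] berezin_fock_id blinfun_compose_id)
  moreover have "S i s \<in> ?A" if "index i s" for i s
    by (simp add: shift_bop that berezin_kernel_intertwine[OF T that] berezin_shift[OF that])
  ultimately have "polyball_algebra k n lam \<subseteq> ?A" by (rule polyball_algebra_minimal)
  then show ?thesis using assms by blast
qed

text \<open>The right factor may be any operator in \<open>bop\<close>, in particular an adjoint.
  This evaluates the transform on Wick-ordered products.\<close>

lemma berezin_compose:
  assumes "f \<in> polyball_algebra k n lam" "g \<in> bop"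
  shows "B (f o\<^sub>L g) = B f o\<^sub>L B g"
proof -
  have f: "f \<in> bop" "adj K o\<^sub>L tensor_id f = B f o\<^sub>L adj K"
    using adj_kernel_tensor[OF assms(1)] by auto
  have "B (f o\<^sub>L g) = (adj K o\<^sub>L tensor_id f) o\<^sub>L (tensor_id g o\<^sub>L K)"
    by (simp add: berezin_def tensor_id_compose f(1) assms(2) blinfun_compose_assoc)
  also have "\<dots> = B f o\<^sub>L B g"
    unfolding f(2) by (simp add: berezin_def blinfun_compose_assoc)
  finally show ?thesis .
qed

end

end

section \<open>Radial limits of the transforms\<close>

context polyball_shifts
begin

lemma polyball_algebra_gens:
  "P \<in> polyball_algebra k n lam" "index i s \<Longrightarrow> S i s \<in> polyball_algebra k n lam"
  unfolding polyball_algebra_def generated_algebra_def std_shifts_eq by blast+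

lemma polyball_algebra_bop: "f \<in> polyball_algebra k n lam \<Longrightarrow> f \<in> bop"
  using polyball_algebra_subset shift_cstar_subset cspan_wick_bop by blast

lemma monomials_subset: "V \<in> monomials \<Longrightarrow> V \<in> polyball_algebra k n lam"
  by (induction rule: monomials.induct) (auto intro: polyball_algebra_compose polyball_algebra_gens)

lemma berezin_fun_tendsto:
  fixes T :: "'h::chilbert_space op_tuple"
  assumes T: "T \<in> polyball k n lam" and "(\<phi> \<longlongrightarrow> L) (at_left 1)"
    and "\<And>r. berezin_data (scale_tuple r T) \<Longrightarrow> \<phi> r = berezin k n (scale_tuple r T) f"
  shows "((\<lambda>r. berezin k n (scale_tuple r T) f) \<longlongrightarrow> L) (at_left 1)"
  by (rule Lim_transform_eventually[OF assms(2)], rule eventually_mono[OF eventually_at_left_unit])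
    (auto intro: assms(3) berezin_data_scale[OF T])

context
  fixes T :: "'h::chilbert_space op_tuple"
  assumes T: "T \<in> polyball k n lam"
begin

abbreviation lim_of :: "fock_op \<Rightarrow> ('h \<Rightarrow>\<^sub>L 'h) \<Rightarrow> bool"
  where "lim_of f L \<equiv> ((\<lambda>r. berezin k n (scale_tuple r T) f) \<longlongrightarrow> L) (at_left 1)"

lemma eventually_berezin_data: "\<forall>\<^sub>F r in at_left 1. berezin_data (scale_tuple r T)"
  by (rule eventually_mono[OF eventually_at_left_unit]) (auto intro: berezin_data_scale[OF T])

lemma lim_of_bop: 
  assumes "lim_of f L" "f \<in> bop" shows "L \<in> bop"
  by (rule Lim_in_closed_set[OF closed_bop _ _ assms(1)])
    (auto intro!: eventually_mono[OF eventually_berezin_data] berezin_bop assms(2))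

lemma lim_of_add: "lim_of f L \<Longrightarrow> lim_of g M \<Longrightarrow> f \<in> bop \<Longrightarrow> g \<in> bop \<Longrightarrow> lim_of (f + g) (L + M)"
  by (rule berezin_fun_tendsto[OF T tendsto_add]) (auto simp: berezin_add)

lemma lim_of_scaleC:
  assumes "lim_of f L" "f \<in> bop" shows "lim_of (c *\<^sub>C f) (c *\<^sub>C L)"
  by (rule berezin_fun_tendsto[OF T bounded_linear.tendsto[OF bounded_linear_scaleC_blinfun assms(1)]])
    (simp add: berezin_scaleC assms(2))

lemma lim_of_compose:
  assumes "lim_of f L" "lim_of g M" "f \<in> polyball_algebra k n lam" "g \<in> bop"
  shows "lim_of (f o\<^sub>L g) (L o\<^sub>L M)"
  by (rule berezin_fun_tendsto[OF T tendsto_blinfun_compose[OF assms(1,2)]])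
    (simp add: berezin_compose assms(3,4))

lemma lim_of_adj:
  assumes "lim_of f L" "f \<in> bop" shows "lim_of (adj f) (adj L)"
proof (rule berezin_fun_tendsto[OF T tendsto_adj[OF assms(1) _ lim_of_bop[OF assms]]])
  show "\<forall>\<^sub>F r in at_left 1. berezin k n (scale_tuple r T) f \<in> bop"
    by (rule eventually_mono[OF eventually_berezin_data]) (rule berezin_bop[OF _ assms(2)])
qed (simp add: berezin_adj assms(2))

lemma lim_of_fock_id: "lim_of P id_blinfun"
  by (rule berezin_fun_tendsto[OF T tendsto_const]) (simp add: berezin_fock_id)

lemma lim_of_shift:
  assumes "index i s" shows "lim_of (S i s) (T i s)"
proof -
  have "((\<lambda>r. r *\<^sub>R T i s) \<longlongrightarrow> 1 *\<^sub>R T i s) (at_left 1)" by (intro tendsto_intros)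
  then have "((\<lambda>r. scale_tuple r T i s) \<longlongrightarrow> T i s) (at_left 1)" by (simp add: scale_tuple_def)
  then show ?thesis by (rule berezin_fun_tendsto[OF T]) (simp add: berezin_shift assms)
qed

text \<open>The transforms are contractive for every r in [0,1), so norm convergence of X makes them
  converge uniformly in r, and the two limits may be interchanged.\<close>

lemma lim_of_closed:
  assumes X: "\<And>i. X i \<in> bop" "X \<longlonglongrightarrow> l" and lim: "\<And>i. lim_of (X i) (G i)" and G: "G \<longlonglongrightarrow> L"
  shows "lim_of l L"
proof (rule swap_uniform_limit'[where f = "\<lambda>i r. berezin k n (scale_tuple r T) (X i)"
      and S = "{0..<1}" and F = sequentially and g = G])
  have l: "l \<in> bop" by (rule closed_sequentially[OF closed_bop X])
  show "uniform_limit {0..<1} (\<lambda>i r. berezin k n (scale_tuple r T) (X i))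
      (\<lambda>r. berezin k n (scale_tuple r T) l) sequentially"
  proof (rule uniform_limitI)
    fix e :: real assume "0 < e"
    from tendstoD[OF X(2) this]
    show "\<forall>\<^sub>F i in sequentially. \<forall>r\<in>{0..<1}.
      dist (berezin k n (scale_tuple r T) (X i)) (berezin k n (scale_tuple r T) l) < e"
    proof (rule eventually_mono, intro ballI)
      fix i and r :: real assume d: "dist (X i) l < e" and "r \<in> {0..<1}"
      then have r: "berezin_data (scale_tuple r T)" using berezin_data_scale[OF T] by simp
      have "norm (berezin k n (scale_tuple r T) (X i - l)) \<le> norm (X i - l)"
        by (rule norm_berezin_le[OF r bop_diff[OF X(1) l]])
      then show "dist (berezin k n (scale_tuple r T) (X i)) (berezin k n (scale_tuple r T) l) < e"
        using d by (simp add: dist_norm berezin_diff[OF r X(1) l])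
    qed
  qed
qed (use lim G eventually_at_left_unit in auto)

text \<open>Contractivity survives the limit; this makes the limits along a Cauchy sequence of
  operators Cauchy again.\<close>

lemma lim_of_dist:
  assumes "lim_of f L" "lim_of g M" "f \<in> bop" "g \<in> bop"
  shows "norm (L - M) \<le> norm (f - g)"
proof (rule tendsto_upperbound[OF tendsto_norm[OF tendsto_diff[OF assms(1,2)]]])
  show "\<forall>\<^sub>F r in at_left 1. norm (berezin k n (scale_tuple r T) f - berezin k n (scale_tuple r T) g) \<le> norm (f - g)"
  proof (rule eventually_mono[OF eventually_berezin_data])
    fix r assume r: "berezin_data (scale_tuple r T)"
    show "norm (berezin k n (scale_tuple r T) f - berezin k n (scale_tuple r T) g) \<le> norm (f - g)"
      using norm_berezin_le[OF r bop_diff[OF assms(3,4)]] by (simp add: berezin_diff[OF r assms(3,4)])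
  qed
qed simp

lemma lim_of_exists:
  assumes "f \<in> cspan wick" shows "\<exists>L. lim_of f L"
proof -
  let ?Y = "{f. f \<in> bop \<and> (\<exists>L. lim_of f L)}"
  have mono: "\<exists>L. lim_of V L" if "V \<in> monomials" for V
    using that
  proof (induction rule: monomials.induct)
    case (shift_mono i s V)
    then show ?case
      using lim_of_compose[OF lim_of_shift _ polyball_algebra_gens(2) monomials_bop] by blast
  qed (use lim_of_fock_id in blast)
  have "cspan wick \<subseteq> ?Y"
  proof (rule cspan_minimal)
    show "wick \<subseteq> ?Y"
    proof
      fix X assume X: "X \<in> wick"
      then obtain c U V where X_eq: "X = c *\<^sub>C (V o\<^sub>L adj U)" and UV: "U \<in> monomials" "V \<in> monomials"
        by (auto simp: wick_def)
      obtain L M where "lim_of U L" "lim_of V M" using mono UV by blast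
      then have "lim_of X (c *\<^sub>C (M o\<^sub>L adj L))"
        unfolding X_eq using UV
        by (intro lim_of_scaleC lim_of_compose lim_of_adj)
          (simp_all add: monomials_subset monomials_bop bop_compose)
      then show "X \<in> ?Y" using X wick_bop by blast
    qed
    show "subspace ?Y"
      unfolding subspace_def
    proof (intro conjI ballI allI)
      \<comment> \<open>Zero is reached as a multiple of the Fock projection, whose limit is
        known.\<close>
      have "lim_of (0 *\<^sub>C P) (0 *\<^sub>C id_blinfun)" by (rule lim_of_scaleC[OF lim_of_fock_id fock_id_bop])
      moreover have "0 *\<^sub>C P = 0" using scaleR_scaleC_blinfun[of 0 P] by simp
      ultimately show "0 \<in> ?Y" by auto
    next
      fix f g assume "f \<in> ?Y" "g \<in> ?Y"
      then show "f + g \<in> ?Y" using lim_of_add bop_add by blast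
    next
      fix c f assume "f \<in> ?Y"
      then show "c *\<^sub>R f \<in> ?Y" unfolding scaleR_scaleC_blinfun using lim_of_scaleC bop_scale by blast
    qed
    show "closed ?Y"
      unfolding closed_sequential_limits
    proof (intro allI impI)
      fix X l assume "(\<forall>i::nat. X i \<in> ?Y) \<and> X \<longlonglongrightarrow> l"
      then have X: "\<And>i. X i \<in> bop" "X \<longlonglongrightarrow> l" and "\<forall>i. \<exists>L. lim_of (X i) L" by auto
      then obtain G where G: "\<And>i. lim_of (X i) (G i)" by metis
      have "Cauchy G"
      proof (rule metric_CauchyI)
        fix e :: real assume "0 < e"
        then obtain N where N: "\<And>i j. i \<ge> N \<Longrightarrow> j \<ge> N \<Longrightarrow> dist (X i) (X j) < e"
          using metric_CauchyD[OF LIMSEQ_imp_Cauchy[OF X(2)]] by blast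
        have "dist (G i) (G j) < e" if "i \<ge> N" "j \<ge> N" for i j
          using lim_of_dist[OF G[of i] G[of j] X(1) X(1)] N[OF that] by (simp add: dist_norm)
        then show "\<exists>N. \<forall>i\<ge>N. \<forall>j\<ge>N. dist (G i) (G j) < e" by blast
      qed
      then obtain L where "G \<longlonglongrightarrow> L" using Cauchy_convergent convergent_def by blast
      then have "lim_of l L" by (rule lim_of_closed[OF X G])
      moreover have "l \<in> bop" by (rule closed_sequentially[OF closed_bop X])
      ultimately show "l \<in> ?Y" by blast
    qed
  qed
  then show ?thesis using assms by blast
qed

text \<open>On monomials the radial limit and the transform of T are the same product of entries of
  T. Adjoints, scalars and contractivity carry the agreement to the closed span.\<close>

lemma lim_of_pure:
  assumes pure: "pure_tuple k n T" and f: "f \<in> cspan wick"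
  shows "lim_of f (berezin k n T f)"
proof -
  let ?B = "berezin k n T"
  let ?Y = "{f. f \<in> bop \<and> lim_of f (?B f)}"
  note T' = berezin_data_pure[OF T pure]
  have mono: "lim_of V (?B V)" if "V \<in> monomials" for V
    using that
  proof (induction rule: monomials.induct)
    case fock_id_mono
    show ?case using lim_of_fock_id by (simp add: berezin_fock_id[OF T'])
  next
    case (shift_mono i s V)
    have "lim_of (S i s o\<^sub>L V) (T i s o\<^sub>L ?B V)"
      using shift_mono by (intro lim_of_compose lim_of_shift polyball_algebra_gens monomials_bop)
    then show ?case
      using shift_mono by (simp add: berezin_compose[OF T'] polyball_algebra_gens monomials_bop berezin_shift[OF T'])
  qed
  have "cspan wick \<subseteq> ?Y"
  proof (rule cspan_minimal)
    show "wick \<subseteq> ?Y"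
    proof
      fix X assume X: "X \<in> wick"
      then obtain c U V where X_eq: "X = c *\<^sub>C (V o\<^sub>L adj U)" and UV: "U \<in> monomials" "V \<in> monomials"
        by (auto simp: wick_def)
      note b = monomials_bop[OF UV(1)] monomials_bop[OF UV(2)]
      have "lim_of X (c *\<^sub>C (?B V o\<^sub>L adj (?B U)))"
        unfolding X_eq using UV
        by (intro lim_of_scaleC lim_of_compose lim_of_adj mono)
          (simp_all add: monomials_subset b bop_compose)
      also have "c *\<^sub>C (?B V o\<^sub>L adj (?B U)) = ?B X"
        unfolding X_eq
        by (simp add: berezin_scaleC[OF T'] berezin_compose[OF T'] berezin_adj[OF T'] b bop_compose
            monomials_subset UV)
      finally show "X \<in> ?Y" using X wick_bop by blast
    qed
    show "subspace ?Y"
      unfolding subspace_def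
    proof (intro conjI ballI allI)
      have z: "0 *\<^sub>C P = 0" using scaleR_scaleC_blinfun[of 0 P] by simp
      have "lim_of (0 *\<^sub>C P) (0 *\<^sub>C ?B P)"
        by (rule lim_of_scaleC[OF mono[OF fock_id_mono] fock_id_bop])
      then have "lim_of (0 *\<^sub>C P) (?B (0 *\<^sub>C P))" by (simp only: berezin_scaleC[OF T' fock_id_bop])
      then show "0 \<in> ?Y" by (simp add: z)
    next
      fix f g assume "f \<in> ?Y" "g \<in> ?Y"
      then show "f + g \<in> ?Y" using lim_of_add[of f "?B f" g "?B g"] by (simp add: bop_add berezin_add[OF T'])
    next
      fix c f assume "f \<in> ?Y"
      then show "c *\<^sub>R f \<in> ?Y"
        using lim_of_scaleC[of f "?B f" "complex_of_real c"]
        by (simp add: scaleR_scaleC_blinfun bop_scale berezin_scaleC[OF T'])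
    qed
    show "closed ?Y"
      unfolding closed_sequential_limits
    proof (intro allI impI)
      fix X l assume "(\<forall>i::nat. X i \<in> ?Y) \<and> X \<longlonglongrightarrow> l"
      then have X: "\<And>i. X i \<in> bop" "X \<longlonglongrightarrow> l" and G: "\<And>i. lim_of (X i) (?B (X i))" by auto
      have l: "l \<in> bop" by (rule closed_sequentially[OF closed_bop X])
      have "(\<lambda>i. ?B (X i) - ?B l) \<longlonglongrightarrow> 0"
      proof (rule tendsto_0_le[OF LIM_zero[OF X(2)], where K = 1])
        show "\<forall>\<^sub>F i in sequentially. norm (?B (X i) - ?B l) \<le> norm (X i - l) * 1"
          using norm_berezin_le[OF T' bop_diff[OF X(1) l]]
          by (intro always_eventually allI) (simp add: berezin_diff[OF T' X(1) l])
      qed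
      then have "lim_of l (?B l)" by (rule lim_of_closed[OF X G LIM_zero_cancel])
      with l show "l \<in> ?Y" by blast
    qed
  qed
  then show ?thesis using f by blast
qed

section \<open>The limit map and its properties\<close>

lemma Psi_eqI: "lim_of f L \<Longrightarrow> Psi k n T f = L"
  unfolding Psi_def by (rule tendsto_Lim[OF trivial_limit_at_left_real])

abbreviation "\<C> \<equiv> shift_cstar_algebra k n lam"

lemma Psi_lim: "f \<in> \<C> \<Longrightarrow> lim_of f (Psi k n T f)"
  using lim_of_exists Psi_eqI shift_cstar_subset by blast

lemma shift_cstar_bop: "f \<in> \<C> \<Longrightarrow> f \<in> bop"
  using shift_cstar_subset cspan_wick_bop by blast

lemma Psi_linear: "linear_map_on \<C> (Psi k n T)"
  unfolding linear_map_on_def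
proof (intro conjI ballI allI)
  show "Psi k n T f \<in> bop" if "f \<in> \<C>" for f
    by (rule lim_of_bop[OF Psi_lim shift_cstar_bop]) fact+
  show "Psi k n T (f + g) = Psi k n T f + Psi k n T g" if "f \<in> \<C>" "g \<in> \<C>" for f g
    by (intro Psi_eqI lim_of_add Psi_lim shift_cstar_bop that)
  show "Psi k n T (c *\<^sub>C f) = c *\<^sub>C Psi k n T f" if "f \<in> \<C>" for c f
    by (intro Psi_eqI lim_of_scaleC Psi_lim shift_cstar_bop that)
qed

text \<open>For a fixed vector only finitely many entries are involved, so the matrix bound, which
  is uniform in r, passes to the limit.\<close>

lemma Psi_completely_contractive: "completely_contractive_on \<C> (Psi k n T)"
  unfolding completely_contractive_on_def
proof (intro allI impI)
  fix m :: nat and F :: "nat \<Rightarrow> nat \<Rightarrow> fock_op" assume "\<forall>i<m. \<forall>j<m. F i j \<in> \<C>"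
  then have F: "F i j \<in> \<C>" if "i < m" "j < m" for i j using that by blast
  show "op_matrix_norm m (\<lambda>i j. Psi k n T (F i j)) \<le> op_matrix_norm m F"
  proof (rule op_matrix_norm_leI)
    fix x :: "nat \<Rightarrow> 'h" assume x: "L2_set (\<lambda>j. norm (x j)) {..<m} \<le> 1"
    show "L2_set (\<lambda>i. norm (\<Sum>j<m. Psi k n T (F i j) (x j))) {..<m} \<le> op_matrix_norm m F"
    proof (rule tendsto_upperbound)
      show "((\<lambda>r. L2_set (\<lambda>i. norm (\<Sum>j<m. berezin k n (scale_tuple r T) (F i j) (x j))) {..<m})
        \<longlongrightarrow> L2_set (\<lambda>i. norm (\<Sum>j<m. Psi k n T (F i j) (x j))) {..<m}) (at_left 1)"
        unfolding L2_set_def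
        by (intro tendsto_real_sqrt tendsto_sum tendsto_power tendsto_norm blinfun.tendsto Psi_lim F tendsto_const) auto
      show "\<forall>\<^sub>F r in at_left 1.
        L2_set (\<lambda>i. norm (\<Sum>j<m. berezin k n (scale_tuple r T) (F i j) (x j))) {..<m} \<le> op_matrix_norm m F"
      proof (rule eventually_mono[OF eventually_berezin_data])
        fix r assume r: "berezin_data (scale_tuple r T)"
        have "L2_set (\<lambda>i. norm (\<Sum>j<m. berezin k n (scale_tuple r T) (F i j) (x j))) {..<m}
          \<le> op_matrix_norm m F * L2_set (\<lambda>j. norm (x j)) {..<m}"
          by (rule berezin_matrix_bound[OF r]) (intro shift_cstar_bop F)
        also have "\<dots> \<le> op_matrix_norm m F"
          using mult_left_mono[OF x op_matrix_norm_nonneg[of m F]] by simp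
        finally show "L2_set (\<lambda>i. norm (\<Sum>j<m. berezin k n (scale_tuple r T) (F i j) (x j))) {..<m}
          \<le> op_matrix_norm m F" .
      qed
    qed simp
  qed
qed

lemma Psi_homomorphism: "homomorphism_on (polyball_algebra k n lam) (Psi k n T)"
  unfolding homomorphism_on_def
proof
  show "linear_map_on (polyball_algebra k n lam) (Psi k n T)"
    using Psi_linear polyball_algebra_subset unfolding linear_map_on_def by blast
  show "\<forall>f\<in>polyball_algebra k n lam. \<forall>g\<in>polyball_algebra k n lam.
      Psi k n T (f o\<^sub>L g) = Psi k n T f o\<^sub>L Psi k n T g"
    using polyball_algebra_subset
    by (intro ballI Psi_eqI lim_of_compose Psi_lim polyball_algebra_bop) auto
qed

lemma Psi_pure: "pure_tuple k n T \<Longrightarrow> f \<in> \<C> \<Longrightarrow> Psi k n T f = berezin k n T f"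
  using shift_cstar_subset by (intro Psi_eqI lim_of_pure) auto

end

end

theorem theorem4p9:
  fixes k :: nat and n :: "nat \<Rightarrow> nat"
    and lam :: "nat \<Rightarrow> nat \<Rightarrow> nat \<Rightarrow> nat \<Rightarrow> complex"
    and T :: "nat \<Rightarrow> nat \<Rightarrow> ('h::chilbert_space \<Rightarrow>\<^sub>L 'h)"
  assumes "k \<ge> 1"
    and "\<And>i. i \<in> {1..k} \<Longrightarrow> n i \<ge> 1"
    and "\<And>i j s t. i \<in> {1..k} \<Longrightarrow> j \<in> {1..k} \<Longrightarrow> i \<noteq> j \<Longrightarrow> s \<in> {1..n i} \<Longrightarrow> t \<in> {1..n j} \<Longrightarrow>
      cmod (lam i j s t) = 1"
    and "\<And>i j s t. i \<in> {1..k} \<Longrightarrow> j \<in> {1..k} \<Longrightarrow> i \<noteq> j \<Longrightarrow> s \<in> {1..n i} \<Longrightarrow> t \<in> {1..n j} \<Longrightarrow>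
      lam j i t s = cnj (lam i j s t)"
    and "T \<in> polyball k n lam"
  shows "(\<forall>f \<in> shift_cstar_algebra k n lam.
          ((\<lambda>r. berezin k n (scale_tuple r T) f) \<longlongrightarrow> Psi k n T f) (at_left 1))
    \<and> linear_map_on (shift_cstar_algebra k n lam) (Psi k n T)
    \<and> completely_contractive_on (shift_cstar_algebra k n lam) (Psi k n T)
    \<and> polyball_algebra k n lam \<subseteq> shift_cstar_algebra k n lam
    \<and> homomorphism_on (polyball_algebra k n lam) (Psi k n T)
    \<and> completely_contractive_on (polyball_algebra k n lam) (Psi k n T)
    \<and> (pure_tuple k n T \<longrightarrow> (\<forall>f \<in> shift_cstar_algebra k n lam. Psi k n T f = berezin k n T f))"
proof -
  interpret polyball_shifts k n lam
    by unfold_locales (fact assms)+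
  note T = \<open>T \<in> polyball k n lam\<close>
  have "completely_contractive_on (polyball_algebra k n lam) (Psi k n T)"
    using Psi_completely_contractive[OF T] polyball_algebra_subset
    unfolding completely_contractive_on_def by blast
  then show ?thesis
    using Psi_lim[OF T] Psi_linear[OF T] Psi_completely_contractive[OF T] polyball_algebra_subset
      Psi_homomorphism[OF T] Psi_pure[OF T]
    by blast
qed

end
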